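(* Let $H_1,\dots,H_m\in C^2(T^*M\times\mathbb{R}^m,\mathbb{R})$ satisfy assumptions (H1)–(H3) listed in the context, and let $\varphi=(\varphi_1,\dots,\varphi_m)\in C(M,\mathbb{R}^m)$. Then the Cauchy problem $$\partial_t u_i+H_i(x,\partial_x u_i,\mathbf{u})=0\ \text{ on } M\times[0,\infty),\qquad \mathbf{u}(x,0)=\varphi(x)\ \text{ for } x\in M,\qquad 1\le i\le m,$$ has a unique viscosity solution $\mathbf{u}=(u_1,\dots,u_m)\in C(M\times[0,\infty),\mathbb{R}^m)$, and it can be represented, for all $1\le i\le m$ and $(x,t)\in M\times[0,\infty)$, by $$u_i(x,t)=\inf_{\substack{\gamma_i(t)=x\\ \gamma_i\in C^{ac}([0,t],M)}}\Big\{\varphi_i(\gamma_i(0))+\int_0^t L_i(\gamma_i(s),\dot\gamma_i(s),\mathbf{u}(\gamma_i(s),s))\,ds\Big\}.$$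
   Context: $n,m>1$ are fixed integers, $M=\mathbb{T}^n$ is the flat $n$-torus, $T_xM$ and $T_x^*M$ are identified with $\mathbb{R}^n$ with Euclidean norm $|\cdot|$ and scalar product $\langle\cdot,\cdot\rangle$; $\|v\|=\max_{1\le i\le m}|v_i|$ for $v\in\mathbb{R}^m$. $C^{ac}([a,b],M)$ is the set of absolutely continuous curves $[a,b]\to M$. Assumptions, for each $1\le i\le m$: (H1) $H_i(x,p,\mathbf{u})$ is strictly convex in $p$. (H2) $H_i$ is superlinear in $p$: for every $(x,\mathbf{u})$, $H_i(x,p,\mathbf{u})/|p|\to\infty$ as $|p|\to\infty$. (H3) There is $\Theta>0$ with $|H_i(x,p,\mathbf{u})-H_i(x,p,\mathbf{v})|\le\Theta\|\mathbf{u}-\mathbf{v}\|$ for all $x,p,\mathbf{u},\mathbf{v}$. $L_i:TM\times\mathbb{R}^m\to\mathbb{R}$ is the convex dual $L_i(x,\dot x,\mathbf{u})=\sup_{p\in T_x^*M}\{\langle p,\dot x\rangle-H_i(x,p,\mathbf{u})\}$. Viscosity solution: a continuous $\mathbf{u}:M\times[0,\infty)\to\mathbb{R}^m$ is a viscosity subsolution of the Cauchy problem if for each $1\le i\le m$: $u_i(\cdot,0)\le\varphi_i$ on $M$, and whenever $\phi$ is a real-valued $C^1$ function on a neighborhood of $(x,t)$, $t>0$, such that $u_i-\phi$ attains a local maximum at $(x,t)$, one has $\partial_t\phi(x,t)+H_i(x,\partial_x\phi(x,t),\mathbf{u}(x,t))\le0$. It is a viscosity supersolution if for each $i$: $u_i(\cdot,0)\ge\varphi_i$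 on $M$, and whenever $\phi$ is $C^1$ near $(x,t)$, $t>0$, and $u_i-\phi$ attains a local minimum at $(x,t)$, one has $\partial_t\phi(x,t)+H_i(x,\partial_x\phi(x,t),\mathbf{u}(x,t))\ge0$. It is a viscosity solution if it is both. *)

theory Defs
  imports "HOL-Analysis.Analysis"
begin

section \<open>The flat torus\<close>

definition int_lattice :: "(real ^ 'n) set" where
  "int_lattice = {k. \<forall>i. k $ i \<in> \<int>}"

lemma int_lattice_0: "0 \<in> int_lattice"
  by (simp add: int_lattice_def)

lemma int_lattice_uminus: "k \<in> int_lattice \<Longrightarrow> - k \<in> int_lattice"
  by (simp add: int_lattice_def)

lemma int_lattice_add: "k \<in> int_lattice \<Longrightarrow> l \<in> int_lattice \<Longrightarrow> k + l \<in> int_lattice"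
  by (simp add: int_lattice_def)

lemma closed_int_lattice: "closed (int_lattice :: (real ^ 'n) set)"
proof -
  have "int_lattice = (\<Inter>i. (\<lambda>k :: real ^ 'n. k $ i) -` \<int>)"
    by (auto simp: int_lattice_def)
  moreover have "closed ((\<lambda>k :: real ^ 'n. k $ i) -` \<int>)" for i
    by (rule continuous_closed_vimage) (auto simp: Ints_def intro: closed_of_int_image)
  ultimately show ?thesis
    by (metis closed_INT)
qed

definition torus_rel :: "real ^ 'n \<Rightarrow> real ^ 'n \<Rightarrow> bool" where
  "torus_rel X Y \<longleftrightarrow> X - Y \<in> int_lattice"

lemma equivp_torus_rel: "equivp (torus_rel :: real ^ 'n \<Rightarrow> real ^ 'n \<Rightarrow> bool)"
proof (rule equivpI)
  show "reflp (torus_rel :: real ^ 'n \<Rightarrow> _)"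
    by (simp add: reflp_def torus_rel_def int_lattice_0)
  show "symp (torus_rel :: real ^ 'n \<Rightarrow> _)"
    unfolding symp_def torus_rel_def by (metis int_lattice_uminus minus_diff_eq)
  show "transp (torus_rel :: real ^ 'n \<Rightarrow> _)"
    unfolding transp_def torus_rel_def by (metis int_lattice_add diff_add_cancel add_diff_eq)
qed

quotient_type (overloaded) 'n torus = "real ^ ('n :: finite)" / torus_rel
  by (rule equivp_torus_rel)

lift_definition to_torus :: "real ^ ('n :: finite) \<Rightarrow> 'n torus" is "\<lambda>X. X" .

lemma infdist_add_lattice:
  fixes X k :: "real ^ 'n"
  assumes "k \<in> int_lattice"
  shows "infdist (X + k) int_lattice \<le> infdist X int_lattice"
proof -
  have ne: "int_lattice \<noteq> ({} :: (real ^ 'n) set)"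
    using int_lattice_0 by auto
  obtain l where l: "l \<in> int_lattice" "infdist X int_lattice = dist X l"
    using infdist_attains_inf[OF closed_int_lattice ne] by blast
  have "infdist (X + k) int_lattice \<le> dist (X + k) (l + k)"
    by (intro infdist_le int_lattice_add l assms)
  then show ?thesis using l by simp
qed

lemma infdist_lattice_cong:
  fixes X Y :: "real ^ 'n"
  assumes "X - Y \<in> int_lattice"
  shows "infdist X int_lattice = infdist Y int_lattice"
  using infdist_add_lattice[OF assms, of Y] infdist_add_lattice[OF int_lattice_uminus[OF assms], of X]
  by simp

text \<open>The flat metric: the distance of two points of the torus is the least Euclidean distance
  between representatives.\<close>

instantiation torus :: (finite) metric_space
begin

lift_definition dist_torus :: "'a torus \<Rightarrow> 'a torus \<Rightarrow> real"
  is "\<lambda>X Y. infdist (X - Y) int_lattice"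
proof -
  fix X X' Y Y' :: "real ^ 'a"
  assume "torus_rel X X'" "torus_rel Y Y'"
  then have "(X - X') + - (Y - Y') \<in> int_lattice"
    unfolding torus_rel_def by (intro int_lattice_add int_lattice_uminus)
  also have "(X - X') + - (Y - Y') = (X - Y) - (X' - Y')" by simp
  finally show "infdist (X - Y) int_lattice = infdist (X' - Y') int_lattice"
    by (rule infdist_lattice_cong)
qed

definition uniformity_torus :: "('a torus \<times> 'a torus) filter" where
  "uniformity_torus = (INF e\<in>{0<..}. principal {(x, y). dist x y < e})"

definition open_torus :: "'a torus set \<Rightarrow> bool" where
  "open_torus U \<longleftrightarrow> (\<forall>x\<in>U. eventually (\<lambda>(x', y). x' = x \<longrightarrow> y \<in> U) uniformity)"

instance
proof
  have ne: "int_lattice \<noteq> ({} :: (real ^ 'a) set)"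
    using int_lattice_0 by auto
  show "dist x y = 0 \<longleftrightarrow> x = y" for x y :: "'a torus"
    by transfer
      (simp add: torus_rel_def in_closed_iff_infdist_zero[OF closed_int_lattice ne])
  show "dist x y \<le> dist x z + dist y z" for x y z :: "'a torus"
  proof transfer
    fix X Y Z :: "real ^ 'a"
    obtain k where k: "k \<in> int_lattice" "infdist (X - Z) int_lattice = dist (X - Z) k"
      using infdist_attains_inf[OF closed_int_lattice ne] by blast
    obtain l where l: "l \<in> int_lattice" "infdist (Y - Z) int_lattice = dist (Y - Z) l"
      using infdist_attains_inf[OF closed_int_lattice ne] by blast
    have "infdist (X - Y) int_lattice \<le> dist (X - Y) (k + - l)"
      by (intro infdist_le int_lattice_add int_lattice_uminus k l)
    also have "\<dots> = norm ((X - Z - k) - (Y - Z - l))"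
      by (simp add: dist_norm algebra_simps)
    also have "\<dots> \<le> dist (X - Z) k + dist (Y - Z) l"
      unfolding dist_norm by (rule norm_triangle_ineq4)
    finally show "infdist (X - Y) int_lattice
        \<le> infdist (X - Z) int_lattice + infdist (Y - Z) int_lattice"
      using k l by simp
  qed
qed (simp_all add: uniformity_torus_def open_torus_def)

end


section \<open>Regularity\<close>

text \<open>Functions involving a torus variable are differentiated after composition with
  \<^const>\<open>to_torus\<close>, whose local inverses are the charts of the flat torus.\<close>

definition C1_on :: "'a::real_normed_vector set \<Rightarrow> ('a \<Rightarrow> 'b::real_normed_vector) \<Rightarrow> bool" where
  "C1_on S f \<longleftrightarrow> (\<exists>f' :: 'a \<Rightarrow> 'a \<Rightarrow>\<^sub>L 'b.
     (\<forall>x\<in>S. (f has_derivative blinfun_apply (f' x)) (at x)) \<and> continuous_on S f')"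

definition C2_on :: "'a::real_normed_vector set \<Rightarrow> ('a \<Rightarrow> 'b::real_normed_vector) \<Rightarrow> bool" where
  "C2_on S f \<longleftrightarrow> (\<exists>f' :: 'a \<Rightarrow> 'a \<Rightarrow>\<^sub>L 'b.
     (\<forall>x\<in>S. (f has_derivative blinfun_apply (f' x)) (at x)) \<and> C1_on S f')"

definition abs_continuous_on :: "real \<Rightarrow> real \<Rightarrow> (real \<Rightarrow> 'a::metric_space) \<Rightarrow> bool" where
  "abs_continuous_on a b \<gamma> \<longleftrightarrow>
     (\<forall>\<epsilon>>0. \<exists>\<delta>>0. \<forall>D :: (real \<times> real) set.
        finite D \<longrightarrow>
        (\<forall>(c, d)\<in>D. a \<le> c \<and> c \<le> d \<and> d \<le> b) \<longrightarrow>
        pairwise (\<lambda>I J. {fst I<..<snd I} \<inter> {fst J<..<snd J} = {}) D \<longrightarrow>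
        (\<Sum>(c, d)\<in>D. d - c) < \<delta> \<longrightarrow>
        (\<Sum>(c, d)\<in>D. dist (\<gamma> c) (\<gamma> d)) < \<epsilon>)"

definition has_velocity :: "(real \<Rightarrow> 'n::finite torus) \<Rightarrow> real ^ 'n \<Rightarrow> real \<Rightarrow> bool" where
  "has_velocity \<gamma> w s \<longleftrightarrow>
     (\<exists>c. (c has_vector_derivative w) (at s) \<and> (\<forall>\<^sub>F r in nhds s. \<gamma> r = to_torus (c r)))"

text \<open>Unspecified at the points where the curve is not differentiable, which form a null set
  if the curve is absolutely continuous.\<close>

definition velocity :: "(real \<Rightarrow> 'n::finite torus) \<Rightarrow> real \<Rightarrow> real ^ 'n" where
  "velocity \<gamma> s = (THE w. has_velocity \<gamma> w s)"


section \<open>Hamiltonians and Lagrangians\<close>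

text \<open>The cotangent bundle of the torus is trivial, so a Hamiltonian on
  $T^*M \times R^m$ is a function of a point of the torus, a momentum and a value.\<close>

type_synonym ('n, 'm) hamiltonian = "'n torus \<Rightarrow> real ^ 'n \<Rightarrow> real ^ 'm \<Rightarrow> real"

definition C2_hamiltonian :: "('n::finite, 'm::finite) hamiltonian \<Rightarrow> bool" where
  "C2_hamiltonian h \<longleftrightarrow> C2_on UNIV (\<lambda>(X, p, u). h (to_torus X) p u)"

definition strictly_convex :: "('a::real_vector \<Rightarrow> real) \<Rightarrow> bool" where
  "strictly_convex f \<longleftrightarrow>
     (\<forall>p q. p \<noteq> q \<longrightarrow> (\<forall>a. 0 < a \<longrightarrow> a < 1 \<longrightarrow>
        f ((1 - a) *\<^sub>R p + a *\<^sub>R q) < (1 - a) * f p + a * f q))"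

definition superlinear :: "('a::real_normed_vector \<Rightarrow> real) \<Rightarrow> bool" where
  "superlinear f \<longleftrightarrow> filterlim (\<lambda>p. f p / norm p) at_top at_infinity"

text \<open>\<^const>\<open>infnorm\<close> is the maximum norm of the components.\<close>

definition Lipschitz_in_value :: "('n::finite, 'm::finite) hamiltonian \<Rightarrow> bool" where
  "Lipschitz_in_value h \<longleftrightarrow>
     (\<exists>\<Theta>>0. \<forall>x p u v. \<bar>h x p u - h x p v\<bar> \<le> \<Theta> * infnorm (u - v))"

text \<open>For superlinear continuous Hamiltonians the set is bounded above, so that this real
  supremum is the convex dual.\<close>

definition lagrangian ::
  "('n::finite, 'm::finite) hamiltonian \<Rightarrow> 'n torus \<Rightarrow> real ^ 'n \<Rightarrow> real ^ 'm \<Rightarrow> real" where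
  "lagrangian h x v u = (SUP p. p \<bullet> v - h x p u)"


section \<open>Viscosity solutions\<close>

text \<open>Space-time functions are given on all of $M \times R$; only their values at
  times $t \ge 0$ matter. In the following definitions \<open>X\<close> is a representative of the
  torus point $x$, \<open>q\<close> is $\partial_x \phi(x,t)$ and \<open>\<tau>\<close> is $\partial_t \phi(x,t)$.\<close>

definition C1_near ::
  "'n::finite torus \<times> real \<Rightarrow> ('n torus \<times> real \<Rightarrow> real) \<Rightarrow> bool" where
  "C1_near z \<phi> \<longleftrightarrow> (\<exists>W. open W \<and> z \<in> W \<and>
     C1_on {(Y, s). (to_torus Y, s) \<in> W} (\<lambda>(Y, s). \<phi> (to_torus Y, s)))"

definition viscosity_subsolution ::
  "('m::finite \<Rightarrow> ('n::finite, 'm) hamiltonian) \<Rightarrow> ('n torus \<Rightarrow> real ^ 'm) \<Rightarrow>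
   ('n torus \<times> real \<Rightarrow> real ^ 'm) \<Rightarrow> bool" where
  "viscosity_subsolution H \<phi>\<^sub>0 u \<longleftrightarrow>
     continuous_on (UNIV \<times> {0..}) u \<and>
     (\<forall>i.
       (\<forall>x. u (x, 0) $ i \<le> \<phi>\<^sub>0 x $ i) \<and>
       (\<forall>X t \<phi> q \<tau>.
          0 < t \<longrightarrow>
          C1_near (to_torus X, t) \<phi> \<longrightarrow>
          (\<forall>\<^sub>F z in nhds (to_torus X, t).
             u z $ i - \<phi> z \<le> u (to_torus X, t) $ i - \<phi> (to_torus X, t)) \<longrightarrow>
          (GDERIV (\<lambda>Y. \<phi> (to_torus Y, t)) X :> q) \<longrightarrow>
          ((\<lambda>s. \<phi> (to_torus X, s)) has_real_derivative \<tau>) (at t) \<longrightarrow>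
          \<tau> + H i (to_torus X) q (u (to_torus X, t)) \<le> 0))"

definition viscosity_supersolution ::
  "('m::finite \<Rightarrow> ('n::finite, 'm) hamiltonian) \<Rightarrow> ('n torus \<Rightarrow> real ^ 'm) \<Rightarrow>
   ('n torus \<times> real \<Rightarrow> real ^ 'm) \<Rightarrow> bool" where
  "viscosity_supersolution H \<phi>\<^sub>0 u \<longleftrightarrow>
     continuous_on (UNIV \<times> {0..}) u \<and>
     (\<forall>i.
       (\<forall>x. u (x, 0) $ i \<ge> \<phi>\<^sub>0 x $ i) \<and>
       (\<forall>X t \<phi> q \<tau>.
          0 < t \<longrightarrow>
          C1_near (to_torus X, t) \<phi> \<longrightarrow>
          (\<forall>\<^sub>F z in nhds (to_torus X, t).
             u z $ i - \<phi> z \<ge> u (to_torus X, t) $ i - \<phi> (to_torus X, t)) \<longrightarrow>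
          (GDERIV (\<lambda>Y. \<phi> (to_torus Y, t)) X :> q) \<longrightarrow>
          ((\<lambda>s. \<phi> (to_torus X, s)) has_real_derivative \<tau>) (at t) \<longrightarrow>
          \<tau> + H i (to_torus X) q (u (to_torus X, t)) \<ge> 0))"

definition viscosity_solution ::
  "('m::finite \<Rightarrow> ('n::finite, 'm) hamiltonian) \<Rightarrow> ('n torus \<Rightarrow> real ^ 'm) \<Rightarrow>
   ('n torus \<times> real \<Rightarrow> real ^ 'm) \<Rightarrow> bool" where
  "viscosity_solution H \<phi>\<^sub>0 u \<longleftrightarrow>
     viscosity_subsolution H \<phi>\<^sub>0 u \<and> viscosity_supersolution H \<phi>\<^sub>0 u"


section \<open>The action\<close>

text \<open>The integral of the positive part minus the integral of the negative part. For continuous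
  \<open>u\<close> the Lagrangian is bounded below along a curve, so \<open>\<infinity> - \<infinity>\<close> does not occur in
  the action below. The action may be \<open>\<infinity>\<close>, in which case the Bochner integral would be \<open>0\<close>.\<close>

definition extended_integral :: "real set \<Rightarrow> (real \<Rightarrow> real) \<Rightarrow> ereal" where
  "extended_integral S f =
     enn2ereal (\<integral>\<^sup>+s\<in>S. ennreal (f s) \<partial>lebesgue) - enn2ereal (\<integral>\<^sup>+s\<in>S. ennreal (- f s) \<partial>lebesgue)"

definition action ::
  "('n::finite, 'm::finite) hamiltonian \<Rightarrow> ('n torus \<times> real \<Rightarrow> real ^ 'm) \<Rightarrow> real \<Rightarrow>
   (real \<Rightarrow> 'n torus) \<Rightarrow> ereal" where
  "action h u t \<gamma> =
     extended_integral {0..t} (\<lambda>s. lagrangian h (\<gamma> s) (velocity \<gamma> s) (u (\<gamma> s, s)))"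

end

theory Submission
  imports Defs
begin

text \<open>For given continuous \<open>v\<close>, let \<open>A v\<close> be the vector of value functions obtained by
  inserting \<open>v\<close> into the running costs \<open>L\<^sub>i\<close>. As \<open>L\<^sub>i\<close> is \<open>\<Theta>\<close>-Lipschitz in the value,
  uniformly in the velocity, \<open>A\<close> is a contraction for a norm with weight \<open>exp (- \<kappa> t)\<close>,
  and its fixed point satisfies the representation formula by construction. The dynamic
  programming principle, with straight lines for subsolutions and near optimal curves for
  supersolutions, shows that the fixed point is a viscosity solution; minimizers are not needed.
  Absolutely continuous curves are handled through their controls: such a curve lifts to the
  Euclidean space, where the Radon-Nikodym theorem and Lebesgue's differentiation theorem
  identify it with the indefinite integral of its velocity. Uniqueness is a doubling of variables
  for the whole system: at a maximum, over points and components, of the difference of two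
  solutions divided by \<open>exp (\<kappa> t)\<close>, the coupling is controlled by that same maximum.\<close>

section \<open>The torus\<close>

text \<open>A curve is encoded by its end point \<open>X\<close> in Euclidean space and its velocity
  \<open>g\<close>: cutting, concatenating and shifting in time become operations on
  \<open>g\<close>, and the constraint at the final time is built in. Controls whose running cost is
  not integrable are left out of the infimum; their action is infinite, because the Lagrangian is
  bounded below along a curve. As a supremum over momenta the Lagrangian is jointly lower
  semicontinuous; upper semicontinuity is obtained at a fixed velocity. Each half of the viscosity
  property therefore uses a bound in the available direction: for subsolutions, a constant velocity
  dual to the test momentum \<open>q\<close>, which exists as the Hamiltonian is convex and
  differentiable; for supersolutions, Fenchel's inequality at the single momentum \<open>q\<close>,
  with superlinearity bounding the length of near optimal curves. In the comparison argument the
  exponential weight does two jobs: a rate above \<Theta> beats the coupling, and a rate large in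
  terms of the size of the difference keeps the maximum away from the final time, where a maximum
  over [0, T] would not be a local one.\<close>

lemma to_torus_eq_iff: "to_torus X = to_torus Y \<longleftrightarrow> X - Y \<in> int_lattice"
  by transfer (simp add: torus_rel_def)

lemma to_torus_surj: "\<exists>X. to_torus X = x"
  by transfer (meson equivp_reflp equivp_torus_rel)

lemma dist_to_torus: "dist (to_torus X) (to_torus Y) = infdist (X - Y) int_lattice"
  by transfer simp

lemma to_torus_add_lattice: "k \<in> int_lattice \<Longrightarrow> to_torus (X + k) = to_torus X"
  by (simp add: to_torus_eq_iff)

lemma dist_to_torus_le: "dist (to_torus X) (to_torus Y) \<le> dist X Y"
proof -
  have "infdist (X - Y) int_lattice \<le> dist (X - Y) 0"
    by (intro infdist_le int_lattice_0)
  then show ?thesis by (simp add: dist_to_torus dist_norm)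
qed

lemma norm_int_lattice_ge_1:
  assumes "k \<in> int_lattice" "k \<noteq> 0"
  shows "1 \<le> norm k"
proof -
  obtain i where i: "k $ i \<noteq> 0" using assms(2) by (auto simp: vec_eq_iff)
  have "k $ i \<in> \<int>" using assms(1) by (simp add: int_lattice_def)
  then have "1 \<le> \<bar>k $ i\<bar>" using i by (auto elim!: Ints_cases)
  then show ?thesis using component_le_norm_cart[of k i] by linarith
qed

text \<open>The lattice is closed, so the infimum defining the distance is attained; translating by
  the minimizing lattice vector changes the representative and not the point. Local arguments on the
  torus become Euclidean through this nearest representative.\<close>

lemma to_torus_lift:
  obtains X where "to_torus X = x" "dist X Y = dist x (to_torus Y)"
proof -
  obtain Z where Z: "to_torus Z = x" using to_torus_surj by blast
  have ne: "int_lattice \<noteq> ({} :: (real ^ 'a) set)"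
    using int_lattice_0 by auto
  obtain k where k: "k \<in> int_lattice" "infdist (Z - Y) int_lattice = dist (Z - Y) k"
    using infdist_attains_inf[OF closed_int_lattice ne] by blast
  have "to_torus (Z + - k) = x"
    using Z to_torus_add_lattice[OF int_lattice_uminus[OF k(1)]] by simp
  moreover have "dist (Z + - k) Y = dist x (to_torus Y)"
    using k Z by (simp add: dist_to_torus dist_norm algebra_simps flip: Z)
  ultimately show ?thesis using that by blast
qed

text \<open>1/2 is half the length of a shortest nonzero lattice vector. The representative nearest
  to \<open>Y\<close> and \<open>X\<close> itself are both closer to \<open>Y\<close> than 1/2,
  hence differ by a lattice vector of norm below 1, which is 0.\<close>

lemma dist_to_torus_eq:
  assumes "dist X Y < 1 / 2"
  shows "dist (to_torus X) (to_torus Y) = dist X Y"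
proof (rule antisym[OF dist_to_torus_le])
  obtain Z where Z: "to_torus Z = to_torus X" "dist Z Y = dist (to_torus X) (to_torus Y)"
    using to_torus_lift by metis
  have "norm (Z - X) \<le> dist Z Y + dist X Y"
    by (metis dist_commute dist_norm dist_triangle)
  also have "\<dots> < 1"
    using Z(2) assms dist_to_torus_le[of X Y] by linarith
  finally have "Z - X = 0"
    using norm_int_lattice_ge_1[of "Z - X"] Z(1) to_torus_eq_iff by fastforce
  then show "dist X Y \<le> dist (to_torus X) (to_torus Y)"
    using Z(2) by simp
qed

lemma tendsto_to_torus [tendsto_intros]:
  assumes "(f \<longlongrightarrow> l) F"
  shows "((\<lambda>x. to_torus (f x)) \<longlongrightarrow> to_torus l) F"
proof (rule metric_tendsto_imp_tendsto[OF assms])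
  show "\<forall>\<^sub>F x in F. dist (to_torus (f x)) (to_torus l) \<le> dist (f x) l"
    by (simp add: dist_to_torus_le)
qed

lemma continuous_on_to_torus [continuous_intros]:
  assumes "continuous_on S f"
  shows "continuous_on S (\<lambda>x. to_torus (f x))"
  using assms unfolding continuous_on_def by (auto intro: tendsto_to_torus)

lemma compact_UNIV_torus: "compact (UNIV :: 'n::finite torus set)"
proof -
  have "(UNIV :: 'n torus set) \<subseteq> to_torus ` cbox 0 1"
  proof
    fix x :: "'n torus"
    obtain X where X: "to_torus X = x" using to_torus_surj by blast
    define k :: "real ^ 'n" where "k = (\<chi> i. - of_int \<lfloor>X $ i\<rfloor>)"
    have "k \<in> int_lattice" by (simp add: k_def int_lattice_def)
    then have "to_torus (X + k) = x" using X to_torus_add_lattice[of k X] by simp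
    moreover have "X + k \<in> cbox 0 1"
    proof -
      have "0 \<le> (X + k) $ i \<and> (X + k) $ i \<le> 1" for i
        unfolding k_def by simp linarith
      then show ?thesis by (simp add: mem_box_cart)
    qed
    ultimately show "x \<in> to_torus ` cbox 0 1" by blast
  qed
  then have "(UNIV :: 'n torus set) = to_torus ` cbox 0 1" by blast
  moreover have "compact (to_torus ` cbox (0 :: real ^ 'n) 1)"
    by (intro compact_continuous_image continuous_on_to_torus continuous_on_id compact_cbox)
  ultimately show ?thesis by simp
qed

text \<open>The nearest representative preserves the distance to the chosen base point, so the
  Euclidean radius serves unchanged on the torus.\<close>

lemma continuous_on_torus_Times:
  fixes f :: "'n::finite torus \<times> 'b::metric_space \<Rightarrow> 'c::metric_space"
  assumes "continuous_on (UNIV \<times> S) (\<lambda>(X, b). f (to_torus X, b))"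
  shows "continuous_on (UNIV \<times> S) f"
  unfolding continuous_on_iff
proof (intro ballI allI impI)
  fix z and e :: real
  assume z: "z \<in> (UNIV :: 'n torus set) \<times> S" and "0 < e"
  obtain x b where xb: "z = (x, b)" by (cases z)
  obtain X where X: "to_torus X = x" using to_torus_surj by blast
  obtain d where "d > 0" and
    d: "\<And>w. w \<in> UNIV \<times> S \<Longrightarrow> dist w (X, b) < d \<Longrightarrow>
        dist ((\<lambda>(X, b). f (to_torus X, b)) w) (f (to_torus X, b)) < e"
    using assms[unfolded continuous_on_iff, rule_format, of "(X, b)" e] z xb \<open>0 < e\<close> by auto
  show "\<exists>d>0. \<forall>z'\<in>UNIV \<times> S. dist z' z < d \<longrightarrow> dist (f z') (f z) < e"
  proof (intro exI conjI ballI impI)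
    fix z' assume z': "z' \<in> (UNIV :: 'n torus set) \<times> S" "dist z' z < d"
    obtain y c where yc: "z' = (y, c)" by (cases z')
    obtain Y where Y: "to_torus Y = y" "dist Y X = dist y x"
      using to_torus_lift[of y X] X by metis
    have "dist (Y, c) (X, b) = dist z' z"
      using Y by (simp add: yc xb dist_Pair_Pair)
    then show "dist (f z') (f z) < e"
      using d[of "(Y, c)"] z' by (simp add: yc xb X Y)
  qed (fact \<open>d > 0\<close>)
qed

lemma eventually_nhds_torus_lift:
  assumes "\<forall>\<^sub>F z in nhds (to_torus X, t). P z"
  shows "\<exists>d>0. \<forall>Y s. dist Y X < d \<longrightarrow> dist s t < d \<longrightarrow> P (to_torus Y, s)"
proof -
  have "((\<lambda>(Y, s). (to_torus Y, s)) \<longlongrightarrow> (to_torus X, t)) (nhds (X, t))"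
    by (auto simp: case_prod_beta' intro!: tendsto_eq_intros filterlim_ident)
  then have "\<forall>\<^sub>F w in nhds (X, t). P ((\<lambda>(Y, s). (to_torus Y, s)) w)"
    by (rule eventually_compose_filterlim[OF assms])
  then have "\<forall>\<^sub>F w in nhds X \<times>\<^sub>F nhds t. P ((\<lambda>(Y, s). (to_torus Y, s)) w)"
    by (simp add: nhds_prod)
  then obtain P1 P2 where "eventually P1 (nhds X)" "eventually P2 (nhds t)"
    and P: "\<And>Y s. P1 Y \<Longrightarrow> P2 s \<Longrightarrow> P (to_torus Y, s)"
    unfolding eventually_prod_filter by auto
  then obtain d1 d2 where "d1 > 0" "d2 > 0" "\<And>Y. dist Y X < d1 \<Longrightarrow> P1 Y" "\<And>s. dist s t < d2 \<Longrightarrow> P2 s"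
    unfolding eventually_nhds_metric by blast
  then show ?thesis by (intro exI[of _ "min d1 d2"]) (auto intro: P)
qed

section \<open>Absolutely continuous functions\<close>

definition interval_family :: "real \<Rightarrow> real \<Rightarrow> (real \<times> real) set \<Rightarrow> bool" where
  "interval_family a b D \<longleftrightarrow> finite D \<and> (\<forall>(c, d)\<in>D. a \<le> c \<and> c \<le> d \<and> d \<le> b) \<and>
     pairwise (\<lambda>I J. {fst I<..<snd I} \<inter> {fst J<..<snd J} = {}) D"

lemma abs_continuous_on_iff:
  "abs_continuous_on a b \<gamma> \<longleftrightarrow> (\<forall>e>0. \<exists>\<delta>>0. \<forall>D. interval_family a b D \<longrightarrow>
     (\<Sum>(c, d)\<in>D. d - c) < \<delta> \<longrightarrow> (\<Sum>(c, d)\<in>D. dist (\<gamma> c) (\<gamma> d)) < e)"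
  unfolding abs_continuous_on_def interval_family_def by (simp only: imp_conjL)

text \<open>An indexed family, unlike a set of intervals, may repeat degenerate intervals.\<close>

definition dist_sum_modulus :: "'i itself \<Rightarrow> (real \<Rightarrow> 'a::metric_space) \<Rightarrow> real \<Rightarrow> real \<Rightarrow> real \<Rightarrow> real \<Rightarrow> bool" where
  "dist_sum_modulus T \<gamma> a b e d \<longleftrightarrow>
     (\<forall>(I :: 'i set) p q. finite I \<longrightarrow> (\<forall>i\<in>I. a \<le> p i \<and> p i \<le> q i \<and> q i \<le> b) \<longrightarrow>
       (\<forall>i\<in>I. \<forall>j\<in>I. i \<noteq> j \<longrightarrow> {p i<..<q i} \<inter> {p j<..<q j} = {}) \<longrightarrow>
       (\<Sum>i\<in>I. q i - p i) < d \<longrightarrow> (\<Sum>i\<in>I. dist (\<gamma> (p i)) (\<gamma> (q i))) < e)"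

lemma dist_sum_modulusD:
  fixes I :: "'i set"
  assumes "dist_sum_modulus TYPE('i) \<gamma> a b e d" "finite I"
    and "\<And>i. i \<in> I \<Longrightarrow> a \<le> p i \<and> p i \<le> q i \<and> q i \<le> b"
    and "\<And>i j. i \<in> I \<Longrightarrow> j \<in> I \<Longrightarrow> i \<noteq> j \<Longrightarrow> {p i<..<q i} \<inter> {p j<..<q j} = {}"
    and "(\<Sum>i\<in>I. q i - p i) < d"
  shows "(\<Sum>i\<in>I. dist (\<gamma> (p i)) (\<gamma> (q i))) < e"
  using assms(1)[unfolded dist_sum_modulus_def, rule_format, OF assms(2), of p q] assms(3-5) by blast

text \<open>Degenerate members contribute 0 to both sums and are discarded. Among the others the
  interval determines the index, since two equal nondegenerate intervals would share their midpoint;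
  the indexed sums are then sums over a set of intervals.\<close>

lemma abs_continuous_on_modulus:
  fixes \<gamma> :: "real \<Rightarrow> 'a::metric_space"
  assumes "abs_continuous_on a b \<gamma>" "e > 0"
  shows "\<exists>d>0. dist_sum_modulus TYPE('i) \<gamma> a b e d"
proof -
  obtain d where "d > 0" and d: "\<And>D. interval_family a b D \<Longrightarrow>
        (\<Sum>(c, d)\<in>D. d - c) < d \<Longrightarrow>
        (\<Sum>(c, d)\<in>D. dist (\<gamma> c) (\<gamma> d)) < e"
    using assms unfolding abs_continuous_on_iff by meson
  show ?thesis
    unfolding dist_sum_modulus_def
  proof (intro exI conjI allI impI)
    show "d > 0" by fact
    fix I :: "'i set" and p q
    assume fin: "finite I" and pq': "\<forall>i\<in>I. a \<le> p i \<and> p i \<le> q i \<and> q i \<le> b"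
      and disj': "\<forall>i\<in>I. \<forall>j\<in>I. i \<noteq> j \<longrightarrow> {p i<..<q i} \<inter> {p j<..<q j} = {}"
      and sum: "(\<Sum>i\<in>I. q i - p i) < d"
    note pq = bspec[OF pq'] and disj = disj'[rule_format]
    define I' where "I' = {i \<in> I. p i < q i}"
    have I': "finite I'" "I' \<subseteq> I" using fin by (auto simp: I'_def)
    have inj: "inj_on (\<lambda>i. (p i, q i)) I'"
    proof (rule inj_onI, rule ccontr)
      fix i j assume ij: "i \<in> I'" "j \<in> I'" "(p i, q i) = (p j, q j)" "i \<noteq> j"
      then have "(p i + q i) / 2 \<in> {p i<..<q i} \<inter> {p j<..<q j}"
        by (auto simp: I'_def)
      then show False using disj[of i j] ij by (auto simp: I'_def)
    qed
    have sum': "(\<Sum>i\<in>I. h (p i) (q i)) = (\<Sum>(c, d)\<in>(\<lambda>i. (p i, q i)) ` I'. h c d)"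
      if "\<And>x. h x x = 0" for h :: "real \<Rightarrow> real \<Rightarrow> real"
    proof -
      have "(\<Sum>i\<in>I. h (p i) (q i)) = (\<Sum>i\<in>I'. h (p i) (q i))"
      proof (rule sum.mono_neutral_right[OF fin I'(2)], rule ballI)
        fix i assume "i \<in> I - I'"
        then have "p i = q i" using pq[of i] by (auto simp: I'_def)
        then show "h (p i) (q i) = 0" using that by simp
      qed
      also have "\<dots> = (\<Sum>(c, d)\<in>(\<lambda>i. (p i, q i)) ` I'. h c d)"
        by (simp add: sum.reindex[OF inj] o_def)
      finally show ?thesis .
    qed
    have "(\<Sum>(c, d)\<in>(\<lambda>i. (p i, q i)) ` I'. dist (\<gamma> c) (\<gamma> d)) < e"
    proof (rule d)
      show "interval_family a b ((\<lambda>i. (p i, q i)) ` I')"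
        unfolding interval_family_def
      proof (intro conjI)
        show "finite ((\<lambda>i. (p i, q i)) ` I')" using I' by simp
        show "\<forall>(c, d)\<in>(\<lambda>i. (p i, q i)) ` I'. a \<le> c \<and> c \<le> d \<and> d \<le> b"
          using pq I' by auto
        show "pairwise (\<lambda>I J. {fst I<..<snd I} \<inter> {fst J<..<snd J} = {}) ((\<lambda>i. (p i, q i)) ` I')"
          unfolding pairwise_def using disj I'(2) by (clarsimp) blast
      qed
      show "(\<Sum>(c, d)\<in>(\<lambda>i. (p i, q i)) ` I'. d - c) < d"
        using sum sum'[of "\<lambda>c d. d - c"] by simp
    qed
    then show "(\<Sum>i\<in>I. dist (\<gamma> (p i)) (\<gamma> (q i))) < e"
      using sum'[of "\<lambda>c d. dist (\<gamma> c) (\<gamma> d)"] by simp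
  qed
qed

lemma abs_continuous_on_imp_uniform:
  fixes \<gamma> :: "real \<Rightarrow> 'a::metric_space"
  assumes "abs_continuous_on a b \<gamma>" "e > 0"
  obtains d where "d > 0"
    "\<And>s r. s \<in> {a..b} \<Longrightarrow> r \<in> {a..b} \<Longrightarrow> \<bar>s - r\<bar> < d \<Longrightarrow> dist (\<gamma> s) (\<gamma> r) < e"
proof -
  obtain d where "d > 0" and d: "dist_sum_modulus TYPE(unit) \<gamma> a b e d"
    using abs_continuous_on_modulus[OF assms] by blast
  have *: "dist (\<gamma> s) (\<gamma> r) < e" if "s \<in> {a..b}" "r \<in> {a..b}" "\<bar>s - r\<bar> < d" "s \<le> r" for s r
    using dist_sum_modulusD[OF d, of UNIV "\<lambda>_. s" "\<lambda>_. r"] that by (simp add: UNIV_unit)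
  show ?thesis
  proof
    show "dist (\<gamma> s) (\<gamma> r) < e" if "s \<in> {a..b}" "r \<in> {a..b}" "\<bar>s - r\<bar> < d" for s r
      using *[of s r] *[of r s] that by (cases "s \<le> r") (auto simp: dist_commute abs_minus_commute)
  qed fact
qed

lemma abs_continuous_on_imp_continuous_on:
  assumes "abs_continuous_on a b \<gamma>"
  shows "continuous_on {a..b} \<gamma>"
  unfolding continuous_on_iff
proof (intro ballI allI impI)
  fix x e :: real assume x: "x \<in> {a..b}" and "0 < e"
  then obtain d where d: "d > 0"
    "\<And>s r. s \<in> {a..b} \<Longrightarrow> r \<in> {a..b} \<Longrightarrow> \<bar>s - r\<bar> < d \<Longrightarrow> dist (\<gamma> s) (\<gamma> r) < e"
    using abs_continuous_on_imp_uniform[OF assms] by metis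
  show "\<exists>d>0. \<forall>x'\<in>{a..b}. dist x' x < d \<longrightarrow> dist (\<gamma> x') (\<gamma> x) < e"
    using d x by (auto simp: dist_real_def intro!: exI[of _ d])
qed

section \<open>Variation of an absolutely continuous function\<close>

definition variation_sums :: "(real \<Rightarrow> real) \<Rightarrow> real \<Rightarrow> real \<Rightarrow> real set" where
  "variation_sums f a b =
     {\<Sum>k<n. \<bar>f (x (Suc k)) - f (x k)\<bar> | n x. mono x \<and> range x \<subseteq> {a..b}}"

definition variation :: "(real \<Rightarrow> real) \<Rightarrow> real \<Rightarrow> real \<Rightarrow> real" where
  "variation f a b = Sup (variation_sums f a b)"

lemma mono_range_subsetD:
  fixes x :: "nat \<Rightarrow> real"
  assumes "mono x" "range x \<subseteq> {a..b}" "k \<le> k'"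
  shows "a \<le> x k" "x k \<le> x k'" "x k' \<le> b"
  using assms by (auto dest: monoD subsetD[OF _ rangeI])

lemma variation_sumsI:
  "mono x \<Longrightarrow> range x \<subseteq> {a..b} \<Longrightarrow> (\<Sum>k<n. \<bar>f (x (Suc k)) - f (x k)\<bar>) \<in> variation_sums f a b"
  unfolding variation_sums_def by blast

lemma variation_sumsE:
  assumes "z \<in> variation_sums f a b"
  obtains n x where "mono x" "range x \<subseteq> {a..b}" "z = (\<Sum>k<n. \<bar>f (x (Suc k)) - f (x k)\<bar>)"
  using assms unfolding variation_sums_def by blast

text \<open>Every sample is replaced by its minimum and its maximum with \<open>c\<close>. A step on
  one side of \<open>c\<close> survives in one of the two sums and is constant in the other; a step
  across \<open>c\<close> is split by the triangle inequality. Samples are only weakly monotone, so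
  the same index range serves for both halves.\<close>

lemma variation_sums_split:
  assumes "z \<in> variation_sums f a b" "c \<in> {a..b}"
  obtains z1 z2 where "z1 \<in> variation_sums f a c" "z2 \<in> variation_sums f c b" "z \<le> z1 + z2"
proof -
  obtain n x where x: "mono x" "range x \<subseteq> {a..b}" and z: "z = (\<Sum>k<n. \<bar>f (x (Suc k)) - f (x k)\<bar>)"
    using variation_sumsE[OF assms(1)] .
  have xk: "x k \<le> x (Suc k)" "a \<le> x k" "x k \<le> b" for k
    using mono_range_subsetD[OF x, of k k] mono_range_subsetD[OF x, of k "Suc k"] by auto
  define y where "y k = min (x k) c" for k
  define w where "w k = max (x k) c" for k
  have "mono y" "mono w"
    unfolding y_def w_def by (auto intro!: monoI min.mono max.mono monoD[OF x(1)])
  moreover have "range y \<subseteq> {a..c}" "range w \<subseteq> {c..b}"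
    using assms(2) xk by (auto simp: y_def w_def)
  moreover have "z \<le> (\<Sum>k<n. \<bar>f (y (Suc k)) - f (y k)\<bar>) + (\<Sum>k<n. \<bar>f (w (Suc k)) - f (w k)\<bar>)"
    unfolding z sum.distrib[symmetric]
  proof (rule sum_mono)
    fix k
    have "x (Suc k) \<le> c \<or> c \<le> x k \<or> x k \<le> c \<and> c \<le> x (Suc k)" by linarith
    then show "\<bar>f (x (Suc k)) - f (x k)\<bar>
        \<le> \<bar>f (y (Suc k)) - f (y k)\<bar> + \<bar>f (w (Suc k)) - f (w k)\<bar>"
      using xk[of k] by (elim disjE) (auto simp: y_def w_def min_def max_def)
  qed
  ultimately show ?thesis using that variation_sumsI by blast
qed

lemma variation_sums_nonempty: "a \<le> b \<Longrightarrow> variation_sums f a b \<noteq> {}"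
  using variation_sumsI[of "\<lambda>_. a" a b f 0] by auto

lemma variation_sums_mono: "a \<le> a' \<Longrightarrow> b' \<le> b \<Longrightarrow> variation_sums f a' b' \<subseteq> variation_sums f a b"
  unfolding variation_sums_def by fastforce

lemma variation_sums_less:
  assumes d: "dist_sum_modulus TYPE(nat) f a b e d"
    and ab: "a \<le> a'" "b' \<le> b" "b' - a' < d" and z: "z \<in> variation_sums f a' b'"
  shows "z < e"
proof -
  obtain n x where x: "mono x" "range x \<subseteq> {a'..b'}" and z: "z = (\<Sum>k<n. \<bar>f (x (Suc k)) - f (x k)\<bar>)"
    using variation_sumsE[OF z] .
  have "(\<Sum>i\<in>{..<n}. dist (f (x i)) (f (x (Suc i)))) < e"
  proof (rule dist_sum_modulusD[OF d])
    show "a \<le> x i \<and> x i \<le> x (Suc i) \<and> x (Suc i) \<le> b" for i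
      using mono_range_subsetD[OF x, of i "Suc i"] ab by auto
    show "{x i<..<x (Suc i)} \<inter> {x j<..<x (Suc j)} = {}" if "i \<noteq> j" for i j
    proof (cases "i < j")
      case True
      then have "x (Suc i) \<le> x j" using x(1) by (simp add: mono_def)
      then show ?thesis by auto
    next
      case False
      then have "x (Suc j) \<le> x i" using x(1) that by (simp add: mono_def)
      then show ?thesis by auto
    qed
    have "(\<Sum>i<n. x (Suc i) - x i) = x n - x 0" by (rule sum_lessThan_telescope)
    also have "\<dots> \<le> b' - a'" using mono_range_subsetD[OF x, of 0 n] by auto
    finally show "(\<Sum>i<n. x (Suc i) - x i) < d" using ab by simp
  qed simp
  then show ?thesis unfolding z by (simp add: dist_real_def abs_minus_commute)
qed

text \<open>Pieces of length \<open>d / 2\<close> are split off at the right end. Each has variation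
  sums below 1, so sums over \<open>N\<close> pieces stay below \<open>N\<close>, up to equality for
  a degenerate interval.\<close>

lemma bdd_above_variation_sums:
  assumes "abs_continuous_on a b f"
  shows "bdd_above (variation_sums f a b)"
proof -
  obtain d where "d > 0" and d: "dist_sum_modulus TYPE(nat) f a b 1 d"
    using abs_continuous_on_modulus[OF assms zero_less_one] by blast
  have "\<forall>z\<in>variation_sums f a b'. z \<le> real N" if "b' \<le> b" "b' \<le> a + real N * (d / 2)" for b' N
    using that
  proof (induction N arbitrary: b')
    case 0
    have Z: "z = 0" if zin: "z \<in> variation_sums f a b'" for z
    proof -
      obtain n x where x: "mono x" "range x \<subseteq> {a..b'}" and z: "z = (\<Sum>k<n. \<bar>f (x (Suc k)) - f (x k)\<bar>)"
        using variation_sumsE[OF zin] .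
      have "x k = a" for k using mono_range_subsetD[OF x order_refl, of k] 0 by simp
      then show ?thesis by (simp add: z)
    qed
    show ?case
    proof
      show "z \<le> real 0" if "z \<in> variation_sums f a b'" for z using Z[OF that] by simp
    qed
  next
    case (Suc N)
    show ?case
    proof
      fix z assume z: "z \<in> variation_sums f a b'"
      define c where "c = max a (b' - d / 2)"
      show "z \<le> real (Suc N)"
      proof (cases "a \<le> b'")
        case True
        then have "c \<in> {a..b'}" using \<open>d > 0\<close> by (auto simp: c_def)
        then obtain z1 z2 where z12: "z1 \<in> variation_sums f a c" "z2 \<in> variation_sums f c b'" "z \<le> z1 + z2"
          using variation_sums_split[OF z] by blast
        have "z1 \<le> real N"
        proof (rule Suc.IH[THEN bspec, OF _ _ z12(1)])
          show "c \<le> b" using Suc.prems \<open>c \<in> {a..b'}\<close> by auto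
          show "c \<le> a + real N * (d / 2)"
          proof -
            have "real (Suc N) * (d / 2) = real N * (d / 2) + d / 2" by (simp add: algebra_simps)
            with Suc.prems(2) have "b' \<le> a + (real N * (d / 2) + d / 2)" by (simp only:)
            then have "b' - d / 2 \<le> a + real N * (d / 2)" by linarith
            moreover have "a \<le> a + real N * (d / 2)" using \<open>d > 0\<close> by simp
            ultimately show ?thesis unfolding c_def by (rule max.boundedI[rotated])
          qed
        qed
        moreover have "z2 < 1"
          by (rule variation_sums_less[OF d _ _ _ z12(2)]) (use Suc.prems \<open>d > 0\<close> in \<open>auto simp: c_def\<close>)
        ultimately show ?thesis using z12 by simp
      next
        case False
        have "variation_sums f a b' = {}"
          using False mono_range_subsetD[OF _ _ order_refl, of _ a b' 0]
          unfolding variation_sums_def by fastforce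
        then show ?thesis using z by simp
      qed
    qed
  qed
  moreover obtain N where "(b - a) / (d / 2) \<le> real N" using real_arch_simple by blast
  then have "b \<le> a + real N * (d / 2)" using \<open>d > 0\<close> by (simp add: field_simps)
  ultimately show ?thesis by (auto simp: bdd_above_def)
qed

lemma variation_upper:
  assumes "abs_continuous_on a b f" "a \<le> p" "q \<le> b" "z \<in> variation_sums f p q"
  shows "z \<le> variation f p q"
  unfolding variation_def
  by (rule cSup_upper[OF assms(4)])
    (metis assms(1-3) bdd_above_mono bdd_above_variation_sums variation_sums_mono)

lemma variation_split:
  assumes "abs_continuous_on a b f" "a \<le> c" "c \<le> d" "d \<le> b"
  shows "variation f a d \<le> variation f a c + variation f c d"
  unfolding variation_def[of f a d]
proof (rule cSup_least)
  show "variation_sums f a d \<noteq> {}" using assms by (intro variation_sums_nonempty) auto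
  fix z assume "z \<in> variation_sums f a d"
  then obtain z1 z2 where "z1 \<in> variation_sums f a c" "z2 \<in> variation_sums f c d" "z \<le> z1 + z2"
    using variation_sums_split[of z f a d c] assms by auto
  moreover have "z1 \<le> variation f a c" "z2 \<le> variation f c d"
    using variation_upper[OF assms(1)] calculation assms by auto
  ultimately show "z \<le> variation f a c + variation f c d" by linarith
qed

lemma abs_diff_le_variation:
  assumes "abs_continuous_on a b f" "a \<le> c" "c \<le> d" "d \<le> b"
  shows "variation f a c + \<bar>f d - f c\<bar> \<le> variation f a d"
proof -
  have "variation f a c \<le> variation f a d - \<bar>f d - f c\<bar>"
    unfolding variation_def[of f a c]
  proof (rule cSup_least)
    show "variation_sums f a c \<noteq> {}" using assms by (intro variation_sums_nonempty) auto
    fix z assume zin: "z \<in> variation_sums f a c"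
    obtain n x where x: "mono x" "range x \<subseteq> {a..c}" and z: "z = (\<Sum>k<n. \<bar>f (x (Suc k)) - f (x k)\<bar>)"
      using variation_sumsE[OF zin] .
    \<comment> \<open>The samples are prolonged by \<open>c\<close> and then \<open>d\<close>: the
      last increment is the one to be gained, and the one from \<open>x n\<close> to
      \<open>c\<close> is nonnegative and dropped.\<close>
    define y where "y k = (if k \<le> n then x k else if k = Suc n then c else d)" for k
    have xk: "a \<le> x k" "x k \<le> x (Suc k)" "x k \<le> c" for k
      using mono_range_subsetD[OF x, of k "Suc k"] mono_range_subsetD[OF x, of k k] by auto
    have "mono y"
      unfolding mono_iff_le_Suc y_def using xk assms(2-4) by auto
    moreover have "range y \<subseteq> {a..d}"
      unfolding y_def using order_trans[OF xk(3) assms(3)] xk(1) assms(2,3) by auto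
    ultimately have "(\<Sum>k<Suc (Suc n). \<bar>f (y (Suc k)) - f (y k)\<bar>) \<le> variation f a d"
      using variation_upper[OF assms(1) _ assms(4)] variation_sumsI by blast
    moreover have "(\<Sum>k<n. \<bar>f (y (Suc k)) - f (y k)\<bar>) = z"
      unfolding z by (rule sum.cong) (auto simp: y_def)
    ultimately show "z \<le> variation f a d - \<bar>f d - f c\<bar>"
      by (simp add: y_def)
  qed
  then show ?thesis by simp
qed

text \<open>Near optimal subdivisions of all the intervals are pooled into one family indexed by
  pairs, to which the modulus applies at once; hence the index type. Passing to the suprema makes
  the bound a weak one.\<close>

lemma sum_variation_le:
  assumes d: "dist_sum_modulus TYPE('j \<times> nat) f a b e d"
    and J: "finite (J :: 'j set)" and pq: "\<And>j. j \<in> J \<Longrightarrow> a \<le> p j \<and> p j \<le> q j \<and> q j \<le> b"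
    and disj: "\<And>i j. i \<in> J \<Longrightarrow> j \<in> J \<Longrightarrow> i \<noteq> j \<Longrightarrow> {p i<..<q i} \<inter> {p j<..<q j} = {}"
    and sum: "(\<Sum>i\<in>J. q i - p i) < d"
  shows "(\<Sum>j\<in>J. variation f (p j) (q j)) \<le> e"
proof (rule field_le_epsilon)
  fix \<eta> :: real assume "\<eta> > 0"
  \<comment> \<open>The loss \<eta> is shared equally among the intervals; the added 1 covers an
    empty \<open>J\<close>.\<close>
  define \<eta>' where "\<eta>' = \<eta> / (real (card J) + 1)"
  have "\<eta>' > 0" using \<open>\<eta> > 0\<close> by (simp add: \<eta>'_def add_nonneg_pos)
  have "\<exists>n x. mono x \<and> range x \<subseteq> {p j..q j} \<and>
      variation f (p j) (q j) - \<eta>' < (\<Sum>k<n. \<bar>f (x (Suc k)) - f (x k)\<bar>)" if "j \<in> J" for j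
  proof -
    have "variation_sums f (p j) (q j) \<noteq> {}" using pq that by (intro variation_sums_nonempty) auto
    then obtain z where "z \<in> variation_sums f (p j) (q j)" "variation f (p j) (q j) - \<eta>' < z"
      using less_cSupE[of "variation f (p j) (q j) - \<eta>'" "variation_sums f (p j) (q j)"] \<open>\<eta>' > 0\<close>
      by (auto simp: variation_def)
    then show ?thesis by (elim variation_sumsE) (auto intro!: exI)
  qed
  then have "\<forall>j\<in>J. \<exists>nx. mono (snd nx) \<and> range (snd nx) \<subseteq> {p j..q j} \<and>
      variation f (p j) (q j) - \<eta>' < (\<Sum>k<fst nx. \<bar>f (snd nx (Suc k)) - f (snd nx k)\<bar>)"
    by auto
  then obtain nx where nx: "\<forall>j\<in>J. mono (snd (nx j)) \<and> range (snd (nx j)) \<subseteq> {p j..q j} \<and>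
      variation f (p j) (q j) - \<eta>'
        < (\<Sum>k<fst (nx j). \<bar>f (snd (nx j) (Suc k)) - f (snd (nx j) k)\<bar>)"
    by (rule bchoice[THEN exE])
  define n where "n j = fst (nx j)" for j
  define x where "x j = snd (nx j)" for j
  have x: "\<And>j. j \<in> J \<Longrightarrow> mono (x j)" "\<And>j. j \<in> J \<Longrightarrow> range (x j) \<subseteq> {p j..q j}"
    and v: "\<And>j. j \<in> J \<Longrightarrow> variation f (p j) (q j) - \<eta>' < (\<Sum>k<n j. \<bar>f (x j (Suc k)) - f (x j k)\<bar>)"
    using nx by (auto simp: n_def x_def)
  have xk: "p j \<le> x j k" "x j k \<le> q j" "k \<le> k' \<Longrightarrow> x j k \<le> x j k'" if "j \<in> J" for j k k'
    using mono_range_subsetD[OF x[OF that] order_refl, of k] monoD[OF x(1)[OF that], of k k'] by auto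
  have "(\<Sum>i\<in>Sigma J (\<lambda>j. {..<n j}). dist (f (x (fst i) (snd i))) (f (x (fst i) (Suc (snd i))))) < e"
  proof (rule dist_sum_modulusD[OF d])
    show "finite (Sigma J (\<lambda>j. {..<n j}))" using J by auto
    show "a \<le> x (fst i) (snd i) \<and> x (fst i) (snd i) \<le> x (fst i) (Suc (snd i)) \<and> x (fst i) (Suc (snd i)) \<le> b"
      if "i \<in> Sigma J (\<lambda>j. {..<n j})" for i
      using that xk(1,2)[of "fst i" "snd i"] xk(1,2)[of "fst i" "Suc (snd i)"]
        xk(3)[of "fst i" "snd i" "Suc (snd i)"] pq[of "fst i"] by auto
    fix i j assume i: "i \<in> Sigma J (\<lambda>j. {..<n j})" and j: "j \<in> Sigma J (\<lambda>j. {..<n j})" and "i \<noteq> j"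
    show "{x (fst i) (snd i)<..<x (fst i) (Suc (snd i))} \<inter> {x (fst j) (snd j)<..<x (fst j) (Suc (snd j))} = {}"
    proof (cases "fst i = fst j")
      case True
      then consider "Suc (snd i) \<le> snd j" | "Suc (snd j) \<le> snd i"
        using \<open>i \<noteq> j\<close> by (cases i, cases j) (auto, linarith)
      from this show ?thesis
      proof cases
        case 1
        then have "x (fst i) (Suc (snd i)) \<le> x (fst j) (snd j)" using xk(3) i True by auto
        then show ?thesis by auto
      next
        case 2
        then have "x (fst j) (Suc (snd j)) \<le> x (fst i) (snd i)" using xk(3) i True by auto
        then show ?thesis by auto
      qed
    next
      case False
      have sub: "{x (fst i) (snd i)<..<x (fst i) (Suc (snd i))} \<subseteq> {p (fst i)<..<q (fst i)}"
        if "i \<in> Sigma J (\<lambda>j. {..<n j})" for i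
        using xk(1,2)[of "fst i" "snd i"] xk(1,2)[of "fst i" "Suc (snd i)"] that by auto
      have "{p (fst i)<..<q (fst i)} \<inter> {p (fst j)<..<q (fst j)} = {}"
        using disj[of "fst i" "fst j"] False i j by auto
      then show ?thesis using sub[OF i] sub[OF j] by blast
    qed
  next
    have "(\<Sum>i\<in>Sigma J (\<lambda>j. {..<n j}). x (fst i) (Suc (snd i)) - x (fst i) (snd i))
        = (\<Sum>j\<in>J. \<Sum>k<n j. x j (Suc k) - x j k)"
      using J by (subst sum.Sigma) (auto simp: case_prod_beta')
    also have "\<dots> = (\<Sum>j\<in>J. x j (n j) - x j 0)" by (simp only: sum_lessThan_telescope)
    also have "\<dots> \<le> (\<Sum>j\<in>J. q j - p j)" using xk by (intro sum_mono diff_mono) auto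
    finally show "(\<Sum>i\<in>Sigma J (\<lambda>j. {..<n j}). x (fst i) (Suc (snd i)) - x (fst i) (snd i)) < d"
      using sum by simp
  qed
  also have "(\<Sum>i\<in>Sigma J (\<lambda>j. {..<n j}). dist (f (x (fst i) (snd i))) (f (x (fst i) (Suc (snd i)))))
      = (\<Sum>j\<in>J. \<Sum>k<n j. \<bar>f (x j (Suc k)) - f (x j k)\<bar>)"
    using J by (subst sum.Sigma) (auto simp: case_prod_beta' dist_real_def abs_minus_commute)
  finally have "(\<Sum>j\<in>J. \<Sum>k<n j. \<bar>f (x j (Suc k)) - f (x j k)\<bar>) < e" .
  moreover have "(\<Sum>j\<in>J. variation f (p j) (q j) - \<eta>') \<le> (\<Sum>j\<in>J. \<Sum>k<n j. \<bar>f (x j (Suc k)) - f (x j k)\<bar>)"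
    using v by (intro sum_mono) (auto intro: less_imp_le)
  moreover have "real (card J) * \<eta>' \<le> \<eta>"
    using \<open>\<eta> > 0\<close> by (simp add: \<eta>'_def field_simps)
  ultimately show "(\<Sum>j\<in>J. variation f (p j) (q j)) \<le> e + \<eta>"
    by (simp add: sum_subtractf)
qed

lemma abs_continuous_on_variation:
  assumes "abs_continuous_on a b f"
  shows "abs_continuous_on a b (variation f a)"
  unfolding abs_continuous_on_iff
proof (intro allI impI)
  fix e :: real assume "e > 0"
  \<comment> \<open>\<open>sum_variation_le\<close> yields a weak inequality, so half of
    \<open>e\<close> is aimed at.\<close>
  then have "e / 2 > 0" by simp
  obtain d where "d > 0" and d: "dist_sum_modulus TYPE((real \<times> real) \<times> nat) f a b (e / 2) d"
    using abs_continuous_on_modulus[OF assms \<open>e / 2 > 0\<close>] by blast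
  show "\<exists>\<delta>>0. \<forall>D. interval_family a b D \<longrightarrow>
        (\<Sum>(c, d)\<in>D. d - c) < \<delta> \<longrightarrow>
        (\<Sum>(c, d)\<in>D. dist (variation f a c) (variation f a d)) < e"
  proof (intro exI conjI allI impI)
    show "d > 0" by fact
    fix D
    assume fam: "interval_family a b D"
      and sum: "(\<Sum>(c, d)\<in>D. d - c) < d"
    then have D: "finite D" "\<forall>(c, d)\<in>D. a \<le> c \<and> c \<le> d \<and> d \<le> b"
      and disj: "pairwise (\<lambda>I J. {fst I<..<snd I} \<inter> {fst J<..<snd J} = {}) D"
      by (auto simp: interval_family_def)
    have "(\<Sum>(c, d)\<in>D. dist (variation f a c) (variation f a d)) \<le> (\<Sum>j\<in>D. variation f (fst j) (snd j))"
      unfolding case_prod_beta'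
    proof (rule sum_mono)
      fix j assume "j \<in> D"
      then have "a \<le> fst j" "fst j \<le> snd j" "snd j \<le> b" using D by auto
      then show "dist (variation f a (fst j)) (variation f a (snd j)) \<le> variation f (fst j) (snd j)"
        using variation_split[OF assms, of "fst j" "snd j"] abs_diff_le_variation[OF assms, of "fst j" "snd j"]
        by (auto simp: dist_real_def)
    qed
    also have "\<dots> \<le> e / 2"
      by (rule sum_variation_le[OF d]) (use D disj sum in \<open>auto simp: pairwise_def case_prod_beta'\<close>)
    finally show "(\<Sum>(c, d)\<in>D. dist (variation f a c) (variation f a d)) < e"
      using \<open>e > 0\<close> by simp
  qed
qed

text \<open>Serves for the sum of two functions and, with \<open>f\<close> and \<open>g\<close>
  equal, for a component of a vector-valued one.\<close>

lemma abs_continuous_on_dist_sum: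
  fixes h :: "real \<Rightarrow> 'c::metric_space"
  assumes "abs_continuous_on a b f" "abs_continuous_on a b g"
    and le: "\<And>x y. x \<in> {a..b} \<Longrightarrow> y \<in> {a..b} \<Longrightarrow> dist (h x) (h y) \<le> dist (f x) (f y) + dist (g x) (g y)"
  shows "abs_continuous_on a b h"
  unfolding abs_continuous_on_iff
proof (intro allI impI)
  fix e :: real assume "e > 0"
  then have "e / 2 > 0" by simp
  obtain d1 where "d1 > 0" and d1: "\<And>D. interval_family a b D \<Longrightarrow>
        (\<Sum>(c, d)\<in>D. d - c) < d1 \<Longrightarrow> (\<Sum>(c, d)\<in>D. dist (f c) (f d)) < e / 2"
    using assms(1) \<open>e / 2 > 0\<close> unfolding abs_continuous_on_iff by meson
  obtain d2 where "d2 > 0" and d2: "\<And>D. interval_family a b D \<Longrightarrow>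
        (\<Sum>(c, d)\<in>D. d - c) < d2 \<Longrightarrow> (\<Sum>(c, d)\<in>D. dist (g c) (g d)) < e / 2"
    using assms(2) \<open>e / 2 > 0\<close> unfolding abs_continuous_on_iff by meson
  show "\<exists>\<delta>>0. \<forall>D. interval_family a b D \<longrightarrow>
        (\<Sum>(c, d)\<in>D. d - c) < \<delta> \<longrightarrow>
        (\<Sum>(c, d)\<in>D. dist (h c) (h d)) < e"
  proof (intro exI conjI allI impI)
    show "min d1 d2 > 0" using \<open>d1 > 0\<close> \<open>d2 > 0\<close> by simp
    fix D
    assume fam: "interval_family a b D"
      and sum: "(\<Sum>(c, d)\<in>D. d - c) < min d1 d2"
    then have D: "\<forall>(c, d)\<in>D. a \<le> c \<and> c \<le> d \<and> d \<le> b"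
      by (auto simp: interval_family_def)
    have "(\<Sum>(c, d)\<in>D. dist (h c) (h d)) \<le> (\<Sum>(c, d)\<in>D. dist (f c) (f d)) + (\<Sum>(c, d)\<in>D. dist (g c) (g d))"
      unfolding case_prod_beta' sum.distrib[symmetric]
      using D by (intro sum_mono le) (auto intro: order_trans)
    also have "\<dots> < e / 2 + e / 2"
      using d1[OF fam] d2[OF fam] sum by (intro add_strict_mono) auto
    finally show "(\<Sum>(c, d)\<in>D. dist (h c) (h d)) < e" by simp
  qed
qed

section \<open>Densities of absolutely continuous functions\<close>

lemma emeasure_Union_countable_le:
  assumes "countable \<D>" "\<And>K. K \<in> \<D> \<Longrightarrow> K \<in> sets M"
    and le: "\<And>E. finite E \<Longrightarrow> E \<subseteq> \<D> \<Longrightarrow> emeasure M (\<Union>E) \<le> e"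
  shows "emeasure M (\<Union>\<D>) \<le> e"
proof (cases "\<D> = {}")
  case False
  define A where "A n = \<Union>(from_nat_into \<D> ` {..n})" for n :: nat
  have sub: "from_nat_into \<D> ` {..n} \<subseteq> \<D>" for n
    using from_nat_into[OF False] by auto
  have "incseq A" unfolding A_def incseq_def by force
  moreover have "range A \<subseteq> sets M"
    unfolding A_def using sub assms(2) by (auto intro!: sets.finite_Union)
  ultimately have "(SUP n. emeasure M (A n)) = emeasure M (\<Union>n. A n)"
    by (rule SUP_emeasure_incseq[rotated])
  moreover have "(\<Union>n. A n) = \<Union>\<D>"
  proof -
    have "(\<Union>n. A n) = \<Union>(range (from_nat_into \<D>))" unfolding A_def by blast
    then show ?thesis by (simp only: range_from_nat_into[OF False assms(1)])
  qed
  moreover have "(SUP n. emeasure M (A n)) \<le> e"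
    unfolding A_def by (intro SUP_least le sub finite_imageI) auto
  ultimately show ?thesis by simp
qed simp

text \<open>The Stieltjes measure of \<open>F\<close> vanishes on null sets: such a set is covered
  by countably many nonoverlapping intervals of small total length, and any finitely many of them
  have small total increment by absolute continuity. The Radon-Nikodym derivative with respect to
  Lebesgue measure is the density.\<close>

lemma abs_continuous_mono_has_density:
  assumes ac: "abs_continuous_on a b F" and "a \<le> b"
    and mono: "\<And>x y. a \<le> x \<Longrightarrow> x \<le> y \<Longrightarrow> y \<le> b \<Longrightarrow> F x \<le> (F y :: real)"
  obtains g where "g absolutely_integrable_on {a..b}"
    "\<And>x. x \<in> {a..b} \<Longrightarrow> F x = F a + integral {a..x} g"
proof -
  \<comment> \<open>\<open>cl\<close> is the projection onto [a, b]. Composed with it,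
    \<open>F\<close> is extended by its end values to a monotone continuous function
    \<open>G\<close> on the line, which generates a Stieltjes measure.\<close>
  define cl where "cl x = max a (min b x)" for x
  have cl: "a \<le> cl x" "cl x \<le> b" "x \<le> y \<Longrightarrow> cl x \<le> cl y" for x y
    using \<open>a \<le> b\<close> by (auto simp: cl_def)
  have cl_between: "u < x" "x < v" if "cl u < x" "x < cl v" for u v x
    using that \<open>a \<le> b\<close> by (auto simp: cl_def max_def min_def split: if_splits)
  have cl_diff: "cl v - cl u \<le> v - u" if "u \<le> v" for u v
    using that \<open>a \<le> b\<close> by (auto simp: cl_def max_def min_def)
  define G where "G x = F (cl x)" for x
  have monoG: "G x \<le> G y" if "x \<le> y" for x y
    unfolding G_def using cl that by (intro mono) auto
  have contG: "continuous_on UNIV G"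
    unfolding G_def
  proof (rule continuous_on_compose2[OF abs_continuous_on_imp_continuous_on[OF ac]])
    show "continuous_on UNIV cl" unfolding cl_def by (intro continuous_intros)
  qed (use cl in auto)
  define \<mu> where "\<mu> = interval_measure G"
  have Icc: "emeasure \<mu> {c..d} = ennreal (G d - G c)" if "c \<le> d" for c d
    unfolding \<mu>_def using emeasure_interval_measure_Icc[OF that monoG contG] by simp
  have sets\<mu>: "sets \<mu> = sets borel" by (simp add: \<mu>_def)
  \<comment> \<open>Outer covers by intervals are taken inside a bounded box, whence the
    intersection with \<open>{- real n..real n}\<close>; the union over \<open>n\<close> recovers
    the null set.\<close>
  have null: "emeasure \<mu> (N \<inter> {- real n..real n}) = 0" if N: "N \<in> null_sets lborel" for N n
  proof -
    define M where "M = N \<inter> {- real n..real n}"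
    have M: "M \<in> null_sets lborel" unfolding M_def using N by (intro null_set_Int2) auto
    then have "M \<in> null_sets lebesgue" by (rule null_sets_completionI)
    then have Ml: "M \<in> lmeasurable" "measure lebesgue M = 0"
      by (auto simp: fmeasurable_def null_sets_def measure_def)
    have eps: "emeasure \<mu> M \<le> 0 + ennreal e" if "e > 0" for e
    proof -
      obtain d where "d > 0" and d: "dist_sum_modulus TYPE(real set) F a b e d"
        using abs_continuous_on_modulus[OF ac \<open>e > 0\<close>] by blast
      have "M \<subseteq> cbox (- real n) (real n)" "d / 2 > 0" using \<open>d > 0\<close> by (auto simp: M_def)
      show ?thesis
      proof (rule measurable_outer_intervals_bounded[OF Ml(1) \<open>M \<subseteq> cbox (- real n) (real n)\<close> \<open>d / 2 > 0\<close>])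
        fix \<D> assume cD: "countable \<D>"
          and ivl: "\<And>K. K \<in> \<D> \<Longrightarrow> K \<subseteq> cbox (- real n) (real n) \<and> K \<noteq> {} \<and> (\<exists>c d. K = cbox c d)"
          and disj: "pairwise (\<lambda>A B. interior A \<inter> interior B = {}) \<D>"
          and cov: "M \<subseteq> \<Union>\<D>" and UD: "\<Union>\<D> \<in> lmeasurable"
          and meas: "measure lebesgue (\<Union>\<D>) \<le> measure lebesgue M + d / 2"
        have K: "K = {Inf K..Sup K}" "Inf K \<le> Sup K" if "K \<in> \<D>" for K
        proof -
          obtain c d where "K = {c..d}" "c \<le> d" using ivl[OF \<open>K \<in> \<D>\<close>] by fastforce
          then show "K = {Inf K..Sup K}" "Inf K \<le> Sup K" by auto
        qed
        have K\<mu>: "K \<in> sets \<mu>" if "K \<in> \<D>" for K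
          using K(1)[OF that] atLeastAtMost_borel unfolding sets\<mu> by metis
        \<comment> \<open>Projected to [a, b] by \<open>cl\<close>, the intervals of a finite
          subfamily keep disjoint interiors and do not grow, so the modulus of \<open>F\<close>
          applies to them; their increments under \<open>G\<close> are those of
          \<open>F\<close>.\<close>
        have "emeasure \<mu> (\<Union>E) \<le> ennreal e" if E: "finite E" "E \<subseteq> \<D>" for E
        proof -
          have E': "K = {Inf K..Sup K}" "Inf K \<le> Sup K" "K \<in> sets \<mu>" if "K \<in> E" for K
          proof -
            have "K \<in> \<D>" using E that by blast
            then show "K = {Inf K..Sup K}" "Inf K \<le> Sup K" "K \<in> sets \<mu>" using K K\<mu> by blast+
          qed
          have "emeasure \<mu> (\<Union>E) \<le> (\<Sum>K\<in>E. emeasure \<mu> K)"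
            using emeasure_subadditive_finite[of E "\<lambda>K. K" \<mu>] E E'(3) by auto
          also have "\<dots> = (\<Sum>K\<in>E. ennreal (G (Sup K) - G (Inf K)))"
          proof (rule sum.cong[OF refl])
            fix K assume "K \<in> E"
            then show "emeasure \<mu> K = ennreal (G (Sup K) - G (Inf K))"
              using Icc[OF E'(2)] E'(1) by metis
          qed
          also have "\<dots> = ennreal (\<Sum>K\<in>E. G (Sup K) - G (Inf K))"
            using E'(2) monoG by (intro sum_ennreal) auto
          also have "\<dots> \<le> ennreal e"
          proof (rule ennreal_leI)
            have "(\<Sum>K\<in>E. dist (F (cl (Inf K))) (F (cl (Sup K)))) < e"
            proof (rule dist_sum_modulusD[OF d \<open>finite E\<close>])
              show "a \<le> cl (Inf K) \<and> cl (Inf K) \<le> cl (Sup K) \<and> cl (Sup K) \<le> b" if "K \<in> E" for K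
                using cl E'(2)[OF that] by auto
              have sub: "{cl (Inf K)<..<cl (Sup K)} \<subseteq> interior K" if "K \<in> E" for K
              proof -
                have "interior K = {Inf K<..<Sup K}"
                  using E'(1)[OF that] interior_atLeastAtMost_real by metis
                moreover have "{cl (Inf K)<..<cl (Sup K)} \<subseteq> {Inf K<..<Sup K}"
                proof
                  fix x assume "x \<in> {cl (Inf K)<..<cl (Sup K)}"
                  then have "cl (Inf K) < x" "x < cl (Sup K)" by simp_all
                  from cl_between[OF this] show "x \<in> {Inf K<..<Sup K}" by simp
                qed
                ultimately show ?thesis by (simp only:)
              qed
              show "{cl (Inf K)<..<cl (Sup K)} \<inter> {cl (Inf K')<..<cl (Sup K')} = {}"
                if "K \<in> E" "K' \<in> E" "K \<noteq> K'" for K K'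
              proof -
                have "interior K \<inter> interior K' = {}"
                  using pairwiseD[OF disj] that E(2) by blast
                then show ?thesis using sub that by blast
              qed
              have "(\<Sum>K\<in>E. cl (Sup K) - cl (Inf K)) \<le> (\<Sum>K\<in>E. measure lebesgue K)"
              proof (rule sum_mono)
                fix K assume "K \<in> E"
                have "cl (Sup K) - cl (Inf K) \<le> Sup K - Inf K"
                  using E'(2)[OF \<open>K \<in> E\<close>] by (rule cl_diff)
                also have "\<dots> = measure lebesgue K"
                proof -
                  have "measure lebesgue {u..v} = v - u" if "u \<le> v" for u v :: real
                    using that by simp
                  then show ?thesis using E'(1,2)[OF \<open>K \<in> E\<close>] by metis
                qed
                finally show "cl (Sup K) - cl (Inf K) \<le> measure lebesgue K" .
              qed
              also have "\<dots> = measure lebesgue (\<Union>E)"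
              proof (rule content_division)
                show "E division_of \<Union>E"
                proof (rule division_ofI)
                  fix K assume "K \<in> E"
                  then show "K \<subseteq> \<Union>E" "K \<noteq> {}" "\<exists>a b. K = cbox a b" using ivl E(2) by auto
                  fix K' assume "K' \<in> E" "K \<noteq> K'"
                  then show "interior K \<inter> interior K' = {}"
                    using pairwiseD[OF disj] \<open>K \<in> E\<close> E(2) by blast
                qed (use E in auto)
              qed
              also have "\<dots> \<le> measure lebesgue (\<Union>\<D>)"
              proof (rule measure_mono_fmeasurable[OF _ _ UD])
                show "\<Union>E \<in> sets lebesgue"
                  using E(1) E'(3) sets\<mu> by (intro sets.finite_Union) (auto intro: sets_completionI_sets)
              qed (use E in auto)
              also have "\<dots> < d" using meas Ml(2) \<open>d > 0\<close> by simp
              finally show "(\<Sum>K\<in>E. cl (Sup K) - cl (Inf K)) < d" .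
            qed
            moreover have "(\<Sum>K\<in>E. G (Sup K) - G (Inf K)) \<le> (\<Sum>K\<in>E. dist (F (cl (Inf K))) (F (cl (Sup K))))"
              unfolding G_def by (intro sum_mono) (auto simp: dist_real_def)
            ultimately show "(\<Sum>K\<in>E. G (Sup K) - G (Inf K)) \<le> e" by linarith
          qed
          finally show ?thesis .
        qed
        then have "emeasure \<mu> (\<Union>\<D>) \<le> ennreal e"
          by (intro emeasure_Union_countable_le[OF cD K\<mu>])
        moreover have "emeasure \<mu> M \<le> emeasure \<mu> (\<Union>\<D>)"
        proof (rule emeasure_mono[OF cov])
          show "\<Union>\<D> \<in> sets \<mu>"
            using K\<mu> by (intro sets.countable_Union[OF cD]) auto
        qed
        ultimately show "emeasure \<mu> M \<le> 0 + ennreal e" by simp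
      qed
    qed
    have "emeasure \<mu> M \<le> 0" by (rule ennreal_le_epsilon) (rule eps)
    then show ?thesis by (simp add: M_def)
  qed
  have "absolutely_continuous lborel \<mu>"
    unfolding absolutely_continuous_def
  proof
    fix N :: "real set" assume N: "N \<in> null_sets lborel"
    then have Nb: "N \<in> sets borel" by (auto simp: null_sets_def)
    have "N \<inter> {- real n..real n} \<in> null_sets \<mu>" for n
      using null[OF N, of n] Nb by (auto simp: null_sets_def sets\<mu>)
    then have "(\<Union>n. N \<inter> {- real n..real n}) \<in> null_sets \<mu>" by (intro null_sets_UN) auto
    moreover have "(\<Union>n. N \<inter> {- real n..real n}) = N"
    proof -
      have "\<exists>n. x \<in> {- real n..real n}" for x
      proof -
        obtain n where "\<bar>x\<bar> \<le> real n" using real_arch_simple by blast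
        then have "x \<in> {- real n..real n}" by auto
        then show ?thesis ..
      qed
      then show ?thesis by auto
    qed
    ultimately show "N \<in> null_sets \<mu>" by simp
  qed
  then obtain f where f: "f \<in> borel_measurable lborel" "density lborel f = \<mu>"
    using sigma_finite_measure.Radon_Nikodym[OF sigma_finite_lborel] sets\<mu> by (metis sets_lborel)
  have ff: "(\<integral>\<^sup>+y. f y * indicator {a..x} y \<partial>lborel) = ennreal (F x - F a)" if "x \<in> {a..b}" for x
  proof -
    have "(\<integral>\<^sup>+y. f y * indicator {a..x} y \<partial>lborel) = emeasure \<mu> {a..x}"
      unfolding f(2)[symmetric] using f(1) by (simp add: emeasure_density)
    also have "\<dots> = ennreal (F x - F a)"
      using Icc[of a x] that by (simp add: G_def cl_def)
    finally show ?thesis .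
  qed
  \<comment> \<open>The density has a finite integral over [a, b], so it is infinite only on a null
    set there, and \<open>enn2real\<close>, which sends infinity to 0, alters no integral over a
    subinterval.\<close>
  have "AE y in lborel. f y * indicator {a..b} y \<noteq> \<infinity>"
    using ff[of b] \<open>a \<le> b\<close> f(1) by (intro nn_integral_PInf_AE) auto
  then have fin: "AE y in lborel. y \<in> {a..b} \<longrightarrow> f y \<noteq> \<infinity>"
    by eventually_elim (auto simp: indicator_def)
  define g where "g y = enn2real (f y)" for y
  have gm: "g \<in> borel_measurable lborel" unfolding g_def using f(1) by measurable
  have hb: "has_bochner_integral lborel (\<lambda>y. indicator {a..x} y *\<^sub>R g y) (F x - F a)" if x: "x \<in> {a..b}" for x
  proof (rule has_bochner_integral_nn_integral)
    show "(\<lambda>y. indicator {a..x} y *\<^sub>R g y) \<in> borel_measurable lborel" using gm by measurable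
    show "AE y in lborel. 0 \<le> indicator {a..x} y *\<^sub>R g y" by (simp add: g_def)
    show "0 \<le> F x - F a" using mono[of a x] x by auto
    have "(\<integral>\<^sup>+y. ennreal (indicator {a..x} y *\<^sub>R g y) \<partial>lborel) = (\<integral>\<^sup>+y. f y * indicator {a..x} y \<partial>lborel)"
    proof (rule nn_integral_cong_AE)
      show "AE y in lborel. ennreal (indicator {a..x} y *\<^sub>R g y) = f y * indicator {a..x} y"
        using fin
      proof eventually_elim
        case (elim y)
        then show ?case using x by (cases "y \<in> {a..x}") (auto simp: g_def less_top)
      qed
    qed
    then show "(\<integral>\<^sup>+y. ennreal (indicator {a..x} y *\<^sub>R g y) \<partial>lborel) = ennreal (F x - F a)"
      using ff[OF x] by simp
  qed
  have si: "set_integrable lborel {a..x} g" "(LINT y:{a..x}|lborel. g y) = F x - F a" if "x \<in> {a..b}" for x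
    using hb[OF that] unfolding set_integrable_def set_lebesgue_integral_def
    by (auto simp: has_bochner_integral_iff)
  show ?thesis
  proof
    have "g integrable_on {a..b}" using set_borel_integral_eq_integral(1)[OF si(1)] \<open>a \<le> b\<close> by auto
    then show "g absolutely_integrable_on {a..b}"
      by (rule nonnegative_absolutely_integrable_1) (simp add: g_def)
    show "F x = F a + integral {a..x} g" if "x \<in> {a..b}" for x
      using set_borel_integral_eq_integral(2)[OF si(1)] si(2) that by force
  qed
qed

text \<open>Jordan decomposition: \<open>f\<close> is the difference of the monotone functions
  \<open>V + f\<close> and \<open>V\<close>, where the variation \<open>V\<close> inherits absolute
  continuity.\<close>

lemma abs_continuous_on_has_density_real:
  assumes ac: "abs_continuous_on a b f" and "a \<le> b"
  obtains g where "g absolutely_integrable_on {a..b}"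
    "\<And>x. x \<in> {a..b} \<Longrightarrow> f x = f a + (integral {a..x} g :: real)"
proof -
  define V where "V = variation f a"
  have V: "V x + \<bar>f y - f x\<bar> \<le> V y" if "a \<le> x" "x \<le> y" "y \<le> b" for x y
    unfolding V_def using abs_diff_le_variation[OF ac that] .
  have acV: "abs_continuous_on a b V" unfolding V_def by (rule abs_continuous_on_variation[OF ac])
  have acVf: "abs_continuous_on a b (\<lambda>x. V x + f x)"
    by (rule abs_continuous_on_dist_sum[OF acV ac]) (auto simp: dist_real_def)
  have Vm: "V x \<le> V y" if "a \<le> x" "x \<le> y" "y \<le> b" for x y
    using V[OF that] by linarith
  obtain g1 where g1: "g1 absolutely_integrable_on {a..b}" "\<And>x. x \<in> {a..b} \<Longrightarrow> V x = V a + integral {a..x} g1"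
    using abs_continuous_mono_has_density[OF acV \<open>a \<le> b\<close> Vm] by blast
  have Vf: "V x + f x \<le> V y + f y" if "a \<le> x" "x \<le> y" "y \<le> b" for x y
    using V[OF that] by linarith
  obtain g2 where g2: "g2 absolutely_integrable_on {a..b}"
      "\<And>x. x \<in> {a..b} \<Longrightarrow> V x + f x = V a + f a + integral {a..x} g2"
    using abs_continuous_mono_has_density[OF acVf \<open>a \<le> b\<close> Vf] by blast
  show ?thesis
  proof
    show "(\<lambda>x. g2 x - g1 x) absolutely_integrable_on {a..b}"
      by (rule set_integral_diff(1)[OF g2(1) g1(1)])
    fix x assume x: "x \<in> {a..b}"
    have "g1 integrable_on {a..x}" "g2 integrable_on {a..x}"
      using g1(1) g2(1) x by (auto intro!: set_lebesgue_integral_eq_integral(1) intro: absolutely_integrable_on_subinterval)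
    then have "integral {a..x} (\<lambda>x. g2 x - g1 x) = integral {a..x} g2 - integral {a..x} g1"
      by (intro integral_diff)
    then show "f x = f a + integral {a..x} (\<lambda>x. g2 x - g1 x)"
      using g1(2)[OF x] g2(2)[OF x] by simp
  qed
qed

lemma abs_continuous_on_has_density:
  fixes c :: "real \<Rightarrow> real ^ 'n"
  assumes ac: "abs_continuous_on a b c" and "a \<le> b"
  obtains g where "g absolutely_integrable_on {a..b}"
    "\<And>x. x \<in> {a..b} \<Longrightarrow> c x = c a + integral {a..x} g"
proof -
  have "\<exists>g. g absolutely_integrable_on {a..b} \<and> (\<forall>x\<in>{a..b}. c x $ i = c a $ i + integral {a..x} g)" for i
  proof -
    have "abs_continuous_on a b (\<lambda>x. c x $ i)"
    proof (rule abs_continuous_on_dist_sum[OF ac ac])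
      fix x y
      have "dist (c x $ i) (c y $ i) \<le> dist (c x) (c y)" by (rule dist_vec_nth_le)
      also have "\<dots> \<le> dist (c x) (c y) + dist (c x) (c y)" by simp
      finally show "dist (c x $ i) (c y $ i) \<le> dist (c x) (c y) + dist (c x) (c y)" .
    qed
    then show ?thesis
    proof (rule abs_continuous_on_has_density_real[OF _ \<open>a \<le> b\<close>])
      fix g assume "g absolutely_integrable_on {a..b}"
        "\<And>x. x \<in> {a..b} \<Longrightarrow> c x $ i = c a $ i + integral {a..x} g"
      then show ?thesis by (intro exI conjI ballI)
    qed
  qed
  then have "\<forall>i. \<exists>g. g absolutely_integrable_on {a..b} \<and> (\<forall>x\<in>{a..b}. c x $ i = c a $ i + integral {a..x} g)"
    by blast
  from choice[OF this] obtain g where g: "\<And>i. g i absolutely_integrable_on {a..b}"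
    "\<And>i x. x \<in> {a..b} \<Longrightarrow> c x $ i = c a $ i + integral {a..x} (g i)" by blast
  define G where "G x = (\<chi> i. g i x)" for x
  have G: "G absolutely_integrable_on {a..b}"
    by (subst absolutely_integrable_on_iff_component) (auto simp: G_def g)
  show ?thesis
  proof
    fix x assume x: "x \<in> {a..b}"
    have int: "G integrable_on {a..x}"
      using G x by (auto intro!: set_lebesgue_integral_eq_integral(1) intro: absolutely_integrable_on_subinterval)
    have "integral {a..x} (\<lambda>s. G s $ i) = integral {a..x} G $ i" for i
      using integral_linear[OF int bounded_linear_vec_nth] by (simp add: o_def)
    then show "c x = c a + integral {a..x} G"
      using g(2)[OF x] by (simp add: vec_eq_iff G_def)
  qed fact
qed

section \<open>Differentiation of integrals, and curves dominated by an integral\<close>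

lemma AE_has_vector_derivative_integral:
  fixes g :: "real \<Rightarrow> 'b::euclidean_space"
  assumes g: "g integrable_on {a..b}"
  obtains N where "negligible N"
    "\<And>x. x \<in> {a<..<b} \<Longrightarrow> x \<notin> N \<Longrightarrow> ((\<lambda>t. integral {a..t} g) has_vector_derivative g x) (at x)"
proof -
  \<comment> \<open>Extension by 0 gives a function integrable on every interval, to which the
    differentiation theorem applies.\<close>
  define g0 where "g0 x = (if x \<in> {a..b} then g x else 0)" for x
  have g0: "g0 integrable_on UNIV" unfolding g0_def integrable_restrict_UNIV by (rule g)
  have g0c: "g0 integrable_on cbox c d" for c d by (rule integrable_on_subcbox[OF g0]) simp
  \<comment> \<open>The differentiation theorem averages over cubes with lower corner
    \<open>x\<close>, which in dimension one gives the right derivative. The left derivative comes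
    from the reflected function, at the cost of a reflected null set.\<close>
  have g0r: "(\<lambda>x. g0 (- x)) integrable_on cbox c d" for c d
    using g0c[of "- d" "- c"] Henstock_Kurzweil_Integration.integrable_reflect_real[of g0 "- c" "- d"] by simp
  have ex: "\<exists>N. negligible N \<and> (\<forall>x e. x \<notin> N \<longrightarrow> 0 < e \<longrightarrow>
      (\<exists>d>0. \<forall>h. 0 < h \<and> h < d \<longrightarrow> norm (integral (cbox x (x + h *\<^sub>R One)) f /\<^sub>R h ^ DIM(real) - f x) < e))"
    if f: "\<And>c d. f integrable_on cbox c d" for f :: "real \<Rightarrow> 'b"
  proof (rule integrable_ccontinuous_explicit[OF f])
    fix N :: "real set"
    assume "negligible N" "\<And>x e. x \<notin> N \<Longrightarrow> 0 < e \<Longrightarrow>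
      \<exists>d>0. \<forall>h. 0 < h \<and> h < d \<longrightarrow> norm (integral (cbox x (x + h *\<^sub>R One)) f /\<^sub>R h ^ DIM(real) - f x) < e"
    then show ?thesis by (rule_tac exI, intro conjI allI impI)
  qed
  obtain N1 where N1: "negligible N1" "\<forall>x e. x \<notin> N1 \<longrightarrow> 0 < e \<longrightarrow>
      (\<exists>d>0. \<forall>h. 0 < h \<and> h < d \<longrightarrow> norm (integral (cbox x (x + h *\<^sub>R One)) g0 /\<^sub>R h ^ DIM(real) - g0 x) < e)"
    using ex[OF g0c] by blast
  obtain N2 where N2: "negligible N2" "\<forall>x e. x \<notin> N2 \<longrightarrow> 0 < e \<longrightarrow>
      (\<exists>d>0. \<forall>h. 0 < h \<and> h < d \<longrightarrow>
        norm (integral (cbox x (x + h *\<^sub>R One)) (\<lambda>x. g0 (- x)) /\<^sub>R h ^ DIM(real) - g0 (- x)) < e)"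
    using ex[OF g0r] by blast
  show ?thesis
  proof
    show "negligible (N1 \<union> uminus ` N2)"
      using N1(1) N2(1)
      by (intro negligible_Un negligible_differentiable_image_negligible) (auto intro!: derivative_intros)
    fix x assume x: "x \<in> {a<..<b}" and "x \<notin> N1 \<union> uminus ` N2"
    then have nx: "x \<notin> N1" "- x \<notin> N2" by force+
    have scale: "norm (I - h *\<^sub>R y) \<le> e * h" if "norm (I /\<^sub>R h - y) < e" "h > 0" for I y :: 'b and h e :: real
    proof -
      have "I - h *\<^sub>R y = h *\<^sub>R (I /\<^sub>R h - y)" using \<open>h > 0\<close> by (simp add: algebra_simps)
      then have "norm (I - h *\<^sub>R y) = h * norm (I /\<^sub>R h - y)" using \<open>h > 0\<close> by simp
      also have "\<dots> \<le> h * e" using that by (intro mult_left_mono) auto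
      finally show ?thesis by (simp add: mult.commute)
    qed
    show "((\<lambda>t. integral {a..t} g) has_vector_derivative g x) (at x)"
      unfolding has_vector_derivative_def has_derivative_at_alt
    proof (intro conjI allI impI bounded_linear_scaleR_left)
      fix e :: real assume "e > 0"
      obtain d1 where "d1 > 0" and d1: "\<And>h. 0 < h \<Longrightarrow> h < d1 \<Longrightarrow>
          norm (integral (cbox x (x + h *\<^sub>R One)) g0 /\<^sub>R h ^ DIM(real) - g0 x) < e"
        using N1(2)[rule_format, OF nx(1) \<open>e > 0\<close>] by blast
      obtain d2 where "d2 > 0" and d2: "\<And>h. 0 < h \<Longrightarrow> h < d2 \<Longrightarrow>
          norm (integral (cbox (- x) (- x + h *\<^sub>R One)) (\<lambda>x. g0 (- x)) /\<^sub>R h ^ DIM(real) - g0 (- (- x))) < e"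
        using N2(2)[rule_format, OF nx(2) \<open>e > 0\<close>] by blast
      define d where "d = Min {d1, d2, x - a, b - x}"
      have d: "d > 0" "d \<le> d1" "d \<le> d2" "d \<le> x - a" "d \<le> b - x"
        using x \<open>d1 > 0\<close> \<open>d2 > 0\<close> by (auto simp: d_def)
      have int_eq: "integral {y..z} g0 = integral {y..z} g" if "a \<le> y" "z \<le> b" for y z
        by (rule integral_cong) (use that in \<open>auto simp: g0_def\<close>)
      have comb: "integral {a..y} g + integral {y..z} g = integral {a..z} g" if "a \<le> y" "y \<le> z" "z \<le> b" for y z
        by (rule Henstock_Kurzweil_Integration.integral_combine)
          (use that g in \<open>auto intro: integrable_on_subinterval\<close>)
      have g0x: "g0 x = g x" using x by (auto simp: g0_def)
      show "\<exists>d>0. \<forall>y. norm (y - x) < d \<longrightarrow>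
          norm (integral {a..y} g - integral {a..x} g - (y - x) *\<^sub>R g x) \<le> e * norm (y - x)"
      proof (intro exI conjI allI impI)
        fix y assume y: "norm (y - x) < d"
        consider "y = x" | "y > x" | "y < x" by linarith
        then show "norm (integral {a..y} g - integral {a..x} g - (y - x) *\<^sub>R g x) \<le> e * norm (y - x)"
        proof cases
          case 2
          have "norm (integral {x..y} g /\<^sub>R (y - x) - g x) < e"
            using d1[of "y - x"] 2 y d x int_eq[of x y] by (simp add: g0x)
          from scale[OF this] have "norm (integral {x..y} g - (y - x) *\<^sub>R g x) \<le> e * (y - x)" using 2 by simp
          moreover have "integral {a..x} g + integral {x..y} g = integral {a..y} g"
            using 2 y d x by (intro comb) auto
          then have "integral {a..y} g - integral {a..x} g = integral {x..y} g"
            by (metis add_diff_cancel_left')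
          ultimately show ?thesis using 2 by simp
        next
          case 3
          have "integral {- x..- y} (\<lambda>x. g0 (- x)) = integral {y..x} g0"
            by (rule Henstock_Kurzweil_Integration.integral_reflect_real)
          then have "norm (integral {y..x} g /\<^sub>R (x - y) - g x) < e"
            using d2[of "x - y"] 3 y d x int_eq[of y x] by (simp add: g0x)
          from scale[OF this] have "norm (integral {y..x} g - (x - y) *\<^sub>R g x) \<le> e * (x - y)" using 3 by simp
          moreover have "integral {a..y} g - integral {a..x} g - (y - x) *\<^sub>R g x
              = - (integral {y..x} g - (x - y) *\<^sub>R g x)"
          proof -
            have "integral {a..y} g + integral {y..x} g = integral {a..x} g"
              using 3 y d x by (intro comb) auto
            then have "integral {a..y} g - integral {a..x} g = - integral {y..x} g"
              by (metis add_diff_cancel_left' minus_diff_eq)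
            then show ?thesis by (simp add: algebra_simps)
          qed
          ultimately show ?thesis using 3 by (simp only: norm_minus_cancel) simp
        qed simp
      qed (use d in auto)
    qed
  qed
qed

text \<open>Closed intervals of the family may touch, so the integrand is cut off to the open ones,
  which changes it at end points only.\<close>

lemma sum_integral_disjoint_le:
  fixes h :: "real \<Rightarrow> real"
  assumes h: "h integrable_on {a..b}" "\<And>x. x \<in> {a..b} \<Longrightarrow> 0 \<le> h x"
    and fam: "interval_family a b D"
  shows "(\<Sum>(c, d)\<in>D. integral {c..d} h) \<le> integral {a..b} h"
proof -
  have D: "finite D" "\<forall>(c, d)\<in>D. a \<le> c \<and> c \<le> d \<and> d \<le> b"
    and disj: "pairwise (\<lambda>I J. {fst I<..<snd I} \<inter> {fst J<..<snd J} = {}) D"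
    using fam by (auto simp: interval_family_def)
  define k where "k I x = (if x \<in> {fst I<..<snd I} then h x else 0)" for I x
  have sub: "{fst I<..<snd I} \<inter> {a..b} = {fst I<..<snd I}" if "I \<in> D" for I
    using D(2) that by auto
  have int: "k I integrable_on {a..b}" if "I \<in> D" for I
    unfolding k_def integrable_restrict_Int sub[OF that] integrable_on_open_interval_real
    using D(2) that by (auto intro!: integrable_on_subinterval[OF h(1)])
  have "(\<Sum>(c, d)\<in>D. integral {c..d} h) = (\<Sum>I\<in>D. integral {a..b} (k I))"
    unfolding case_prod_beta'
  proof (rule sum.cong[OF refl])
    fix I assume "I \<in> D"
    show "integral {fst I..snd I} h = integral {a..b} (k I)"
      unfolding k_def integral_restrict_Int sub[OF \<open>I \<in> D\<close>] by (rule integral_open_interval_real)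
  qed
  also have "\<dots> = integral {a..b} (\<lambda>x. \<Sum>I\<in>D. k I x)"
    using int by (intro integral_sum[symmetric] D)
  also have "\<dots> \<le> integral {a..b} h"
  proof (rule integral_le[OF integrable_sum h(1)])
    fix x assume x: "x \<in> {a..b}"
    show "(\<Sum>I\<in>D. k I x) \<le> h x"
    proof (cases "\<exists>I\<in>D. x \<in> {fst I<..<snd I}")
      case True
      then obtain I where I: "I \<in> D" "x \<in> {fst I<..<snd I}" by blast
      have "k J x = 0" if "J \<in> D - {I}" for J
      proof -
        have "{fst I<..<snd I} \<inter> {fst J<..<snd J} = {}" using pairwiseD[OF disj, of I J] I that by auto
        then show ?thesis using I(2) unfolding k_def by (auto simp only: split: if_splits)
      qed
      then have "(\<Sum>J\<in>D. k J x) = k I x"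
        using sum.remove[OF D(1) I(1), of "\<lambda>J. k J x"] sum.neutral[of "D - {I}" "\<lambda>J. k J x"] by simp
      then show ?thesis using I by (simp add: k_def)
    next
      case False
      then have "(\<Sum>I\<in>D. k I x) = 0" by (intro sum.neutral) (auto simp: k_def)
      then show ?thesis using h(2)[OF x] by simp
    qed
  qed (use D int in auto)
  finally show ?thesis .
qed

text \<open>Integrals of \<open>f\<close> over short families are uniformly small: \<open>f\<close>
  is its truncation at height \<open>k\<close> plus a remainder whose integral over all of [a, b] is
  below \<open>e / 2\<close> for a large \<open>k\<close>, by dominated convergence.\<close>

lemma abs_continuous_onI_integral:
  fixes f :: "real \<Rightarrow> real"
  assumes f: "f integrable_on {a..b}" "\<And>x. x \<in> {a..b} \<Longrightarrow> 0 \<le> f x"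
    and le: "\<And>s r. a \<le> s \<Longrightarrow> s \<le> r \<Longrightarrow> r \<le> b \<Longrightarrow> dist (\<gamma> s) (\<gamma> r) \<le> integral {s..r} f"
  shows "abs_continuous_on a b \<gamma>"
  unfolding abs_continuous_on_iff
proof (intro allI impI)
  fix e :: real assume "e > 0"
  define fk where "fk k x = min (f x) (real k)" for k x
  have fk: "fk k integrable_on {a..b}" for k
  proof -
    have "f absolutely_integrable_on {a..b}" by (rule nonnegative_absolutely_integrable_1[OF f])
    moreover have "(\<lambda>x. real k) absolutely_integrable_on {a..b}"
      by (rule nonnegative_absolutely_integrable_1) auto
    ultimately have "(\<lambda>x. \<Sum>i\<in>Basis. min (f x \<bullet> i) (real k \<bullet> i) *\<^sub>R i) absolutely_integrable_on {a..b}"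
      by (rule absolutely_integrable_min)
    then show ?thesis unfolding fk_def by (auto dest: set_lebesgue_integral_eq_integral(1))
  qed
  have "(\<lambda>k. integral {a..b} (fk k)) \<longlonglongrightarrow> integral {a..b} f"
  proof (rule dominated_convergence(2)[OF fk f(1)])
    show "norm (fk k x) \<le> f x" if "x \<in> {a..b}" for k x using f(2)[OF that] by (auto simp: fk_def)
    fix x
    have "\<forall>\<^sub>F k in sequentially. fk k x = f x"
      using eventually_ge_at_top[of "nat \<lceil>f x\<rceil>"]
      by eventually_elim (simp add: fk_def nat_le_iff ceiling_le_iff)
    then show "(\<lambda>k. fk k x) \<longlonglongrightarrow> f x" by (rule tendsto_eventually)
  qed
  then obtain k where k: "\<bar>integral {a..b} (fk k) - integral {a..b} f\<bar> < e / 2"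
    using \<open>e > 0\<close> LIMSEQ_D[of _ _ "e / 2"] by fastforce
  \<comment> \<open>Makes \<open>real k * d\<close> at most \<open>e / 2\<close>; the added 1 covers
    \<open>k = 0\<close>.\<close>
  define d where "d = e / (2 * (real k + 1))"
  have "d > 0" using \<open>e > 0\<close> by (simp add: d_def add_nonneg_pos)
  show "\<exists>\<delta>>0. \<forall>D. interval_family a b D \<longrightarrow>
        (\<Sum>(c, d)\<in>D. d - c) < \<delta> \<longrightarrow>
        (\<Sum>(c, d)\<in>D. dist (\<gamma> c) (\<gamma> d)) < e"
  proof (intro exI conjI allI impI)
    show "d > 0" by fact
    fix D
    assume fam: "interval_family a b D"
      and sum: "(\<Sum>(c, d)\<in>D. d - c) < d"
    then have D: "\<forall>(c, d)\<in>D. a \<le> c \<and> c \<le> d \<and> d \<le> b"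
      by (auto simp: interval_family_def)
    have "(\<Sum>(c, d)\<in>D. dist (\<gamma> c) (\<gamma> d))
        \<le> (\<Sum>(c, d)\<in>D. integral {c..d} (\<lambda>x. f x - fk k x)) + (\<Sum>(c, d)\<in>D. real k * (d - c))"
      unfolding case_prod_beta' sum.distrib[symmetric]
    proof (rule sum_mono)
      fix I assume "I \<in> D"
      then have I: "a \<le> fst I" "fst I \<le> snd I" "snd I \<le> b" using D by auto
      have int: "f integrable_on {fst I..snd I}" "fk k integrable_on {fst I..snd I}"
        using I by (auto intro!: integrable_on_subinterval[OF f(1)] integrable_on_subinterval[OF fk])
      have "integral {fst I..snd I} (fk k) \<le> integral {fst I..snd I} (\<lambda>_. real k)"
        using int by (intro integral_le) (auto simp: fk_def)
      also have "\<dots> = real k * (snd I - fst I)" using I by simp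
      finally have "integral {fst I..snd I} f - real k * (snd I - fst I)
          \<le> integral {fst I..snd I} f - integral {fst I..snd I} (fk k)" by simp
      also have "\<dots> = integral {fst I..snd I} (\<lambda>x. f x - fk k x)"
        using int by (rule integral_diff[symmetric])
      finally show "dist (\<gamma> (fst I)) (\<gamma> (snd I))
          \<le> integral {fst I..snd I} (\<lambda>x. f x - fk k x) + real k * (snd I - fst I)"
        using le[OF I] by simp
    qed
    also have "(\<Sum>(c, d)\<in>D. integral {c..d} (\<lambda>x. f x - fk k x)) \<le> integral {a..b} (\<lambda>x. f x - fk k x)"
      by (intro sum_integral_disjoint_le fam integrable_diff f(1) fk) (simp add: fk_def)
    also have "\<dots> < e / 2" using k unfolding integral_diff[OF f(1) fk[of k]] abs_less_iff by simp
    also have "(\<Sum>(c, d)\<in>D. real k * (d - c)) = real k * (\<Sum>(c, d)\<in>D. d - c)"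
      by (simp add: sum_distrib_left case_prod_beta')
    also have "\<dots> \<le> real k * d" using sum by (intro mult_left_mono) auto
    also have "\<dots> \<le> e / 2"
      using \<open>e > 0\<close> by (simp add: d_def field_simps)
    finally show "(\<Sum>(c, d)\<in>D. dist (\<gamma> c) (\<gamma> d)) < e" by simp
  qed
qed

section \<open>Lagrangians\<close>

locale tonelli =
  fixes h :: "('n::finite, 'm::finite) hamiltonian" and \<Theta> :: real
  assumes C2: "C2_hamiltonian h"
    and convex: "\<And>x u. strictly_convex (\<lambda>p. h x p u)"
    and superlin: "\<And>x u. superlinear (\<lambda>p. h x p u)"
    and \<Theta>_pos: "0 < \<Theta>"
    and lip: "\<And>x p u v. \<bar>h x p u - h x p v\<bar> \<le> \<Theta> * infnorm (u - v)"
begin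

lemma continuous_hamiltonian: "continuous_on UNIV (\<lambda>(x, p, u). h x p u)"
proof -
  obtain f' where "\<And>z. ((\<lambda>(X, p, u). h (to_torus X) p u) has_derivative blinfun_apply (f' z)) (at z)"
    using C2 unfolding C2_hamiltonian_def C2_on_def by blast
  then have "continuous_on UNIV (\<lambda>(X, p, u). h (to_torus X) p u)"
    by (intro continuous_at_imp_continuous_on ballI has_derivative_continuous)
  then show ?thesis
    using continuous_on_torus_Times[of UNIV "\<lambda>(x, p, u). h x p u"] by simp
qed

lemma tendsto_hamiltonian [tendsto_intros]:
  assumes "(f \<longlongrightarrow> x) F" "(g \<longlongrightarrow> p) F" "(k \<longlongrightarrow> u) F"
  shows "((\<lambda>s. h (f s) (g s) (k s)) \<longlongrightarrow> h x p u) F"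
  using continuous_on_tendsto_compose[OF continuous_hamiltonian tendsto_Pair[OF assms(1) tendsto_Pair[OF assms(2,3)]]]
  by simp

lemma continuous_on_hamiltonian [continuous_intros]:
  assumes "continuous_on S f" "continuous_on S g" "continuous_on S k"
  shows "continuous_on S (\<lambda>s. h (f s) (g s) (k s))"
  using assms unfolding continuous_on_def by (auto intro: tendsto_hamiltonian)

lemma hamiltonian_convex:
  assumes "0 \<le> a" "a \<le> 1"
  shows "h x ((1 - a) *\<^sub>R p + a *\<^sub>R q) u \<le> (1 - a) * h x p u + a * h x q u"
proof (cases "p = q \<or> a = 0 \<or> a = 1")
  case True
  then show ?thesis
  proof (elim disjE)
    assume "p = q"
    then have "(1 - a) *\<^sub>R p + a *\<^sub>R q = q" "(1 - a) * h x p u + a * h x q u = h x q u"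
      by (simp_all add: algebra_simps)
    then show ?thesis by simp
  qed simp_all
next
  case False
  with assms have "0 < a" "a < 1" "p \<noteq> q" by auto
  then show ?thesis using convex[of x u] unfolding strictly_convex_def by (meson less_imp_le)
qed

text \<open>Slopes of a convex function along a ray from 0 do not decrease: a large slope on a
  sphere persists outside it, and a small one persists inside.\<close>

lemma hamiltonian_radial:
  assumes "0 < r" "r \<le> norm p"
  shows "h x ((r / norm p) *\<^sub>R p) u - h x 0 u \<le> r / norm p * (h x p u - h x 0 u)"
proof -
  have "h x ((1 - r / norm p) *\<^sub>R 0 + (r / norm p) *\<^sub>R p) u
      \<le> (1 - r / norm p) * h x 0 u + r / norm p * h x p u"
    using assms by (intro hamiltonian_convex) (auto simp: divide_le_eq_1)
  then show ?thesis by (simp add: algebra_simps)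
qed

lemma hamiltonian_bounded_on_balls: "\<exists>C. \<forall>x p. norm p \<le> K \<longrightarrow> \<bar>h x p 0\<bar> \<le> C"
proof -
  have "compact ((\<lambda>(x, p). h x p 0) ` (UNIV \<times> cball 0 K))"
    unfolding case_prod_beta'
    by (intro compact_continuous_image compact_Times compact_UNIV_torus compact_cball continuous_intros)
  then obtain C where "\<forall>y\<in>(\<lambda>(x, p). h x p 0) ` (UNIV \<times> cball 0 K). norm y \<le> C"
    by (meson compact_imp_bounded bounded_iff)
  then have "\<bar>h x p 0\<bar> \<le> C" if "norm p \<le> K" for x p
    using that by force
  then show ?thesis by blast
qed

lemma superlinear_at:
  "\<exists>N. 0 < N \<and> (\<forall>p. norm p = real N \<longrightarrow> K * real N < h x p 0 - h x 0 0)"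
proof -
  have "\<forall>\<^sub>F p in at_infinity. K + \<bar>h x 0 0\<bar> + 1 < h x p 0 / norm p"
    using superlin[of x 0] unfolding superlinear_def filterlim_at_top_dense by blast
  then obtain b where b: "\<And>p. b \<le> norm p \<Longrightarrow> K + \<bar>h x 0 0\<bar> + 1 < h x p 0 / norm p"
    unfolding eventually_at_infinity by blast
  obtain N where N: "max b 1 \<le> real N" using real_arch_simple by blast
  have "K * real N < h x p 0 - h x 0 0" if p: "norm p = real N" for p
  proof -
    \<comment> \<open>\<open>c\<close> pays for \<open>h x 0 0\<close> on every sphere of radius at
      least 1.\<close>
    define c where "c = \<bar>h x 0 0\<bar> + 1"
    have c: "h x 0 0 < c" "0 \<le> c" by (simp_all add: c_def)
    have "K + c < h x p 0 / real N" using b[of p] N p by (simp add: c_def)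
    then have "(K + c) * real N < h x p 0" using N by (simp add: pos_less_divide_eq)
    moreover have "c * 1 \<le> c * real N" using N c by (intro mult_left_mono) auto
    moreover have "(K + c) * real N = K * real N + c * real N" by (rule distrib_right)
    ultimately show ?thesis using c by linarith
  qed
  moreover have "0 < N" using N by (cases N) auto
  ultimately show ?thesis by blast
qed

text \<open>Superlinearity is only assumed pointwise; by convexity, growth on a sphere propagates outwards,
  so that a compactness argument on spheres makes it uniform.\<close>

lemma superlinear_uniform_sphere:
  "\<exists>N. 0 < N \<and> (\<forall>x p. norm p = real N \<longrightarrow> K * real N < h x p 0 - h x 0 0)"
proof (rule ccontr)
  assume neg: "\<not> ?thesis"
  have "\<exists>xp. norm (snd xp) = real (Suc k) \<and> h (fst xp) (snd xp) 0 - h (fst xp) 0 0 \<le> K * real (Suc k)" for k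
  proof -
    from neg have "\<not> (\<forall>x p. norm p = real (Suc k) \<longrightarrow> K * real (Suc k) < h x p 0 - h x 0 0)" by blast
    then obtain x p where "norm p = real (Suc k)" "h x p 0 - h x 0 0 \<le> K * real (Suc k)"
      by (auto simp only: not_all not_imp not_less)
    then show ?thesis by (intro exI[of _ "(x, p)"]) simp
  qed
  then have "\<forall>k. \<exists>xp. norm (snd xp) = real (Suc k) \<and> h (fst xp) (snd xp) 0 - h (fst xp) 0 0 \<le> K * real (Suc k)"
    by blast
  from choice[OF this] obtain xp where xp: "\<And>k. norm (snd (xp k)) = real (Suc k)"
    "\<And>k. h (fst (xp k)) (snd (xp k)) 0 - h (fst (xp k)) 0 0 \<le> K * real (Suc k)" by blast
  define X where "X k = fst (xp k)" for k
  define P where "P k = snd (xp k)" for k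
  have P: "norm (P k) = real (Suc k)" "h (X k) (P k) 0 - h (X k) 0 0 \<le> K * real (Suc k)" for k
    unfolding X_def P_def by (rule xp)+
  obtain l r where r: "strict_mono r" "(X \<circ> r) \<longlonglongrightarrow> l"
    using compact_UNIV_torus unfolding compact_def by blast
  obtain N where N: "0 < N" "\<And>p. norm p = real N \<Longrightarrow> K * real N < h l p 0 - h l 0 0"
    using superlinear_at by blast
  \<comment> \<open>The failing momenta are pulled back to the sphere whose radius \<open>N\<close>
    works at the limit point \<open>l\<close>. By radial monotonicity the slope there is still at
    most \<open>K\<close>, and this sphere is compact.\<close>
  define Q where "Q k = (real N / norm (P k)) *\<^sub>R P k" for k
  have Pne: "norm (P k) \<noteq> 0" for k unfolding P(1) by simp
  have "norm (Q k) = real N" for k unfolding Q_def using Pne[of k] by simp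
  then have "(Q \<circ> r) k \<in> sphere 0 (real N)" for k by simp
  then obtain q r' where r': "q \<in> sphere 0 (real N)" "strict_mono r'" "((Q \<circ> r) \<circ> r') \<longlonglongrightarrow> q"
    using compact_sphere[of 0 "real N"] unfolding compact_def by blast
  have lim: "(\<lambda>k. h (((X \<circ> r) \<circ> r') k) (((Q \<circ> r) \<circ> r') k) 0 - h (((X \<circ> r) \<circ> r') k) 0 0)
      \<longlonglongrightarrow> h l q 0 - h l 0 0"
    by (intro tendsto_intros LIMSEQ_subseq_LIMSEQ[OF r(2) r'(2)] r'(3))
  have "h (X k) (Q k) 0 - h (X k) 0 0 \<le> K * real N" if "N \<le> k" for k
  proof -
    have "h (X k) (Q k) 0 - h (X k) 0 0 \<le> real N / norm (P k) * (h (X k) (P k) 0 - h (X k) 0 0)"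
      unfolding Q_def using N that P(1)[of k] by (intro hamiltonian_radial) auto
    also have "\<dots> \<le> real N / norm (P k) * (K * norm (P k))"
      using P by (intro mult_left_mono) auto
    also have "\<dots> = K * real N" using Pne[of k] by simp
    finally show ?thesis .
  qed
  moreover have "N \<le> r (r' k)" if "N \<le> k" for k
    using that seq_suble[OF r(1), of "r' k"] seq_suble[OF r'(2), of k] by linarith
  ultimately have "h l q 0 - h l 0 0 \<le> K * real N"
    using tendsto_upperbound[OF lim, of "K * real N"]
    by (auto simp: eventually_sequentially intro!: exI[of _ N])
  then show False using N(2)[of q] r'(1) by simp
qed

text \<open>At value 0, compactness bounds \<open>h\<close> inside the good sphere and convexity
  keeps the slope above \<open>K\<close> outside; the Lipschitz condition then passes from value 0
  to \<open>u\<close>.\<close>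

lemma hamiltonian_superlinear:
  assumes "0 \<le> K"
  shows "\<exists>C. \<forall>x p u. K * norm p - C - \<Theta> * infnorm u \<le> h x p u"
proof -
  obtain N where N: "0 < N" "\<And>x p. norm p = real N \<Longrightarrow> K * real N < h x p 0 - h x 0 0"
    using superlinear_uniform_sphere by blast
  obtain B where B: "\<And>x p. norm p \<le> real N \<Longrightarrow> \<bar>h x p 0\<bar> \<le> B"
    using hamiltonian_bounded_on_balls by blast
  have "K * norm p - (B + K * real N) \<le> h x p 0" for x p
  proof (cases "norm p \<le> real N")
    case True
    then have "K * norm p \<le> K * real N" using assms by (intro mult_left_mono) auto
    then show ?thesis using B[OF True, of x] by linarith
  next
    case False
    then have p: "real N \<le> norm p" "norm p > 0" using N(1) by auto
    have "K * real N < h x ((real N / norm p) *\<^sub>R p) 0 - h x 0 0"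
      using p by (intro N(2)) simp
    also have "\<dots> \<le> real N / norm p * (h x p 0 - h x 0 0)"
      using N(1) p by (intro hamiltonian_radial) auto
    finally have "real N * (K * norm p) < real N * (h x p 0 - h x 0 0)"
      using p(2) by (simp add: field_simps)
    then have "K * norm p < h x p 0 - h x 0 0" using N(1) by simp
    moreover have "- B \<le> h x 0 0" using B[of 0 x] N(1) by simp
    moreover have "0 \<le> K * real N" using assms by simp
    ultimately show ?thesis by linarith
  qed
  then have "K * norm p - (B + K * real N) - \<Theta> * infnorm u \<le> h x p u" for x p u
  proof -
    have "\<bar>h x p u - h x p 0\<bar> \<le> \<Theta> * infnorm u" using lip[of x p u 0] by simp
    moreover note \<open>\<And>x p. K * norm p - (B + K * real N) \<le> h x p 0\<close>[of p x]
    ultimately show ?thesis by linarith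
  qed
  then show ?thesis by blast
qed

lemma hamiltonian_upper: "\<exists>C. \<forall>x p u. norm p \<le> K \<longrightarrow> h x p u \<le> C + \<Theta> * infnorm u"
proof -
  obtain B where B: "\<And>x p. norm p \<le> K \<Longrightarrow> \<bar>h x p 0\<bar> \<le> B"
    using hamiltonian_bounded_on_balls by blast
  have "h x p u \<le> B + \<Theta> * infnorm u" if "norm p \<le> K" for x p u
    using lip[of x p u 0] B[OF that, of x] by simp
  then show ?thesis by blast
qed

section \<open>Convex duality\<close>

lemma bdd_above_lagrangian: "bdd_above (range (\<lambda>p. p \<bullet> v - h x p u))"
proof -
  obtain C where C: "\<And>x p u. norm v * norm p - C - \<Theta> * infnorm u \<le> h x p u"
    using hamiltonian_superlinear[of "norm v"] by auto
  have "p \<bullet> v - h x p u \<le> C + \<Theta> * infnorm u" for p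
    using C[of p u x] norm_cauchy_schwarz[of p v] by (simp add: mult.commute)
  then show ?thesis by (auto simp: bdd_above_def)
qed

lemma fenchel: "p \<bullet> v - h x p u \<le> lagrangian h x v u"
  unfolding lagrangian_def by (rule cSUP_upper[OF UNIV_I bdd_above_lagrangian])

lemma lagrangian_leI: "(\<And>p. p \<bullet> v - h x p u \<le> B) \<Longrightarrow> lagrangian h x v u \<le> B"
  unfolding lagrangian_def by (rule cSUP_least) auto

lemma less_lagrangianE:
  assumes "B < lagrangian h x v u"
  obtains p where "B < p \<bullet> v - h x p u"
  using assms lagrangian_leI[of v x u B] by (meson not_less)

lemma lagrangian_superlinear:
  assumes "0 \<le> K"
  shows "\<exists>C. \<forall>x v u. K * norm v - C - \<Theta> * infnorm u \<le> lagrangian h x v u"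
proof -
  obtain C where C: "\<And>x p u. norm p \<le> K \<Longrightarrow> h x p u \<le> C + \<Theta> * infnorm u"
    using hamiltonian_upper by blast
  have "K * norm v - C - \<Theta> * infnorm u \<le> lagrangian h x v u" for x v u
  proof -
    \<comment> \<open>The momentum of length at most \<open>K\<close> along \<open>v\<close>
      extracts \<open>K * norm v\<close> from the supremum.\<close>
    define p where "p = K *\<^sub>R sgn v"
    have "norm p \<le> K" using assms by (simp add: p_def norm_sgn)
    moreover have "p \<bullet> v = K * norm v"
      by (simp add: p_def sgn_div_norm power2_norm_eq_inner[symmetric] power2_eq_square divide_simps)
    ultimately show ?thesis using fenchel[of p v x u] C[of p x u] by linarith
  qed
  then show ?thesis by blast
qed

lemma lagrangian_upper:
  assumes "0 \<le> K"
  shows "\<exists>C. \<forall>x v u. norm v \<le> K \<longrightarrow> lagrangian h x v u \<le> C + \<Theta> * infnorm u"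
proof -
  obtain C where C: "\<And>x p u. K * norm p - C - \<Theta> * infnorm u \<le> h x p u"
    using hamiltonian_superlinear[OF assms] by blast
  have "lagrangian h x v u \<le> C + \<Theta> * infnorm u" if "norm v \<le> K" for x v u
  proof (rule lagrangian_leI)
    fix p
    have "p \<bullet> v \<le> norm p * norm v" by (rule norm_cauchy_schwarz)
    also have "\<dots> \<le> norm p * K" using that by (intro mult_left_mono) auto
    finally show "p \<bullet> v - h x p u \<le> C + \<Theta> * infnorm u"
      using C[of p u x] by (simp add: mult.commute)
  qed
  then show ?thesis by blast
qed

lemma lagrangian_lip: "\<bar>lagrangian h x v u - lagrangian h x v u'\<bar> \<le> \<Theta> * infnorm (u - u')"
proof -
  have *: "lagrangian h x v u \<le> lagrangian h x v u' + \<Theta> * infnorm (u - u')" for u u'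
  proof (rule lagrangian_leI)
    show "p \<bullet> v - h x p u \<le> lagrangian h x v u' + \<Theta> * infnorm (u - u')" for p
      using fenchel[of p v x u'] lip[of x p u u'] by linarith
  qed
  show ?thesis using *[of u u'] *[of u' u] by (simp add: infnorm_sub abs_le_iff)
qed

text \<open>A supremum of continuous functions is lower semicontinuous: its strict superlevel sets
  are unions of open sets.\<close>

lemma borel_measurable_lagrangian: "(\<lambda>(X, v, u). lagrangian h (to_torus X) v u) \<in> borel_measurable borel"
proof (rule borel_measurableI_greater)
  fix a
  have "{z. a < (\<lambda>(X, v, u). lagrangian h (to_torus X) v u) z}
      = (\<Union>p. {z. a < p \<bullet> fst (snd z) - h (to_torus (fst z)) p (snd (snd z))})"
    by (fastforce elim: less_lagrangianE intro: less_le_trans[OF _ fenchel])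
  also have "open \<dots>"
    by (intro open_UN ballI open_Collect_less continuous_intros)
  finally show "{z \<in> space borel. a < (\<lambda>(X, v, u). lagrangian h (to_torus X) v u) z} \<in> sets borel"
    by simp
qed

text \<open>The gradient of a convex function is a subgradient: with \<open>w\<close> the gradient
  of \<open>h\<close> in the momentum at \<open>q\<close>, the supremum defining the Lagrangian at
  \<open>w\<close> is attained at \<open>q\<close>. In subsolution tests this turns a bound on the
  Lagrangian into one on the Hamiltonian.\<close>

lemma lagrangian_attained: "\<exists>w. lagrangian h x w u = q \<bullet> w - h x q u"
proof -
  obtain X where X: "to_torus X = x" using to_torus_surj by blast
  obtain f' where f': "\<And>z. ((\<lambda>(X, p, u). h (to_torus X) p u) has_derivative blinfun_apply (f' z)) (at z)"
    using C2 unfolding C2_hamiltonian_def C2_on_def by blast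
  have "((\<lambda>z. (X, z, u)) has_derivative (\<lambda>z. (0, z, 0))) (at q)"
    by (auto intro!: derivative_eq_intros)
  from has_derivative_compose[OF this f'[of "(X, q, u)"]]
  have D: "((\<lambda>z. h x z u) has_derivative (\<lambda>z. blinfun_apply (f' (X, q, u)) (0, z, 0))) (at q)"
    by (simp add: X)
  define D' where "D' z = blinfun_apply (f' (X, q, u)) (0, z, 0)" for z
  have lin: "linear D'" using has_derivative_linear[OF D] by (simp add: D'_def[abs_def])
  \<comment> \<open>The adjoint of a linear functional, applied to 1, is the vector that represents
    it.\<close>
  define w where "w = adjoint D' 1"
  have w: "D' z = z \<bullet> w" for z using adjoint_works[OF lin, of z 1] by (simp add: w_def)
  have *: "(p - q) \<bullet> w \<le> h x p u - h x q u" for p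
  proof -
    have "((\<lambda>a. q + a *\<^sub>R (p - q)) has_derivative (\<lambda>a. a *\<^sub>R (p - q))) (at 0)"
      by (auto intro!: derivative_eq_intros)
    moreover have "((\<lambda>z. h x z u) has_derivative D') (at (q + 0 *\<^sub>R (p - q)))"
      using D by (simp add: D'_def[abs_def])
    ultimately have "((\<lambda>a. h x (q + a *\<^sub>R (p - q)) u) has_derivative (\<lambda>a. D' (a *\<^sub>R (p - q)))) (at 0)"
      by (rule has_derivative_compose)
    then have "((\<lambda>a. h x (q + a *\<^sub>R (p - q)) u) has_real_derivative D' (p - q)) (at 0)"
      using lin by (simp add: has_field_derivative_def linear_scale mult.commute[of "D' (p - q)"] mult_commute_abs)
    then have "((\<lambda>a. (h x (q + a *\<^sub>R (p - q)) u - h x q u) / a) \<longlongrightarrow> D' (p - q)) (at 0)"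
      unfolding has_field_derivative_iff by simp
    then have "((\<lambda>a. (h x (q + a *\<^sub>R (p - q)) u - h x q u) / a) \<longlongrightarrow> D' (p - q)) (at_right 0)"
      by (simp add: filterlim_at_split)
    moreover have "\<forall>\<^sub>F a in at_right 0. (h x (q + a *\<^sub>R (p - q)) u - h x q u) / a \<le> h x p u - h x q u"
    proof -
      have "(h x (q + a *\<^sub>R (p - q)) u - h x q u) / a \<le> h x p u - h x q u" if "0 < a" "a < 1" for a
      proof -
        have "q + a *\<^sub>R (p - q) = (1 - a) *\<^sub>R q + a *\<^sub>R p" by (simp add: algebra_simps)
        then have "h x (q + a *\<^sub>R (p - q)) u \<le> (1 - a) * h x q u + a * h x p u"
          using hamiltonian_convex[of a x q p u] that by simp
        then have "h x (q + a *\<^sub>R (p - q)) u - h x q u \<le> (h x p u - h x q u) * a"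
          by (simp add: algebra_simps)
        then show ?thesis using that by (simp add: pos_divide_le_eq)
      qed
      then show ?thesis
        by (auto simp: eventually_at_right_field intro!: exI[of _ 1])
    qed
    ultimately have "D' (p - q) \<le> h x p u - h x q u"
      by (rule tendsto_upperbound) simp
    then show ?thesis by (simp add: w)
  qed
  have "lagrangian h x w u = q \<bullet> w - h x q u"
  proof (rule antisym[OF lagrangian_leI fenchel])
    show "p \<bullet> w - h x p u \<le> q \<bullet> w - h x q u" for p
      using *[of p] by (simp add: inner_diff_left)
  qed
  then show ?thesis ..
qed

text \<open>Along a sequence violating the claim, momenta that nearly attain the supremum are
  bounded by superlinearity. A limit momentum would exceed the supremum at \<open>x\<close> and
  \<open>u\<close>, against Fenchel's inequality.\<close>

lemma lagrangian_usc:
  assumes "0 < e"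
  shows "\<exists>d>0. \<forall>y u'. dist y x < d \<longrightarrow> dist u' u < d \<longrightarrow> lagrangian h y w u' < lagrangian h x w u + e"
proof (rule ccontr)
  assume neg: "\<not> ?thesis"
  define R where "R k y u' p \<longleftrightarrow> dist y x < inverse (real (Suc k)) \<and> dist u' u < inverse (real (Suc k)) \<and>
      lagrangian h x w u + e / 2 < p \<bullet> w - h y p u'" for k y u' p
  have "\<exists>z. R k (fst z) (fst (snd z)) (snd (snd z))" for k
  proof -
    have "inverse (real (Suc k)) > 0" by simp
    then obtain y u' where *: "dist y x < inverse (real (Suc k))" "dist u' u < inverse (real (Suc k))"
      "lagrangian h x w u + e \<le> lagrangian h y w u'"
      using neg by (meson not_less)
    then have "lagrangian h x w u + e / 2 < lagrangian h y w u'" using assms by linarith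
    then obtain p where "lagrangian h x w u + e / 2 < p \<bullet> w - h y p u'"
      by (rule less_lagrangianE)
    with * show ?thesis by (intro exI[of _ "(y, u', p)"]) (simp add: R_def)
  qed
  then have "\<forall>k. \<exists>z. R k (fst z) (fst (snd z)) (snd (snd z))" ..
  from choice[OF this] obtain z where z: "\<And>k. R k (fst (z k)) (fst (snd (z k))) (snd (snd (z k)))" by blast
  define Y U P where "Y k = fst (z k)" and "U k = fst (snd (z k))" and "P k = snd (snd (z k))" for k
  have Y: "dist (Y k) x < inverse (real (Suc k))" and U: "dist (U k) u < inverse (real (Suc k))"
    and P: "lagrangian h x w u + e / 2 < P k \<bullet> w - h (Y k) (P k) (U k)" for k
    using z[of k] unfolding R_def Y_def U_def P_def by auto
  have "Y \<longlonglongrightarrow> x" "U \<longlonglongrightarrow> u"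
    using Y U by (auto intro!: metric_tendsto_imp_tendsto[OF LIMSEQ_inverse_real_of_nat] always_eventually
        simp: dist_real_def less_imp_le)
  \<comment> \<open>Slope \<open>norm w + 1\<close> beats the linear term
    \<open>P k \<bullet> w\<close> and leaves \<open>norm (P k)\<close> to be bounded.\<close>
  obtain C where C: "\<And>x p u. (norm w + 1) * norm p - C - \<Theta> * infnorm u \<le> h x p u"
    using hamiltonian_superlinear[of "norm w + 1"] by auto
  have "norm (P k) \<le> C + \<Theta> * (norm u + 1) + \<bar>lagrangian h x w u\<bar>" for k
  proof -
    have "inverse (real (Suc k)) \<le> 1" by (simp add: inverse_le_1_iff)
    then have "norm (U k) \<le> norm u + 1"
      using U[of k] norm_triangle_sub[of "U k" u] by (simp add: dist_norm)
    then have "\<Theta> * infnorm (U k) \<le> \<Theta> * (norm u + 1)"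
      using infnorm_le_norm[of "U k"] \<Theta>_pos by (intro mult_left_mono) auto
    moreover have "P k \<bullet> w \<le> norm w * norm (P k)"
      using norm_cauchy_schwarz[of "P k" w] by (simp add: mult.commute)
    ultimately show ?thesis
      using P[of k] C[of "P k" "U k" "Y k"] assms by (simp add: algebra_simps)
  qed
  then have "P k \<in> cball 0 (C + \<Theta> * (norm u + 1) + \<bar>lagrangian h x w u\<bar>)" for k by simp
  then obtain p r where r: "strict_mono r" "(P \<circ> r) \<longlonglongrightarrow> p"
    using compact_cball[of 0 "C + \<Theta> * (norm u + 1) + \<bar>lagrangian h x w u\<bar>"]
    unfolding compact_def by blast
  have "(\<lambda>k. (P \<circ> r) k \<bullet> w - h ((Y \<circ> r) k) ((P \<circ> r) k) ((U \<circ> r) k)) \<longlonglongrightarrow> p \<bullet> w - h x p u"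
    by (intro tendsto_intros r(2) LIMSEQ_subseq_LIMSEQ[OF \<open>Y \<longlonglongrightarrow> x\<close> r(1)] LIMSEQ_subseq_LIMSEQ[OF \<open>U \<longlonglongrightarrow> u\<close> r(1)])
  then have "lagrangian h x w u + e / 2 \<le> p \<bullet> w - h x p u"
    using P by (intro tendsto_lowerbound[of _ _ sequentially]) (auto intro!: always_eventually less_imp_le)
  then show False using fenchel[of p w x u] assms by linarith
qed

end

section \<open>The value function\<close>

lemma absolutely_integrable_imp_integrable:
  fixes f :: "'a::euclidean_space \<Rightarrow> 'b::euclidean_space"
  shows "f absolutely_integrable_on S \<Longrightarrow> f integrable_on S"
  by (rule set_lebesgue_integral_eq_integral(1))

text \<open>Integrated backwards from the end point \<open>X\<close> at time \<open>t\<close>,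
  because curves are constrained at the final time and free at the initial one.\<close>

definition traj :: "real ^ 'n \<Rightarrow> real \<Rightarrow> (real \<Rightarrow> real ^ 'n) \<Rightarrow> real \<Rightarrow> real ^ 'n" where
  "traj X t g s = X - integral {s..t} g"

lemma traj_end [simp]: "traj X t g t = X"
  by (simp add: traj_def)

lemma traj_cut:
  assumes "s \<le> r" "r \<le> t" "g integrable_on {s..t}"
  shows "traj (traj X t g r) r g s = traj X t g s"
  using Henstock_Kurzweil_Integration.integral_combine[OF assms]
  by (simp add: traj_def algebra_simps)

lemma traj_diff:
  assumes "s \<le> r" "r \<le> t" "g integrable_on {s..t}"
  shows "traj X t g r - traj X t g s = integral {s..r} g"
  using traj_cut[OF assms, of X] by (simp add: traj_def algebra_simps)

lemma continuous_on_traj: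
  assumes "g integrable_on {a..t}"
  shows "continuous_on {a..t} (traj X t g)"
  unfolding traj_def by (intro continuous_intros indefinite_integral_continuous_1' assms)

lemma norm_traj_diff_le:
  assumes "g absolutely_integrable_on {s..t}" "s \<le> r" "r \<le> t"
  shows "norm (traj X t g r - traj X t g s) \<le> integral {s..r} (\<lambda>s. norm (g s))"
proof -
  have g: "g integrable_on {s..r}" "(\<lambda>s. norm (g s)) integrable_on {s..r}"
    using absolutely_integrable_on_subinterval[OF assms(1), of s r] assms
    by (auto simp: absolutely_integrable_on_def)
  have "traj X t g r - traj X t g s = integral {s..r} g"
    using assms by (intro traj_diff absolutely_integrable_imp_integrable)
  then show ?thesis
    using integral_norm_bound_integral[OF g] by simp
qed

context tonelli
begin

definition running_cost where
  "running_cost v X t g s = lagrangian h (to_torus (traj X t g s)) (g s) (v (to_torus (traj X t g s), s))"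

text \<open>Integrability of the cost is included, so that \<open>cost\<close> of an admissible
  control is never the default value of the integral of a nonintegrable function.\<close>

definition admissible where
  "admissible v X a t g \<longleftrightarrow> g absolutely_integrable_on {a..t} \<and> running_cost v X t g absolutely_integrable_on {a..t}"

definition cost where
  "cost v X a t g = integral {a..t} (running_cost v X t g)"

definition total_cost where
  "total_cost v \<phi> X t g = \<phi> (to_torus (traj X t g 0)) + cost v X 0 t g"

definition value_fn :: "('n torus \<times> real \<Rightarrow> real ^ 'm) \<Rightarrow> ('n torus \<Rightarrow> real) \<Rightarrow> real ^ 'n \<Rightarrow> real \<Rightarrow> real" where
  "value_fn v \<phi> X t = (INF g\<in>{g. admissible v X 0 t g}. total_cost v \<phi> X t g)"

lemma running_cost_cut:
  assumes "s \<le> r" "r \<le> t" "g integrable_on {s..t}"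
  shows "running_cost v (traj X t g r) r g s = running_cost v X t g s"
  by (simp add: running_cost_def traj_cut[OF assms])

lemma running_cost_cong:
  assumes "\<And>r. s \<le> r \<Longrightarrow> r \<le> t \<Longrightarrow> g r = g' r" "s \<le> t"
  shows "running_cost v X t g s = running_cost v X t g' s"
proof -
  have "integral {s..t} g = integral {s..t} g'" by (rule integral_cong) (use assms in auto)
  then show ?thesis using assms(1)[of s] assms(2) by (simp add: running_cost_def traj_def)
qed

lemma admissible_cut:
  assumes "admissible v X a t g" "a \<le> r" "r \<le> t"
  shows "admissible v (traj X t g r) a r g" "admissible v X r t g"
    "cost v X a t g = cost v (traj X t g r) a r g + cost v X r t g"
proof -
  have g: "g absolutely_integrable_on {a..t}" and c: "running_cost v X t g absolutely_integrable_on {a..t}"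
    using assms by (auto simp: admissible_def)
  have gi: "g integrable_on {s..t}" if "a \<le> s" for s
    using absolutely_integrable_on_subinterval[OF g, of s t] that by (auto intro: absolutely_integrable_imp_integrable)
  have eq: "running_cost v (traj X t g r) r g s = running_cost v X t g s" if "s \<in> {a..r}" for s
    using that assms by (intro running_cost_cut gi) auto
  have sub: "f absolutely_integrable_on {a..r}" "f absolutely_integrable_on {r..t}"
    if "f absolutely_integrable_on {a..t}" for f :: "real \<Rightarrow> 'c::euclidean_space"
    using absolutely_integrable_on_subinterval[OF that] assms by auto
  have "running_cost v (traj X t g r) r g absolutely_integrable_on {a..r}"
    by (rule absolutely_integrable_spike[OF sub(1)[OF c] negligible_empty]) (simp add: eq)
  then show "admissible v (traj X t g r) a r g" "admissible v X r t g"
    using sub[OF g] sub[OF c] by (auto simp: admissible_def)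
  have "integral {a..r} (running_cost v (traj X t g r) r g) = integral {a..r} (running_cost v X t g)"
    by (rule integral_cong) (simp add: eq)
  then show "cost v X a t g = cost v (traj X t g r) a r g + cost v X r t g"
    unfolding cost_def
    using Henstock_Kurzweil_Integration.integral_combine[OF assms(2,3) absolutely_integrable_imp_integrable[OF c]] by simp
qed

text \<open>The first control is anchored at the point where the second one starts, so gluing
  velocities glues trajectories; the value at the junction \<open>r\<close> matters only on a null
  set.\<close>

lemma admissible_concat:
  assumes 1: "admissible v (traj X t g2 r) a r g1" and 2: "admissible v X r t g2" and "a \<le> r" "r \<le> t"
  defines "g \<equiv> \<lambda>s. if s \<le> r then g1 s else g2 s"
  shows "admissible v X a t g" "cost v X a t g = cost v (traj X t g2 r) a r g1 + cost v X r t g2"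
    "traj X t g a = traj (traj X t g2 r) r g1 a"
proof -
  have g1: "g1 absolutely_integrable_on {a..r}" and c1: "running_cost v (traj X t g2 r) r g1 absolutely_integrable_on {a..r}"
    using 1 by (auto simp: admissible_def)
  have g2: "g2 absolutely_integrable_on {r..t}" and c2: "running_cost v X t g2 absolutely_integrable_on {r..t}"
    using 2 by (auto simp: admissible_def)
  have gl: "g absolutely_integrable_on {a..r}"
    by (rule absolutely_integrable_spike[OF g1 negligible_empty]) (simp add: g_def)
  have gr: "g absolutely_integrable_on {r..t}"
    by (rule absolutely_integrable_spike[OF g2 negligible_sing[of r]]) (auto simp: g_def)
  have g: "g absolutely_integrable_on {a..t}"
    by (rule absolutely_integrable_on_combine[OF gl gr assms(3,4)])
  have ig: "g integrable_on {s..t}" if "a \<le> s" for s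
    using absolutely_integrable_on_subinterval[OF g, of s t] that by (auto intro: absolutely_integrable_imp_integrable)
  have "integral {r..t} g = integral {r..t} g2"
    by (rule integral_spike[OF negligible_sing[of r]]) (auto simp: g_def)
  then have trr: "traj X t g r = traj X t g2 r" by (simp add: traj_def)
  have ceq1: "running_cost v X t g s = running_cost v (traj X t g2 r) r g1 s" if "s \<in> {a..r}" for s
  proof -
    have "running_cost v X t g s = running_cost v (traj X t g r) r g s"
      using that assms(4) by (intro running_cost_cut[symmetric] ig) auto
    also have "\<dots> = running_cost v (traj X t g2 r) r g1 s"
      unfolding trr by (rule running_cost_cong) (use that in \<open>auto simp: g_def\<close>)
    finally show ?thesis .
  qed
  have ceq2: "running_cost v X t g s = running_cost v X t g2 s" if "s \<in> {r..t} - {r}" for s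
    by (rule running_cost_cong) (use that in \<open>auto simp: g_def\<close>)
  have cl: "running_cost v X t g absolutely_integrable_on {a..r}"
    by (rule absolutely_integrable_spike[OF c1 negligible_empty]) (use ceq1 in auto)
  have cr: "running_cost v X t g absolutely_integrable_on {r..t}"
    by (rule absolutely_integrable_spike[OF c2 negligible_sing[of r]]) (use ceq2 in auto)
  have c: "running_cost v X t g absolutely_integrable_on {a..t}"
    by (rule absolutely_integrable_on_combine[OF cl cr assms(3,4)])
  show "admissible v X a t g" using g c by (simp add: admissible_def)
  have "integral {a..r} (running_cost v X t g) = cost v (traj X t g2 r) a r g1"
    unfolding cost_def by (rule integral_cong) (rule ceq1)
  moreover have "integral {r..t} (running_cost v X t g) = cost v X r t g2"
    unfolding cost_def by (rule integral_spike[OF negligible_sing[of r]]) (use ceq2 in auto)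
  ultimately show "cost v X a t g = cost v (traj X t g2 r) a r g1 + cost v X r t g2"
    using Henstock_Kurzweil_Integration.integral_combine[OF assms(3,4) absolutely_integrable_imp_integrable[OF c]]
    by (simp add: cost_def)
  have "traj X t g a = traj (traj X t g2 r) r g a"
    using traj_cut[OF assms(3,4) ig, of X] by (simp add: trr)
  also have "\<dots> = traj (traj X t g2 r) r g1 a"
    unfolding traj_def by (intro arg_cong2[where f = "(-)"] integral_cong refl) (simp add: g_def)
  finally show "traj X t g a = traj (traj X t g2 r) r g1 a" .
qed

end

section \<open>Cost estimates and dynamic programming\<close>

locale tonelli_value = tonelli h \<Theta>
  for h :: "('n::finite, 'm::finite) hamiltonian" and \<Theta> +
  fixes v :: "'n torus \<times> real \<Rightarrow> real ^ 'm" and \<phi> :: "'n torus \<Rightarrow> real"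
  assumes cont_v: "continuous_on UNIV v" and cont_\<phi>: "continuous_on UNIV \<phi>"
begin

lemma v_bounded: "\<exists>B\<ge>0. \<forall>x s. 0 \<le> s \<longrightarrow> s \<le> T \<longrightarrow> \<Theta> * infnorm (v (x, s)) \<le> B"
proof -
  have "compact ((UNIV :: 'n torus set) \<times> {0..T})" by (intro compact_Times compact_UNIV_torus) simp
  then have "bounded (v ` (UNIV \<times> {0..T}))"
    by (intro compact_imp_bounded compact_continuous_image continuous_on_subset[OF cont_v]) auto
  then obtain B where B: "\<And>z. z \<in> UNIV \<times> {0..T} \<Longrightarrow> norm (v z) \<le> B" unfolding bounded_iff by blast
  have "\<Theta> * infnorm (v (x, s)) \<le> \<Theta> * \<bar>B\<bar>" if "0 \<le> s" "s \<le> T" for x s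
  proof (intro mult_left_mono)
    have "infnorm (v (x, s)) \<le> norm (v (x, s))" by (rule infnorm_le_norm)
    also have "\<dots> \<le> \<bar>B\<bar>" using B[of "(x, s)"] that by simp
    finally show "infnorm (v (x, s)) \<le> \<bar>B\<bar>" .
  qed (use \<Theta>_pos in simp)
  moreover have "\<Theta> * \<bar>B\<bar> \<ge> 0" using \<Theta>_pos by simp
  ultimately show ?thesis by blast
qed

lemma \<phi>_bounded: "\<exists>B\<ge>0. \<forall>x. \<bar>\<phi> x\<bar> \<le> B"
proof -
  have "bounded (range \<phi>)"
    by (intro compact_imp_bounded compact_continuous_image cont_\<phi> compact_UNIV_torus)
  then obtain B where "\<And>x. norm (\<phi> x) \<le> B" unfolding bounded_iff by blast
  then show ?thesis by (intro exI[of _ "\<bar>B\<bar>"]) (auto intro: order_trans[OF _ abs_ge_self])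
qed

lemma running_cost_lower:
  assumes "0 \<le> K"
  shows "\<exists>C\<ge>0. \<forall>X t g s. 0 \<le> s \<longrightarrow> s \<le> T \<longrightarrow> K * norm (g s) - C \<le> running_cost v X t g s"
proof -
  obtain C where C: "\<And>x w u. K * norm w - C - \<Theta> * infnorm u \<le> lagrangian h x w u"
    using lagrangian_superlinear[OF assms] by blast
  obtain B where B: "B \<ge> 0" "\<And>x s. 0 \<le> s \<Longrightarrow> s \<le> T \<Longrightarrow> \<Theta> * infnorm (v (x, s)) \<le> B"
    using v_bounded by blast
  have "K * norm (g s) - (\<bar>C\<bar> + B) \<le> running_cost v X t g s" if "0 \<le> s" "s \<le> T" for X t g s
    using C[of "g s" "v (to_torus (traj X t g s), s)" "to_torus (traj X t g s)"]
      B(2)[OF that, of "to_torus (traj X t g s)"] unfolding running_cost_def by linarith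
  then show ?thesis using B(1) by (intro exI[of _ "\<bar>C\<bar> + B"]) auto
qed

lemma running_cost_upper:
  assumes "0 \<le> K"
  shows "\<exists>C\<ge>0. \<forall>X t g s. 0 \<le> s \<longrightarrow> s \<le> T \<longrightarrow> norm (g s) \<le> K \<longrightarrow> running_cost v X t g s \<le> C"
proof -
  obtain C where C: "\<And>x w u. norm w \<le> K \<Longrightarrow> lagrangian h x w u \<le> C + \<Theta> * infnorm u"
    using lagrangian_upper[OF assms] by blast
  obtain B where B: "B \<ge> 0" "\<And>x s. 0 \<le> s \<Longrightarrow> s \<le> T \<Longrightarrow> \<Theta> * infnorm (v (x, s)) \<le> B"
    using v_bounded by blast
  have "running_cost v X t g s \<le> \<bar>C\<bar> + B" if "0 \<le> s" "s \<le> T" "norm (g s) \<le> K" for X t g s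
    using C[OF that(3), of "to_torus (traj X t g s)" "v (to_torus (traj X t g s), s)"]
      B(2)[OF that(1,2), of "to_torus (traj X t g s)"] unfolding running_cost_def by linarith
  then show ?thesis using B(1) by (intro exI[of _ "\<bar>C\<bar> + B"]) auto
qed

text \<open>The velocity is merely Lebesgue measurable, so the outer function of the composition,
  the Lagrangian, has to be Borel measurable.\<close>

lemma measurable_running_cost:
  assumes "g absolutely_integrable_on {a..t}"
  shows "running_cost v X t g \<in> borel_measurable (lebesgue_on {a..t})"
proof -
  have g: "g \<in> borel_measurable (lebesgue_on {a..t})"
    by (rule absolutely_integrable_imp_borel_measurable[OF assms]) simp
  have ct: "continuous_on {a..t} (traj X t g)"
    by (intro continuous_on_traj absolutely_integrable_imp_integrable assms)
  have "continuous_on {a..t} (\<lambda>s. v (to_torus (traj X t g s), s))"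
    by (intro continuous_on_compose2[OF cont_v] continuous_intros ct) auto
  then have m: "(\<lambda>s. v (to_torus (traj X t g s), s)) \<in> borel_measurable (lebesgue_on {a..t})"
    "traj X t g \<in> borel_measurable (lebesgue_on {a..t})"
    using ct by (auto intro: continuous_imp_measurable_on_sets_lebesgue)
  have "(\<lambda>s. (traj X t g s, g s, v (to_torus (traj X t g s), s))) \<in> borel_measurable (lebesgue_on {a..t})"
    by (intro borel_measurable_Pair m g)
  from measurable_compose[OF this borel_measurable_lagrangian]
  show ?thesis by (simp add: running_cost_def[abs_def])
qed

lemma admissibleI_bounded:
  assumes g: "g absolutely_integrable_on {a..t}" and f: "f integrable_on {a..t}"
    and le: "\<And>s. s \<in> {a..t} \<Longrightarrow> \<bar>running_cost v X t g s\<bar> \<le> f s"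
  shows "admissible v X a t g"
proof -
  have "running_cost v X t g absolutely_integrable_on {a..t}"
    by (rule measurable_bounded_by_integrable_imp_absolutely_integrable[OF measurable_running_cost[OF g] _ f])
      (use le in auto)
  then show ?thesis using g by (simp add: admissible_def)
qed

lemma admissible_const:
  assumes "0 \<le> a"
  shows "admissible v X a t (\<lambda>_. w)"
proof -
  obtain C where C: "C \<ge> 0" "\<And>X r g s. 0 \<le> s \<Longrightarrow> s \<le> t \<Longrightarrow> 0 * norm (g s) - C \<le> running_cost v X r g s"
    using running_cost_lower[of 0 t, OF order_refl] by blast
  obtain D where D: "D \<ge> 0" "\<And>X r g s. 0 \<le> s \<Longrightarrow> s \<le> t \<Longrightarrow> norm (g s) \<le> norm w \<Longrightarrow> running_cost v X r g s \<le> D"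
    using running_cost_upper[of "norm w" t, OF norm_ge_zero] by blast
  show ?thesis
  proof (rule admissibleI_bounded)
    show "(\<lambda>_. w) absolutely_integrable_on {a..t}"
      unfolding absolutely_integrable_on_def by (intro conjI integrable_const_ivl)
    show "(\<lambda>_. C + D) integrable_on {a..t}" by (rule integrable_const_ivl)
    fix s assume "s \<in> {a..t}"
    then have s: "0 \<le> s" "s \<le> t" using assms by auto
    show "\<bar>running_cost v X t (\<lambda>_. w) s\<bar> \<le> C + D"
      using C(2)[OF s, of "\<lambda>_. w" X t] D(2)[OF s, of "\<lambda>_. w" X t] C(1) D(1) by (simp add: abs_le_iff)
  qed
qed

text \<open>Superlinearity in integrated form: at the price of a constant per unit time, the cost
  controls the length of the curve with any prescribed factor \<open>K\<close>. Suitable choices of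
  \<open>K\<close> keep near optimal curves short.\<close>

lemma cost_lower:
  assumes "0 \<le> K"
  shows "\<exists>C\<ge>0. \<forall>X a t g. 0 \<le> a \<longrightarrow> a \<le> t \<longrightarrow> t \<le> T \<longrightarrow> admissible v X a t g \<longrightarrow>
    K * integral {a..t} (\<lambda>s. norm (g s)) - C * (t - a) \<le> cost v X a t g"
proof -
  obtain C where C: "C \<ge> 0" "\<And>X t g s. 0 \<le> s \<Longrightarrow> s \<le> T \<Longrightarrow> K * norm (g s) - C \<le> running_cost v X t g s"
    using running_cost_lower[OF assms, of T] by blast
  have "K * integral {a..t} (\<lambda>s. norm (g s)) - C * (t - a) \<le> cost v X a t g"
    if "0 \<le> a" "a \<le> t" "t \<le> T" "admissible v X a t g" for X a t g
  proof -
    have ng: "(\<lambda>s. norm (g s)) integrable_on {a..t}" and rc: "running_cost v X t g integrable_on {a..t}"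
      using that(4) unfolding admissible_def absolutely_integrable_on_def by auto
    have Kng: "(\<lambda>s. K * norm (g s)) integrable_on {a..t}"
      using ng by (intro integrable_on_mult_right)
    have "integral {a..t} (\<lambda>s. K * norm (g s) - C) \<le> cost v X a t g"
      unfolding cost_def
      by (intro integral_le integrable_diff Kng rc integrable_const_ivl) (use C(2) that in auto)
    moreover have "integral {a..t} (\<lambda>s. K * norm (g s) - C)
        = integral {a..t} (\<lambda>s. K * norm (g s)) - integral {a..t} (\<lambda>_. C)"
      by (intro integral_diff Kng integrable_const_ivl)
    ultimately show ?thesis using that(2) by (simp add: mult.commute[of C])
  qed
  then show ?thesis using C(1) by blast
qed

lemma cost_const_upper:
  assumes "0 \<le> K"
  shows "\<exists>C\<ge>0. \<forall>X a t w. 0 \<le> a \<longrightarrow> a \<le> t \<longrightarrow> t \<le> T \<longrightarrow> norm w \<le> K \<longrightarrow> cost v X a t (\<lambda>_. w) \<le> C * (t - a)"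
proof -
  obtain C where C: "C \<ge> 0" "\<And>X t g s. 0 \<le> s \<Longrightarrow> s \<le> T \<Longrightarrow> norm (g s) \<le> K \<Longrightarrow> running_cost v X t g s \<le> C"
    using running_cost_upper[OF assms, of T] by blast
  have "cost v X a t (\<lambda>_. w) \<le> C * (t - a)" if "0 \<le> a" "a \<le> t" "t \<le> T" "norm w \<le> K" for X a t w
  proof -
    have rc: "running_cost v X t (\<lambda>_. w) integrable_on {a..t}"
      using admissible_const[OF that(1), of X t w] unfolding admissible_def absolutely_integrable_on_def by auto
    have "cost v X a t (\<lambda>_. w) \<le> integral {a..t} (\<lambda>_. C)"
      unfolding cost_def by (intro integral_le rc integrable_const_ivl) (use C(2)[of _ "\<lambda>_. w"] that in auto)
    then show ?thesis using that(2) by (simp add: mult.commute)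
  qed
  then show ?thesis using C(1) by blast
qed

lemma bdd_below_total_cost:
  assumes "0 \<le> t"
  shows "bdd_below (total_cost v \<phi> X t ` {g. admissible v X 0 t g})"
proof -
  obtain B where B: "\<And>x. \<bar>\<phi> x\<bar> \<le> B" using \<phi>_bounded by blast
  obtain C where C: "\<And>X a t' g. 0 \<le> a \<Longrightarrow> a \<le> t' \<Longrightarrow> t' \<le> t \<Longrightarrow> admissible v X a t' g \<Longrightarrow>
      0 * integral {a..t'} (\<lambda>s. norm (g s)) - C * (t' - a) \<le> cost v X a t' g"
    using cost_lower[of 0 t, OF order_refl] by blast
  have "- B - C * t \<le> total_cost v \<phi> X t g" if "admissible v X 0 t g" for g
    using C[OF order_refl assms order_refl that] B[of "to_torus (traj X t g 0)"] by (simp add: total_cost_def abs_le_iff)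
  then show ?thesis by (auto simp: bdd_below_def)
qed

lemma value_fn_le:
  assumes "0 \<le> t" "admissible v X 0 t g"
  shows "value_fn v \<phi> X t \<le> total_cost v \<phi> X t g"
  unfolding value_fn_def by (rule cINF_lower[OF bdd_below_total_cost]) (use assms in auto)

lemma value_fn_near:
  assumes "0 < e"
  obtains g where "admissible v X 0 t g" "total_cost v \<phi> X t g < value_fn v \<phi> X t + e"
proof -
  have "\<exists>y\<in>total_cost v \<phi> X t ` {g. admissible v X 0 t g}. y < value_fn v \<phi> X t + e"
    using assms admissible_const[of 0 X t 0] unfolding value_fn_def
    by (intro cInf_lessD) auto
  then show ?thesis using that by blast
qed

lemma value_fn_greatest:
  assumes "\<And>g. admissible v X 0 t g \<Longrightarrow> m \<le> total_cost v \<phi> X t g"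
  shows "m \<le> value_fn v \<phi> X t"
  unfolding value_fn_def by (rule cINF_greatest) (use assms admissible_const[of 0 X t 0] in auto)

lemma value_fn_0: "value_fn v \<phi> X 0 = \<phi> (to_torus X)"
proof -
  have "total_cost v \<phi> X 0 g = \<phi> (to_torus X)" for g
    by (simp add: total_cost_def cost_def)
  moreover have "{g. admissible v X 0 0 g} \<noteq> {}" using admissible_const[of 0 X 0 0] by blast
  ultimately show ?thesis by (simp add: value_fn_def)
qed

text \<open>Trajectories of one control ending at two representatives differ by a constant lattice
  vector, so their projections to the torus agree.\<close>

lemma value_fn_cong:
  assumes "to_torus X = to_torus Y"
  shows "value_fn v \<phi> X t = value_fn v \<phi> Y t"
proof -
  have tr: "to_torus (traj X t g s) = to_torus (traj Y t g s)" for g s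
    using assms unfolding to_torus_eq_iff by (simp add: traj_def)
  have rc: "running_cost v X t g = running_cost v Y t g" for g
    by (rule ext) (simp add: running_cost_def tr)
  show ?thesis
    unfolding value_fn_def admissible_def total_cost_def cost_def rc tr ..
qed

lemma dynamic_programming_upper:
  assumes "0 \<le> r" "r \<le> t" "admissible v X r t g"
  shows "value_fn v \<phi> X t \<le> value_fn v \<phi> (traj X t g r) r + cost v X r t g"
proof -
  have "value_fn v \<phi> X t - cost v X r t g \<le> value_fn v \<phi> (traj X t g r) r"
  proof (rule value_fn_greatest)
    fix g' assume g': "admissible v (traj X t g r) 0 r g'"
    note c = admissible_concat[OF g' assms(3,1,2)]
    show "value_fn v \<phi> X t - cost v X r t g \<le> total_cost v \<phi> (traj X t g r) r g'"
      using value_fn_le[OF _ c(1)] assms c(2,3) by (simp add: total_cost_def)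
  qed
  then show ?thesis by simp
qed

text \<open>A control that is optimal up to \<open>e\<close> is cut at time \<open>r\<close>; its
  initial part competes for the value at time \<open>r\<close>.\<close>

lemma dynamic_programming_lower:
  assumes "0 < e" "0 \<le> r" "r \<le> t"
  obtains g where "admissible v X r t g"
    "value_fn v \<phi> (traj X t g r) r + cost v X r t g \<le> value_fn v \<phi> X t + e"
proof -
  obtain g where g: "admissible v X 0 t g" "total_cost v \<phi> X t g < value_fn v \<phi> X t + e"
    using value_fn_near[OF assms(1)] .
  have g': "g integrable_on {0..t}" using g(1) by (auto simp: admissible_def absolutely_integrable_imp_integrable)
  note c = admissible_cut[OF g(1) assms(2,3)]
  have "value_fn v \<phi> (traj X t g r) r \<le> total_cost v \<phi> (traj X t g r) r g"
    by (rule value_fn_le[OF assms(2) c(1)])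
  moreover have "total_cost v \<phi> (traj X t g r) r g + cost v X r t g = total_cost v \<phi> X t g"
    using c(3) traj_cut[OF assms(2,3) g', of X] by (simp add: total_cost_def)
  ultimately have "value_fn v \<phi> (traj X t g r) r + cost v X r t g \<le> value_fn v \<phi> X t + e"
    using g(2) by linarith
  with c(2) show ?thesis by (rule that)
qed

end

text \<open>Integrating an exponential of rate \<kappa> gains the factor 1 / \<kappa>, which is what
  makes the value operator contractive in the weighted norm.\<close>

lemma integral_exp_le:
  fixes \<kappa> :: real
  assumes "0 < \<kappa>" "0 \<le> t" "0 \<le> D"
  shows "(\<lambda>s. D * exp (\<kappa> * s)) integrable_on {0..t}"
    "integral {0..t} (\<lambda>s. D * exp (\<kappa> * s)) \<le> D / \<kappa> * exp (\<kappa> * t)"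
proof -
  have "((\<lambda>s. D * exp (\<kappa> * s)) has_integral D / \<kappa> * exp (\<kappa> * t) - D / \<kappa> * exp (\<kappa> * 0)) {0..t}"
  proof (rule fundamental_theorem_of_calculus[OF assms(2)])
    show "((\<lambda>s. D / \<kappa> * exp (\<kappa> * s)) has_vector_derivative D * exp (\<kappa> * s)) (at s within {0..t})" for s
      unfolding has_real_derivative_iff_has_vector_derivative[symmetric]
      using assms(1) by (auto intro!: derivative_eq_intros)
  qed
  then show "(\<lambda>s. D * exp (\<kappa> * s)) integrable_on {0..t}"
    "integral {0..t} (\<lambda>s. D * exp (\<kappa> * s)) \<le> D / \<kappa> * exp (\<kappa> * t)"
    using assms by (auto simp: has_integral_iff)
qed

section \<open>Growth and continuity of the value function\<close>

context tonelli_value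
begin

lemma value_fn_bounded: "\<exists>B\<ge>0. \<forall>X t. 0 \<le> t \<longrightarrow> t \<le> T \<longrightarrow> \<bar>value_fn v \<phi> X t\<bar> \<le> B"
proof -
  obtain B where B: "B \<ge> 0" "\<And>x. \<bar>\<phi> x\<bar> \<le> B" using \<phi>_bounded by blast
  obtain C where C: "C \<ge> 0" "\<And>X a t g. 0 \<le> a \<Longrightarrow> a \<le> t \<Longrightarrow> t \<le> T \<Longrightarrow> admissible v X a t g \<Longrightarrow>
      0 * integral {a..t} (\<lambda>s. norm (g s)) - C * (t - a) \<le> cost v X a t g"
    using cost_lower[of 0 T, OF order_refl] by blast
  obtain D where D: "D \<ge> 0" "\<And>X a t w. 0 \<le> a \<Longrightarrow> a \<le> t \<Longrightarrow> t \<le> T \<Longrightarrow> norm w \<le> 0 \<Longrightarrow>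
      cost v X a t (\<lambda>_. w) \<le> D * (t - a)"
    using cost_const_upper[of 0 T, OF order_refl] by blast
  have "\<bar>value_fn v \<phi> X t\<bar> \<le> B + (C + D) * T" if t: "0 \<le> t" "t \<le> T" for X t
  proof -
    have CT: "C * t \<le> C * T" "D * t \<le> D * T" "0 \<le> C * T" "0 \<le> D * T"
      using C(1) D(1) t by (auto intro!: mult_left_mono)
    have "- (B + C * T) \<le> value_fn v \<phi> X t"
    proof (rule value_fn_greatest)
      fix g assume "admissible v X 0 t g"
      from C(2)[OF order_refl t this] show "- (B + C * T) \<le> total_cost v \<phi> X t g"
        using B(2)[of "to_torus (traj X t g 0)"] CT by (simp add: total_cost_def abs_le_iff)
    qed
    moreover have "value_fn v \<phi> X t \<le> B + D * T"
    proof -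
      have "value_fn v \<phi> X t \<le> total_cost v \<phi> X t (\<lambda>_. 0)"
        by (intro value_fn_le t admissible_const) simp
      also have "\<dots> \<le> B + D * T"
        using B(2)[of "to_torus (traj X t (\<lambda>_. 0) 0)"] D(2)[OF order_refl t, of 0 X] CT
        by (simp add: total_cost_def abs_le_iff)
      finally show ?thesis .
    qed
    moreover have "(C + D) * T = C * T + D * T" by (rule distrib_right)
    ultimately show ?thesis unfolding abs_le_iff using CT by linarith
  qed
  moreover have "0 \<le> B + (C + D) * \<bar>T\<bar>" using B(1) C(1) D(1) by simp
  ultimately show ?thesis by (intro exI[of _ "B + (C + D) * \<bar>T\<bar>"]) force
qed

text \<open>Makes the value operator map the weighted space to itself: the bounds on the running
  cost grow like the weight, and integration in time preserves the rate. The upper bound comes from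
  the curve at rest.\<close>

lemma value_fn_exp_bounded:
  assumes "0 < \<kappa>" "0 \<le> W"
    and W: "\<And>x s. 0 \<le> s \<Longrightarrow> \<Theta> * infnorm (v (x, s)) \<le> W * exp (\<kappa> * s)"
  shows "\<exists>D. \<forall>X t. 0 \<le> t \<longrightarrow> \<bar>value_fn v \<phi> X t\<bar> \<le> D * exp (\<kappa> * t)"
proof -
  obtain B where B: "B \<ge> 0" "\<And>x. \<bar>\<phi> x\<bar> \<le> B" using \<phi>_bounded by blast
  obtain C1 where C1: "\<And>x w u. 0 * norm w - C1 - \<Theta> * infnorm u \<le> lagrangian h x w u"
    using lagrangian_superlinear[OF order_refl] by blast
  obtain C2 where C2: "\<And>x w u. norm w \<le> 0 \<Longrightarrow> lagrangian h x w u \<le> C2 + \<Theta> * infnorm u"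
    using lagrangian_upper[OF order_refl] by blast
  define C where "C = \<bar>C1\<bar> + \<bar>C2\<bar> + W"
  have "C \<ge> 0" using assms by (simp add: C_def)
  have grow: "\<bar>C1\<bar> + \<bar>C2\<bar> + W * exp (\<kappa> * s) \<le> C * exp (\<kappa> * s)" if "0 \<le> s" for s
  proof -
    have "1 \<le> exp (\<kappa> * s)" using assms that by simp
    then have "(\<bar>C1\<bar> + \<bar>C2\<bar>) * 1 \<le> (\<bar>C1\<bar> + \<bar>C2\<bar>) * exp (\<kappa> * s)" by (intro mult_left_mono) auto
    then show ?thesis by (simp add: C_def algebra_simps)
  qed
  have lower: "- (C * exp (\<kappa> * s)) \<le> running_cost v X t g s" if "0 \<le> s" for X t g s
    using C1[of "g s" "v (to_torus (traj X t g s), s)" "to_torus (traj X t g s)"]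
      W[OF that, of "to_torus (traj X t g s)"] grow[OF that] unfolding running_cost_def by linarith
  have upper: "running_cost v X t (\<lambda>_. 0) s \<le> C * exp (\<kappa> * s)" if "0 \<le> s" for X t s
    using C2[of 0 "to_torus (traj X t (\<lambda>_. 0) s)" "v (to_torus (traj X t (\<lambda>_. 0) s), s)"]
      W[OF that, of "to_torus (traj X t (\<lambda>_. 0) s)"] grow[OF that] unfolding running_cost_def by simp
  have "\<bar>value_fn v \<phi> X t\<bar> \<le> (B + C / \<kappa>) * exp (\<kappa> * t)" if t: "0 \<le> t" for X t
  proof -
    note I = integral_exp_le[OF assms(1) t \<open>0 \<le> C\<close>]
    have "1 \<le> exp (\<kappa> * t)" using assms t by simp
    then have "B * 1 \<le> B * exp (\<kappa> * t)" using B(1) by (intro mult_left_mono) auto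
    then have Bt: "B + C / \<kappa> * exp (\<kappa> * t) \<le> (B + C / \<kappa>) * exp (\<kappa> * t)" by (simp add: distrib_right)
    have "- (B + C / \<kappa> * exp (\<kappa> * t)) \<le> value_fn v \<phi> X t"
    proof (rule value_fn_greatest)
      fix g assume "admissible v X 0 t g"
      then have "running_cost v X t g integrable_on {0..t}"
        by (simp add: admissible_def absolutely_integrable_imp_integrable)
      then have "integral {0..t} (\<lambda>s. - (C * exp (\<kappa> * s))) \<le> cost v X 0 t g"
        unfolding cost_def by (intro integral_le integrable_neg I(1)) (use lower in auto)
      then show "- (B + C / \<kappa> * exp (\<kappa> * t)) \<le> total_cost v \<phi> X t g"
        using I(2) B(2)[of "to_torus (traj X t g 0)"] by (simp add: total_cost_def abs_le_iff)
    qed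
    moreover have "value_fn v \<phi> X t \<le> B + C / \<kappa> * exp (\<kappa> * t)"
    proof -
      have adm: "admissible v X 0 t (\<lambda>_. 0)" by (rule admissible_const) simp
      then have "running_cost v X t (\<lambda>_. 0) integrable_on {0..t}"
        by (simp add: admissible_def absolutely_integrable_imp_integrable)
      then have "cost v X 0 t (\<lambda>_. 0) \<le> integral {0..t} (\<lambda>s. C * exp (\<kappa> * s))"
        unfolding cost_def by (intro integral_le I(1)) (use upper in auto)
      then show ?thesis
        using value_fn_le[OF t adm] I(2) B(2)[of "to_torus (traj X t (\<lambda>_. 0) 0)"]
        by (simp add: total_cost_def abs_le_iff)
    qed
    ultimately show ?thesis using Bt unfolding abs_le_iff by linarith
  qed
  then show ?thesis by blast
qed

text \<open>Both costs are evaluated on the same control. Its two running costs differ by an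
  integrable amount whatever the velocity, so admissibility passes from \<open>w\<close> to
  \<open>v\<close>.\<close>

lemma value_fn_diff_le:
  assumes w: "tonelli_value h \<Theta> w \<phi>" and "0 < \<kappa>" "0 \<le> D" "0 \<le> t"
    and D: "\<And>x s. 0 \<le> s \<Longrightarrow> \<Theta> * infnorm (v (x, s) - w (x, s)) \<le> D * exp (\<kappa> * s)"
  shows "value_fn v \<phi> X t \<le> value_fn w \<phi> X t + D / \<kappa> * exp (\<kappa> * t)"
proof -
  interpret w: tonelli_value h \<Theta> w \<phi> by (rule w)
  note I = integral_exp_le[OF assms(2,4,3)]
  have diff: "\<bar>running_cost v X t g s - running_cost w X t g s\<bar> \<le> D * exp (\<kappa> * s)" if "0 \<le> s" for g s
    using lagrangian_lip D[OF that] unfolding running_cost_def by (rule order_trans)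
  have "value_fn v \<phi> X t - D / \<kappa> * exp (\<kappa> * t) \<le> value_fn w \<phi> X t"
  proof (rule w.value_fn_greatest)
    fix g assume g: "admissible w X 0 t g"
    then have gi: "g absolutely_integrable_on {0..t}" and wi: "running_cost w X t g integrable_on {0..t}"
      and wa: "(\<lambda>s. \<bar>running_cost w X t g s\<bar>) integrable_on {0..t}"
      unfolding admissible_def absolutely_integrable_on_def by auto
    have adm: "admissible v X 0 t g"
    proof (rule admissibleI_bounded[OF gi integrable_add[OF wa I(1)]])
      show "\<bar>running_cost v X t g s\<bar> \<le> \<bar>running_cost w X t g s\<bar> + D * exp (\<kappa> * s)" if "s \<in> {0..t}" for s
        using diff[of s g] that by auto
    qed
    then have vi: "running_cost v X t g integrable_on {0..t}"
      by (simp add: admissible_def absolutely_integrable_imp_integrable)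
    have "cost v X 0 t g \<le> integral {0..t} (\<lambda>s. running_cost w X t g s + D * exp (\<kappa> * s))"
      unfolding cost_def
    proof (rule integral_le[OF vi integrable_add[OF wi I(1)]])
      show "running_cost v X t g s \<le> running_cost w X t g s + D * exp (\<kappa> * s)" if "s \<in> {0..t}" for s
        using diff[of s g] that by auto
    qed
    also have "\<dots> = cost w X 0 t g + integral {0..t} (\<lambda>s. D * exp (\<kappa> * s))"
      unfolding cost_def by (rule integral_add[OF wi I(1)])
    finally show "value_fn v \<phi> X t - D / \<kappa> * exp (\<kappa> * t) \<le> total_cost w \<phi> X t g"
      using value_fn_le[OF assms(4) adm] I(2) by (simp add: total_cost_def)
  qed
  then show ?thesis by simp
qed

text \<open>A straight line of speed at most 1 leads from \<open>X\<close> to \<open>Y\<close> in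
  time \<open>a\<close>; hence the condition that \<open>a\<close> is at least the distance.\<close>

lemma value_fn_forward:
  "\<exists>C\<ge>0. \<forall>X Y t a. 0 \<le> t \<longrightarrow> 0 < a \<longrightarrow> t + a \<le> T \<longrightarrow> norm (Y - X) \<le> a \<longrightarrow>
    value_fn v \<phi> Y (t + a) \<le> value_fn v \<phi> X t + C * a"
proof -
  obtain C where C: "C \<ge> 0" "\<And>X a t w. 0 \<le> a \<Longrightarrow> a \<le> t \<Longrightarrow> t \<le> T \<Longrightarrow> norm w \<le> 1 \<Longrightarrow>
      cost v X a t (\<lambda>_. w) \<le> C * (t - a)"
    using cost_const_upper[of 1 T, OF zero_le_one] by blast
  have "value_fn v \<phi> Y (t + a) \<le> value_fn v \<phi> X t + C * a"
    if "0 \<le> t" "0 < a" "t + a \<le> T" "norm (Y - X) \<le> a" for X Y t a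
  proof -
    define w where "w = (Y - X) /\<^sub>R a"
    have "norm w = norm (Y - X) / a"
      unfolding w_def norm_scaleR using that(2) by (simp add: divide_inverse mult.commute)
    then have "norm w \<le> 1" using that by simp
    have "traj Y (t + a) (\<lambda>_. w) t = X" using that by (simp add: traj_def w_def)
    then have "value_fn v \<phi> Y (t + a) \<le> value_fn v \<phi> X t + cost v Y t (t + a) (\<lambda>_. w)"
      using dynamic_programming_upper[of t "t + a" Y "\<lambda>_. w"] admissible_const[of t] that by simp
    also have "cost v Y t (t + a) (\<lambda>_. w) \<le> C * a"
      using C(2)[of t "t + a" w Y] that \<open>norm w \<le> 1\<close> by simp
    finally show ?thesis by simp
  qed
  then show ?thesis using C(1) by blast
qed

text \<open>A near optimal curve on \<open>[0, t + a]\<close> is shifted back in time by \<open>a\<close>. Translating it in space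
  instead would fail, as the Lagrangian at large velocities is not controlled by its values at
  nearby points; its dependence on time goes through \<open>v\<close> only and is uniform in the velocity.\<close>

lemma value_fn_backward:
  assumes "0 < e" "0 \<le> T"
  shows "\<exists>d>0. \<forall>X t a. 0 \<le> t \<longrightarrow> 0 \<le> a \<longrightarrow> a < d \<longrightarrow> t + a \<le> T \<longrightarrow>
    value_fn v \<phi> X t \<le> value_fn v \<phi> X (t + a) + 3 * e"
proof -
  obtain B where B: "B \<ge> 0" "\<And>x. \<bar>\<phi> x\<bar> \<le> B" using \<phi>_bounded by blast
  obtain d0 where "d0 > 0" and d0: "\<And>x y. dist x y < d0 \<Longrightarrow> dist (\<phi> x) (\<phi> y) < e"
    using compact_uniformly_continuous[OF cont_\<phi> compact_UNIV_torus] \<open>0 < e\<close>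
    unfolding uniformly_continuous_on_def by (metis UNIV_I dist_commute)
  \<comment> \<open>With this slope, \<open>K\<close> times the distance reaches
    \<open>2 * B\<close>, which bounds the oscillation of \<phi>, as soon as the distance is
    \<open>d0\<close>.\<close>
  define K where "K = 2 * B / d0"
  have "K \<ge> 0" using B \<open>d0 > 0\<close> by (simp add: K_def)
  have \<phi>_le: "\<phi> (to_torus Y) \<le> \<phi> (to_torus Z) + e + K * norm (Y - Z)" for Y Z
  proof (cases "norm (Y - Z) < d0")
    case True
    then have "dist (to_torus Y) (to_torus Z) < d0"
      using dist_to_torus_le[of Y Z] by (simp add: dist_norm)
    then have "\<phi> (to_torus Y) \<le> \<phi> (to_torus Z) + e" using d0 by (force simp: dist_real_def)
    moreover have "0 \<le> K * norm (Y - Z)" using \<open>K \<ge> 0\<close> by simp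
    ultimately show ?thesis by linarith
  next
    case False
    then have "K * d0 \<le> K * norm (Y - Z)" using \<open>K \<ge> 0\<close> by (intro mult_left_mono) auto
    moreover have "K * d0 = 2 * B" using \<open>d0 > 0\<close> by (simp add: K_def)
    ultimately show ?thesis
      using B(2)[of "to_torus Y"] B(2)[of "to_torus Z"] \<open>0 < e\<close> unfolding abs_le_iff by linarith
  qed
  have "compact ((UNIV :: 'n torus set) \<times> {0..T})" by (intro compact_Times compact_UNIV_torus) simp
  then have uc: "uniformly_continuous_on (UNIV \<times> {0..T}) v"
    by (intro compact_uniformly_continuous continuous_on_subset[OF cont_v]) auto
  \<comment> \<open>An error \<open>e'\<close> per unit time adds up to at most \<open>e\<close>
    over [0, T].\<close>
  define e' where "e' = e / (T + 1)"
  have "e' > 0" using assms by (simp add: e'_def)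
  then have "e' / \<Theta> > 0" using \<Theta>_pos by simp
  then obtain d1 where "d1 > 0" and d1: "\<And>z z'. z \<in> UNIV \<times> {0..T} \<Longrightarrow> z' \<in> UNIV \<times> {0..T} \<Longrightarrow> dist z' z < d1 \<Longrightarrow>
      dist (v z') (v z) < e' / \<Theta>"
    using uc unfolding uniformly_continuous_on_def by meson
  have v_shift: "\<Theta> * infnorm (v (x, s) - v (x, r)) \<le> e'"
    if "s \<in> {0..T}" "r \<in> {0..T}" "\<bar>s - r\<bar> < d1" for x s r
  proof -
    have "infnorm (v (x, s) - v (x, r)) \<le> e' / \<Theta>"
      using infnorm_le_norm[of "v (x, s) - v (x, r)"] d1[of "(x, r)" "(x, s)"] that
      by (simp add: dist_Pair_Pair dist_norm)
    then show ?thesis using \<Theta>_pos by (simp add: field_simps)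
  qed
  obtain C where C: "C \<ge> 0" "\<And>X a t g. 0 \<le> a \<Longrightarrow> a \<le> t \<Longrightarrow> t \<le> T \<Longrightarrow> admissible v X a t g \<Longrightarrow>
      K * integral {a..t} (\<lambda>s. norm (g s)) - C * (t - a) \<le> cost v X a t g"
    using cost_lower[OF \<open>K \<ge> 0\<close>, of T] by blast
  define d where "d = min d1 (e / (C + 1))"
  have "d > 0" using \<open>d1 > 0\<close> \<open>0 < e\<close> C(1) by (simp add: d_def)
  have "value_fn v \<phi> X t \<le> value_fn v \<phi> X (t + a) + 3 * e"
    if ta: "0 \<le> t" "0 \<le> a" "a < d" "t + a \<le> T" for X t a
  proof -
    have Ca: "C * a \<le> e"
    proof -
      have "(C + 1) * a \<le> e" using ta(3) C(1) by (simp add: d_def field_simps)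
      then show ?thesis using ta(2) by (simp add: algebra_simps)
    qed
    have "value_fn v \<phi> X t - 3 * e \<le> value_fn v \<phi> X (t + a)"
    proof (rule value_fn_greatest)
      fix g assume g: "admissible v X 0 (t + a) g"
      have a: "0 \<le> a" "a \<le> t + a" using ta by auto
      note cut = admissible_cut[OF g a]
      have g0: "g absolutely_integrable_on {0..t + a}" using g by (simp add: admissible_def)
      have ga: "g absolutely_integrable_on {a..t + a}"
        and rca: "running_cost v X (t + a) g absolutely_integrable_on {a..t + a}"
        using cut(2) by (auto simp: admissible_def)
      \<comment> \<open>The shift drops the part of the curve over [0, a]. The initial point moves
        by at most the length of this part, and the cost of the part itself pays for that with slope
        \<open>K\<close>.\<close>
      define g' where "g' s = g (s + a)" for s
      have shift: "(\<lambda>s. f (s + a)) integrable_on {0..t}" "integral {0..t} (\<lambda>s. f (s + a)) = integral {a..t + a} f"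
        if "f integrable_on {a..t + a}" for f :: "real \<Rightarrow> 'c::euclidean_space"
        using integrable_shift_real_ivl[OF that, of a] integral_shift_real_ivl[of a a "t + a" f] by simp_all
      have g': "g' absolutely_integrable_on {0..t}"
        using shift(1)[of g] shift(1)[of "\<lambda>s. norm (g s)"] ga
        unfolding g'_def absolutely_integrable_on_def by auto
      have tr: "traj X t g' s = traj X (t + a) g (s + a)" for s
        using integral_shift_real_ivl[of "s + a" a "t + a" g] by (simp add: traj_def g'_def[abs_def])
      have diff: "\<bar>running_cost v X t g' s - running_cost v X (t + a) g (s + a)\<bar> \<le> e'" if "s \<in> {0..t}" for s
      proof -
        have "\<bar>running_cost v X t g' s - running_cost v X (t + a) g (s + a)\<bar>
            \<le> \<Theta> * infnorm (v (to_torus (traj X t g' s), s) - v (to_torus (traj X t g' s), s + a))"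
          unfolding running_cost_def tr g'_def by (rule lagrangian_lip)
        also have "\<dots> \<le> e'" using that ta by (intro v_shift) (auto simp: d_def)
        finally show ?thesis .
      qed
      have rci: "(\<lambda>s. running_cost v X (t + a) g (s + a)) integrable_on {0..t}"
          "(\<lambda>s. \<bar>running_cost v X (t + a) g (s + a)\<bar>) integrable_on {0..t}"
        using shift(1)[of "running_cost v X (t + a) g"] shift(1)[of "\<lambda>s. \<bar>running_cost v X (t + a) g s\<bar>"] rca
        unfolding absolutely_integrable_on_def by auto
      have adm: "admissible v X 0 t g'"
      proof (rule admissibleI_bounded[OF g' integrable_add[OF rci(2) integrable_const_ivl]])
        show "\<bar>running_cost v X t g' s\<bar> \<le> \<bar>running_cost v X (t + a) g (s + a)\<bar> + e'" if "s \<in> {0..t}" for s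
          using diff[OF that] by linarith
      qed
      then have rc': "running_cost v X t g' integrable_on {0..t}"
        by (simp add: admissible_def absolutely_integrable_imp_integrable)
      have "cost v X 0 t g' \<le> integral {0..t} (\<lambda>s. running_cost v X (t + a) g (s + a) + e')"
        unfolding cost_def
      proof (rule integral_le[OF rc' integrable_add[OF rci(1) integrable_const_ivl]])
        show "running_cost v X t g' s \<le> running_cost v X (t + a) g (s + a) + e'" if "s \<in> {0..t}" for s
          using diff[OF that] by linarith
      qed
      also have "\<dots> = cost v X a (t + a) g + e' * t"
        using integral_add[OF rci(1) integrable_const_ivl[of e' 0 t]]
          shift(2)[OF absolutely_integrable_imp_integrable[OF rca]] ta by (simp add: cost_def mult.commute)
      also have "e' * t \<le> e"
      proof -
        have "e' * t \<le> e' * (T + 1)" using ta \<open>e' > 0\<close> by (intro mult_left_mono) auto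
        also have "\<dots> = e" using assms by (simp add: e'_def)
        finally show ?thesis .
      qed
      finally have 1: "cost v X 0 t g' \<le> cost v X a (t + a) g + e" by simp
      have "norm (traj X (t + a) g a - traj X (t + a) g 0) \<le> integral {0..a} (\<lambda>s. norm (g s))"
        by (rule norm_traj_diff_le[OF g0 a])
      then have "K * norm (traj X (t + a) g a - traj X (t + a) g 0) \<le> K * integral {0..a} (\<lambda>s. norm (g s))"
        using \<open>K \<ge> 0\<close> by (intro mult_left_mono)
      also have "\<dots> \<le> cost v (traj X (t + a) g a) 0 a g + C * a"
        using C(2)[OF order_refl a(1) _ cut(1)] ta by simp
      finally have 2: "K * norm (traj X (t + a) g a - traj X (t + a) g 0) \<le> cost v (traj X (t + a) g a) 0 a g + e"
        using Ca by simp
      have "value_fn v \<phi> X t \<le> total_cost v \<phi> X t g'" by (rule value_fn_le[OF ta(1) adm])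
      also have "\<dots> = \<phi> (to_torus (traj X (t + a) g a)) + cost v X 0 t g'"
        by (simp add: total_cost_def tr)
      also have "\<dots> \<le> total_cost v \<phi> X (t + a) g + 3 * e"
        using \<phi>_le[of "traj X (t + a) g a" "traj X (t + a) g 0"] 1 2 cut(3) by (simp add: total_cost_def)
      finally show "value_fn v \<phi> X t - 3 * e \<le> total_cost v \<phi> X (t + a) g" by simp
    qed
    then show ?thesis by simp
  qed
  then show ?thesis using \<open>d > 0\<close> by blast
qed

text \<open>Two points are compared through a later common time: \<open>value_fn_forward\<close>
  reaches it from one point along a straight line, which takes at least as much time as the
  distance, and \<open>value_fn_backward\<close> returns from it at the other point.\<close>

lemma value_fn_uniformly_continuous:
  assumes "0 < e" "0 \<le> T"
  shows "\<exists>d>0. \<forall>X Y t s. 0 \<le> t \<longrightarrow> t \<le> T \<longrightarrow> 0 \<le> s \<longrightarrow> s \<le> T \<longrightarrow> norm (X - Y) < d \<longrightarrow> \<bar>t - s\<bar> < d \<longrightarrow>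
    \<bar>value_fn v \<phi> X t - value_fn v \<phi> Y s\<bar> < e"
proof -
  \<comment> \<open>The common time may exceed \<open>T\<close>, though by less than 1. The factor 3
    in \<open>value_fn_backward\<close> turns \<open>e / 6\<close> into
    \<open>e / 2\<close>.\<close>
  have "0 < e / 6" "0 \<le> T + 1" using assms by auto
  from value_fn_backward[OF this] obtain d1 where "d1 > 0"
    and d1: "\<And>X t a. 0 \<le> t \<Longrightarrow> 0 \<le> a \<Longrightarrow> a < d1 \<Longrightarrow> t + a \<le> T + 1 \<Longrightarrow>
      value_fn v \<phi> X t \<le> value_fn v \<phi> X (t + a) + 3 * (e / 6)" by blast
  obtain C where C: "C \<ge> 0" "\<And>X Y t a. 0 \<le> t \<Longrightarrow> 0 < a \<Longrightarrow> t + a \<le> T + 1 \<Longrightarrow> norm (Y - X) \<le> a \<Longrightarrow>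
      value_fn v \<phi> Y (t + a) \<le> value_fn v \<phi> X t + C * a"
    using value_fn_forward[of "T + 1"] by blast
  define d where "d = Min {d1 / 3, 1 / 4, e / (8 * (C + 1))}"
  have d: "d > 0" "3 * d \<le> d1" "4 * d \<le> 1" "4 * (C + 1) * d \<le> e / 2"
  proof -
    have "d \<le> e / (8 * (C + 1))" unfolding d_def by (rule Min_le) auto
    then show "4 * (C + 1) * d \<le> e / 2" using C(1) by (simp add: field_simps)
    have "d \<le> d1 / 3" unfolding d_def by (rule Min_le) auto
    moreover have "d \<le> 1 / 4" unfolding d_def by (rule Min_le) auto
    ultimately show "3 * d \<le> d1" "4 * d \<le> 1" by simp_all
    show "d > 0" using \<open>d1 > 0\<close> C(1) assms by (simp add: d_def)
  qed
  have *: "value_fn v \<phi> Y s < value_fn v \<phi> X t + e"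
    if "0 \<le> t" "t \<le> T" "0 \<le> s" "s \<le> T" "norm (Y - X) < d" "\<bar>t - s\<bar> < d" for X Y t s
  proof -
    \<comment> \<open>\<open>s + b\<close> is the common time and \<open>a\<close> the time from
      \<open>t\<close> to it. The three summands make \<open>a\<close> positive and at least
      \<open>norm (Y - X)\<close>, whatever the order of \<open>s\<close> and
      \<open>t\<close>.\<close>
    define b where "b = \<bar>t - s\<bar> + norm (Y - X) + d"
    define a where "a = s + b - t"
    have b: "0 \<le> b" "b < 3 * d" using that d by (auto simp: b_def)
    have a: "norm (Y - X) \<le> a" "0 < a" "a < 4 * d" "t + a = s + b"
      using that d b norm_ge_zero[of "Y - X"] unfolding a_def b_def by linarith+
    have "value_fn v \<phi> Y s \<le> value_fn v \<phi> Y (s + b) + 3 * (e / 6)"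
      using that b d by (intro d1) auto
    also have "value_fn v \<phi> Y (s + b) \<le> value_fn v \<phi> X t + C * a"
      using C(2)[of t a Y X] that a b d by simp
    also have "C * a < e / 2"
    proof -
      have "C * a \<le> C * (4 * d)" using a C(1) by (intro mult_left_mono) auto
      also have "\<dots> < 4 * (C + 1) * d" using d(1) by (simp add: algebra_simps)
      finally show ?thesis using d(4) by simp
    qed
    finally show ?thesis by simp
  qed
  show ?thesis
  proof (intro exI conjI allI impI)
    fix X Y :: "real ^ 'n" and t s
    assume "0 \<le> t" "t \<le> T" "0 \<le> s" "s \<le> T" "norm (X - Y) < d" "\<bar>t - s\<bar> < d"
    then show "\<bar>value_fn v \<phi> X t - value_fn v \<phi> Y s\<bar> < e"
      using *[of t s Y X] *[of s t X Y] by (simp add: norm_minus_commute abs_minus_commute abs_less_iff)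
  qed (rule d)
qed

end

section \<open>Viscosity tests for the value function\<close>

context tonelli_value
begin

text \<open>Dynamic programming along the straight line that arrives at \<open>X\<close> with the
  velocity \<open>w\<close> dual to \<open>q\<close>. An upper bound on the cost is what is wanted,
  and near \<open>(X, t)\<close> it follows from upper semicontinuity of the Lagrangian at
  \<open>w\<close>; dividing by the elapsed time gives the inequality in the limit.\<close>

lemma value_fn_subsolution_test:
  fixes \<psi> :: "(real ^ 'n) \<times> real \<Rightarrow> real"
  assumes t: "0 < t"
    and D: "(\<psi> has_derivative (\<lambda>(W, r). q \<bullet> W + \<tau> * r)) (at (X, t))"
    and max: "0 < d" "\<And>Y s. 0 \<le> s \<Longrightarrow> dist Y X < d \<Longrightarrow> dist s t < d \<Longrightarrow>
      value_fn v \<phi> Y s - \<psi> (Y, s) \<le> value_fn v \<phi> X t - \<psi> (X, t)"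
  shows "\<tau> + h (to_torus X) q (v (to_torus X, t)) \<le> 0"
proof -
  define x where "x = to_torus X"
  define L where "L w = lagrangian h x w (v (x, t))" for w
  obtain w where w: "L w = q \<bullet> w - h x q (v (x, t))"
    using lagrangian_attained unfolding L_def by blast
  have "q \<bullet> w + \<tau> \<le> L w"
  proof (rule field_le_epsilon)
    fix e :: real assume "e > 0"
    obtain d0 where "d0 > 0" and d0: "\<And>y u. dist y x < d0 \<Longrightarrow> dist u (v (x, t)) < d0 \<Longrightarrow>
        lagrangian h y w u < L w + e"
      using lagrangian_usc[OF \<open>e > 0\<close>] unfolding L_def by blast
    obtain d1 where "d1 > 0" and d1: "\<And>z. dist z (x, t) < d1 \<Longrightarrow> dist (v z) (v (x, t)) < d0"
      using cont_v \<open>d0 > 0\<close> unfolding continuous_on_iff by (meson UNIV_I)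
    define \<rho> where "\<rho> = Min {d0, d1, d}"
    have \<rho>: "\<rho> > 0" "\<rho> \<le> d0" "\<rho> \<le> d1" "\<rho> \<le> d" using \<open>d0 > 0\<close> \<open>d1 > 0\<close> \<open>d > 0\<close> by (auto simp: \<rho>_def)
    \<comment> \<open>\<alpha> keeps the line at positive times and within \<rho> of
      \<open>(X, t)\<close>; the factor \<open>norm w + 1\<close> counts motion in space and in
      time.\<close>
    define \<alpha> where "\<alpha> = min t (\<rho> / (norm w + 1))"
    have "\<alpha> > 0" using t \<rho>(1) by (simp add: \<alpha>_def add_nonneg_pos)
    have step: "(\<psi> (X, t) - \<psi> (X - a *\<^sub>R w, t - a)) / a \<le> L w + e" if a: "0 < a" "a < \<alpha>" for a
    proof -
      have at: "a < t" "a * (norm w + 1) < \<rho>"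
        using a by (simp_all add: \<alpha>_def pos_less_divide_eq add_nonneg_pos)
      have an: "a * norm w < \<rho>" "a < \<rho>"
      proof -
        have "a * (norm w + 1) = a * norm w + a" by (simp add: algebra_simps)
        moreover have "0 \<le> a * norm w" using a by simp
        ultimately show "a * norm w < \<rho>" "a < \<rho>" using at(2) a by linarith+
      qed
      have tr: "traj X t (\<lambda>_. w) s = X - (t - s) *\<^sub>R w" if "s \<le> t" for s
        using that by (simp add: traj_def)
      have adm: "admissible v X (t - a) t (\<lambda>_. w)" using at by (intro admissible_const) simp
      have "running_cost v X t (\<lambda>_. w) s \<le> L w + e" if s: "s \<in> {t - a..t}" for s
      proof -
        have "dist (X - (t - s) *\<^sub>R w) X \<le> a * norm w"
          using s by (auto simp: dist_norm intro!: mult_right_mono)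
        then have 1: "dist (to_torus (X - (t - s) *\<^sub>R w)) x \<le> a * norm w"
          using dist_to_torus_le[of "X - (t - s) *\<^sub>R w" X] by (simp add: x_def)
        have "dist (to_torus (X - (t - s) *\<^sub>R w), s) (x, t)
            \<le> dist (to_torus (X - (t - s) *\<^sub>R w)) x + dist s t"
          unfolding dist_Pair_Pair by (rule sqrt_sum_squares_le_sum) auto
        also have "\<dots> \<le> a * norm w + a" using 1 s by (simp add: dist_real_def)
        also have "\<dots> < d1" using at(2) \<rho>(3) by (simp add: algebra_simps)
        finally have 2: "dist (v (to_torus (X - (t - s) *\<^sub>R w), s)) (v (x, t)) < d0" by (rule d1)
        have "dist (to_torus (X - (t - s) *\<^sub>R w)) x < d0" using 1 an(1) \<rho>(2) by linarith
        from d0[OF this 2] show ?thesis using s by (simp add: running_cost_def tr)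
      qed
      moreover have "running_cost v X t (\<lambda>_. w) integrable_on {t - a..t}"
        using adm by (simp add: admissible_def absolutely_integrable_imp_integrable)
      ultimately have "cost v X (t - a) t (\<lambda>_. w) \<le> integral {t - a..t} (\<lambda>_. L w + e)"
        unfolding cost_def by (intro integral_le integrable_const_ivl)
      also have "\<dots> = a * (L w + e)" using a by simp
      finally have c: "cost v X (t - a) t (\<lambda>_. w) \<le> a * (L w + e)" .
      have "value_fn v \<phi> X t \<le> value_fn v \<phi> (X - a *\<^sub>R w) (t - a) + cost v X (t - a) t (\<lambda>_. w)"
        using dynamic_programming_upper[OF _ _ adm] at a by (simp add: tr)
      moreover have "value_fn v \<phi> (X - a *\<^sub>R w) (t - a) - \<psi> (X - a *\<^sub>R w, t - a)
          \<le> value_fn v \<phi> X t - \<psi> (X, t)"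
        using at a an \<rho>(4) by (intro max(2)) (auto simp: dist_norm)
      ultimately have "\<psi> (X, t) - \<psi> (X - a *\<^sub>R w, t - a) \<le> (L w + e) * a"
        using c by (simp add: mult.commute)
      then show ?thesis using a by (simp add: pos_divide_le_eq)
    qed
    define F where "F a = \<psi> (X - a *\<^sub>R w, t - a)" for a
    have "((\<lambda>a. (X - a *\<^sub>R w, t - a)) has_derivative (\<lambda>a. (- (a *\<^sub>R w), - a))) (at 0)"
      by (auto intro!: derivative_eq_intros)
    moreover have "(\<psi> has_derivative (\<lambda>(W, r). q \<bullet> W + \<tau> * r)) (at (X - 0 *\<^sub>R w, t - 0))"
      using D by simp
    ultimately have "(F has_derivative (\<lambda>a. (\<lambda>(W, r). q \<bullet> W + \<tau> * r) (- (a *\<^sub>R w), - a))) (at 0)"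
      unfolding F_def[abs_def] by (rule has_derivative_compose)
    then have "(F has_real_derivative - (q \<bullet> w + \<tau>)) (at 0)"
      unfolding has_field_derivative_def by (rule has_derivative_eq_rhs) (auto simp: algebra_simps)
    then have "((\<lambda>a. - ((F a - F 0) / a)) \<longlongrightarrow> - (- (q \<bullet> w + \<tau>))) (at 0)"
      unfolding has_field_derivative_iff by (intro tendsto_minus) simp
    then have "((\<lambda>a. (F 0 - F a) / a) \<longlongrightarrow> q \<bullet> w + \<tau>) (at 0)"
      by (simp add: minus_divide_left add.commute)
    then have "((\<lambda>a. (F 0 - F a) / a) \<longlongrightarrow> q \<bullet> w + \<tau>) (at_right 0)"
      by (simp add: filterlim_at_split)
    moreover have "\<forall>\<^sub>F a in at_right 0. (F 0 - F a) / a \<le> L w + e"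
      unfolding eventually_at_right_field using step \<open>\<alpha> > 0\<close> by (auto simp: F_def intro!: exI[of _ \<alpha>])
    ultimately show "q \<bullet> w + \<tau> \<le> L w + e"
      by (rule tendsto_upperbound) simp
  qed
  then show ?thesis using w by (simp add: x_def)
qed

text \<open>Fenchel's inequality at the fixed momentum \<open>q\<close> bounds the cost of a near
  optimal curve from below, provided that the curve stays near \<open>(X, t)\<close>. Such a curve
  may be fast, so coercivity is used twice: a crude bound keeps its length \<open>I\<close> below
  \<rho>, and then, with the help of the test function, a sharper one makes \<open>I\<close>
  proportional to the elapsed time.\<close>

lemma value_fn_supersolution_test:
  fixes \<psi> :: "(real ^ 'n) \<times> real \<Rightarrow> real"
  assumes t: "0 < t"
    and D: "(\<psi> has_derivative (\<lambda>(W, r). q \<bullet> W + \<tau> * r)) (at (X, t))"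
    and min: "0 < d" "\<And>Y s. 0 \<le> s \<Longrightarrow> dist Y X < d \<Longrightarrow> dist s t < d \<Longrightarrow>
      value_fn v \<phi> Y s - \<psi> (Y, s) \<ge> value_fn v \<phi> X t - \<psi> (X, t)"
    and bounded: "\<And>Y s. 0 \<le> s \<Longrightarrow> s \<le> t \<Longrightarrow> \<bar>value_fn v \<phi> Y s\<bar> \<le> B"
  shows "\<tau> + h (to_torus X) q (v (to_torus X, t)) \<ge> 0"
proof -
  define Hx where "Hx = h (to_torus X) q (v (to_torus X, t))"
  have B0: "0 \<le> B" using bounded[of t X] t abs_ge_zero[of "value_fn v \<phi> X t"] by linarith
  have main: "0 \<le> \<tau> + Hx + 3 * e" if e: "0 < e" "e \<le> 1" for e
  proof -
    obtain C1 where C1: "C1 \<ge> 0" "\<And>X a t' g. 0 \<le> a \<Longrightarrow> a \<le> t' \<Longrightarrow> t' \<le> t \<Longrightarrow> admissible v X a t' g \<Longrightarrow>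
        (norm q + 2) * integral {a..t'} (\<lambda>s. norm (g s)) - C1 * (t' - a) \<le> cost v X a t' g"
      using cost_lower[of "norm q + 2" t] by auto
    define m where "m = \<bar>\<tau>\<bar>"
    have m: "0 \<le> m" "\<tau> \<le> m" by (simp_all add: m_def)
    \<comment> \<open>The constant in the later bound \<open>I \<le> C2 * a\<close>. Of the slope
      \<open>norm q + 2\<close> in the cost estimate, \<open>norm q\<close> absorbs
      \<open>q \<bullet> (X - Y)\<close>, 1 absorbs the error of differentiation, and 1
      remains.\<close>
    define C2 where "C2 = C1 + e + m + 1"
    have "C2 \<ge> 1" using C1(1) e m by (simp add: C2_def)
    \<comment> \<open>The tolerance in the derivative of \<psi>: multiplied by \<open>I + a\<close>,
      which is at most \<open>(1 + C2) * a\<close>, it gives at most \<open>e * a\<close>.\<close>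
    define ke where "ke = e / (1 + C2)"
    have ke: "0 < ke" "ke \<le> 1" "ke * (1 + C2) = e"
      using \<open>C2 \<ge> 1\<close> e by (auto simp: ke_def field_simps)
    obtain d1 where "d1 > 0" and d1: "\<And>z. norm (z - (X, t)) < d1 \<Longrightarrow>
        norm (\<psi> z - \<psi> (X, t) - (\<lambda>(W, r). q \<bullet> W + \<tau> * r) (z - (X, t))) \<le> ke * norm (z - (X, t))"
      using D ke(1) unfolding has_derivative_at_alt by blast
    have "continuous_on UNIV (\<lambda>z. h (to_torus (fst z)) q (v (to_torus (fst z), snd z)))"
      by (intro continuous_intros continuous_on_compose2[OF cont_v]) auto
    then obtain d3 where "d3 > 0" and d3: "\<And>z. dist z (X, t) < d3 \<Longrightarrow>
        dist (h (to_torus (fst z)) q (v (to_torus (fst z), snd z))) Hx < e"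
      unfolding continuous_on_iff Hx_def using e(1) by (metis UNIV_I fst_conv snd_conv)
    define \<rho> where "\<rho> = Min {d1, d, d3} / 2"
    have \<rho>: "\<rho> > 0" "2 * \<rho> \<le> d1" "2 * \<rho> \<le> d" "2 * \<rho> \<le> d3"
      using \<open>d1 > 0\<close> \<open>d > 0\<close> \<open>d3 > 0\<close> by (auto simp: \<rho>_def)
    \<comment> \<open>The crude bound will be \<open>K * I \<le> 2 * B + 1\<close>, from two values
      of the value function and errors of total size at most 1. This \<open>K\<close> then forces
      \<open>I < \<rho>\<close>.\<close>
    define K where "K = (2 * B + 2) / \<rho>"
    have "K > 0" using B0 \<rho>(1) by (simp add: K_def)
    obtain CK where CK: "CK \<ge> 0" "\<And>X a t' g. 0 \<le> a \<Longrightarrow> a \<le> t' \<Longrightarrow> t' \<le> t \<Longrightarrow> admissible v X a t' g \<Longrightarrow>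
        K * integral {a..t'} (\<lambda>s. norm (g s)) - CK * (t' - a) \<le> cost v X a t' g"
      using cost_lower[of K t] \<open>K > 0\<close> by auto
    define a where "a = Min {t / 2, \<rho> / 2, 1 / (1 + CK)}"
    have a: "0 < a" "a < t" "a < \<rho>" "a * (1 + CK) \<le> 1"
    proof -
      have "a \<le> t / 2" "a \<le> \<rho> / 2" "a \<le> 1 / (1 + CK)" by (simp_all add: a_def)
      then show "a < t" "a < \<rho>" "a * (1 + CK) \<le> 1" using t \<rho>(1) CK(1) by (auto simp: field_simps)
      show "0 < a" using t \<rho>(1) CK(1) by (simp add: a_def)
    qed
    define r where "r = t - a"
    have r: "0 \<le> r" "r \<le> t" "t - r = a" using a by (auto simp: r_def)
    \<comment> \<open>The loss in dynamic programming is proportional to the elapsed time, so it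
      stays small after division by \<open>a\<close>.\<close>
    have "0 < e * a" using e a by auto
    obtain g where adm: "admissible v X r t g"
      and g: "value_fn v \<phi> (traj X t g r) r + cost v X r t g \<le> value_fn v \<phi> X t + e * a"
      using dynamic_programming_lower[OF \<open>0 < e * a\<close> r(1,2)] .
    define Y where "Y = traj X t g r"
    define I where "I = integral {r..t} (\<lambda>s. norm (g s))"
    have ga: "g absolutely_integrable_on {r..t}" and rci: "running_cost v X t g integrable_on {r..t}"
      using adm by (auto simp: admissible_def absolutely_integrable_imp_integrable)
    have gi: "g integrable_on {r..t}" using ga by (rule absolutely_integrable_imp_integrable)
    have dist_I: "norm (X - traj X t g s) \<le> I" if "s \<in> {r..t}" for s
    proof -
      have ni: "(\<lambda>s. norm (g s)) integrable_on {r..t}" using ga by (simp add: absolutely_integrable_on_def)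
      have gs: "g absolutely_integrable_on {s..t}"
        using ga that by (intro absolutely_integrable_on_subinterval[OF ga]) auto
      have "norm (X - traj X t g s) \<le> integral {s..t} (\<lambda>s. norm (g s))"
        using norm_traj_diff_le[OF gs _ order_refl, of X] that by simp
      also have "\<dots> \<le> I" unfolding I_def
        using that ni by (intro integral_subset_le) (auto intro: integrable_on_subinterval)
      finally show ?thesis .
    qed
    have I0: "0 \<le> I" using dist_I[of t] r by simp
    have I_small: "I < \<rho>"
    proof -
      have "K * I - CK * a \<le> cost v X r t g" using CK(2)[OF r(1,2) order_refl adm] r(3) by (simp add: I_def)
      moreover have "e * a + CK * a \<le> 1"
      proof -
        have "e * a \<le> 1 * a" using e a by (intro mult_right_mono) auto
        then show ?thesis using a(4) by (simp add: algebra_simps)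
      qed
      ultimately have "K * I \<le> 2 * B + 1"
        using g bounded[of r "traj X t g r"] bounded[of t X] r t unfolding abs_le_iff by linarith
      also have "\<dots> < K * \<rho>" using \<rho>(1) by (simp add: K_def)
      finally show ?thesis using \<open>K > 0\<close> by simp
    qed
    have near: "norm ((traj X t g s, s) - (X, t)) \<le> I + a" "norm ((traj X t g s, s) - (X, t)) < 2 * \<rho>"
      if "s \<in> {r..t}" for s
    proof -
      have "norm ((traj X t g s, s) - (X, t)) \<le> norm (traj X t g s - X) + norm (s - t)"
        using norm_Pair_le[of "traj X t g s - X" "s - t"] by simp
      also have "\<dots> \<le> I + a" using dist_I[OF that] that r by (simp add: norm_minus_commute)
      finally show "norm ((traj X t g s, s) - (X, t)) \<le> I + a" .
      then show "norm ((traj X t g s, s) - (X, t)) < 2 * \<rho>" using I_small a by simp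
    qed
    have Yr: "r \<in> {r..t}" using r by simp
    have i: "cost v X r t g - e * a \<le> \<psi> (X, t) - \<psi> (Y, r)"
    proof -
      have "dist Y X < d" "dist r t < d"
        using dist_I[OF Yr] I_small \<rho>(1,3) a r by (auto simp: dist_norm norm_minus_commute Y_def)
      from min(2)[OF r(1) this] show ?thesis using g by (simp add: Y_def)
    qed
    have ii: "\<psi> (X, t) - \<psi> (Y, r) \<le> q \<bullet> (X - Y) + \<tau> * a + ke * (I + a)"
    proof -
      have "norm ((Y, r) - (X, t)) < d1" using near(2)[OF Yr] \<rho>(2) by (simp add: Y_def)
      from d1[OF this] have "\<bar>\<psi> (Y, r) - \<psi> (X, t) - (q \<bullet> (Y - X) + \<tau> * (r - t))\<bar> \<le> ke * norm ((Y, r) - (X, t))"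
        by simp
      also have "\<dots> \<le> ke * (I + a)" using near(1)[OF Yr] ke(1) by (intro mult_left_mono) (auto simp: Y_def)
      finally have "\<psi> (X, t) - \<psi> (Y, r) \<le> ke * (I + a) - (q \<bullet> (Y - X) + \<tau> * (r - t))"
        unfolding abs_le_iff by linarith
      moreover have "q \<bullet> (Y - X) = - (q \<bullet> (X - Y))" by (simp add: inner_diff_right)
      moreover have "\<tau> * (r - t) = - (\<tau> * a)" by (simp add: r_def)
      ultimately show ?thesis by linarith
    qed
    have I_le: "I \<le> C2 * a"
    proof -
      have "(norm q + 2) * I - C1 * a \<le> cost v X r t g"
        using C1(2)[OF r(1,2) order_refl adm] r(3) by (simp add: I_def)
      moreover have "q \<bullet> (X - Y) \<le> norm q * I"
      proof -
        have "q \<bullet> (X - Y) \<le> norm q * norm (X - Y)" by (rule norm_cauchy_schwarz)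
        also have "\<dots> \<le> norm q * I" using dist_I[OF Yr] by (intro mult_left_mono) (auto simp: Y_def)
        finally show ?thesis .
      qed
      moreover have "ke * (I + a) \<le> 1 * (I + a)" using ke I0 a by (intro mult_right_mono) auto
      moreover have "\<tau> * a \<le> m * a" using a m by (intro mult_right_mono) auto
      ultimately have "(norm q + 2) * I - C1 * a \<le> e * a + (norm q * I + m * a + 1 * (I + a))"
        using i ii by (smt (verit))
      moreover have "(norm q + 2) * I = norm q * I + 2 * I" by (simp add: algebra_simps)
      moreover have "C2 * a = C1 * a + e * a + m * a + a" by (simp add: C2_def algebra_simps)
      ultimately show ?thesis by (smt (verit))
    qed
    \<comment> \<open>Fenchel's inequality is integrated along the curve; the velocity integrates to
      the displacement \<open>X - Y\<close>.\<close>
    have iv: "q \<bullet> (X - Y) - a * (Hx + e) \<le> cost v X r t g"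
    proof -
      have qg: "(\<lambda>s. q \<bullet> g s) integrable_on {r..t}"
        using integrable_linear[OF gi bounded_linear_inner_right[of q]] by (simp add: o_def)
      have "integral {r..t} (\<lambda>s. q \<bullet> g s - (Hx + e)) \<le> cost v X r t g"
        unfolding cost_def
      proof (rule integral_le[OF integrable_diff[OF qg integrable_const_ivl] rci])
        fix s assume s: "s \<in> {r..t}"
        have "dist (traj X t g s, s) (X, t) < d3" using near(2)[OF s] \<rho>(4) by (simp add: dist_norm)
        from d3[OF this] have "h (to_torus (traj X t g s)) q (v (to_torus (traj X t g s), s)) \<le> Hx + e"
          unfolding dist_real_def abs_less_iff fst_conv snd_conv by linarith
        then show "q \<bullet> g s - (Hx + e) \<le> running_cost v X t g s"
          using fenchel[of q "g s" "to_torus (traj X t g s)" "v (to_torus (traj X t g s), s)"]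
          unfolding running_cost_def by linarith
      qed
      moreover have "integral {r..t} (\<lambda>s. q \<bullet> g s - (Hx + e)) = integral {r..t} (\<lambda>s. q \<bullet> g s) - a * (Hx + e)"
        using integral_diff[OF qg integrable_const_ivl[of "Hx + e" r t]] r by simp
      moreover have "integral {r..t} (\<lambda>s. q \<bullet> g s) = q \<bullet> (X - Y)"
        using integral_linear[OF gi bounded_linear_inner_right[of q]] by (simp add: o_def Y_def traj_def)
      ultimately show ?thesis by simp
    qed
    have "ke * (I + a) \<le> e * a"
    proof -
      have "ke * (I + a) \<le> ke * (C2 * a + a)" using I_le ke(1) by (intro mult_left_mono) auto
      also have "\<dots> = ke * (1 + C2) * a" by (simp add: algebra_simps)
      finally show ?thesis by (simp only: ke(3))
    qed
    then have "0 \<le> \<tau> * a + a * (Hx + e) + e * a + e * a" using i ii iv by linarith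
    also have "\<dots> = (\<tau> + Hx + 3 * e) * a" by (simp add: algebra_simps)
    finally show ?thesis using a(1) by (simp add: zero_le_mult_iff)
  qed
  have "0 \<le> \<tau> + Hx + \<eta>" if "\<eta> > 0" for \<eta>
  proof -
    have "0 < min 1 (\<eta> / 3)" "min 1 (\<eta> / 3) \<le> 1" using that by auto
    from main[OF this] show ?thesis by linarith
  qed
  then have "0 \<le> \<tau> + Hx" by (rule field_le_epsilon)
  then show ?thesis by (simp add: Hx_def)
qed

end

section \<open>Absolutely continuous curves on the torus\<close>

text \<open>Two lifts differ by a lattice-valued function that is continuous at \<open>s\<close>.
  Nonzero lattice vectors have norm at least 1, so the difference is constant near \<open>s\<close>
  and its derivative \<open>w - w'\<close> vanishes.\<close>

lemma has_velocity_unique: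
  assumes "has_velocity \<gamma> w s" "has_velocity \<gamma> w' s"
  shows "w = w'"
proof -
  obtain c where c: "(c has_vector_derivative w) (at s)" "\<forall>\<^sub>F r in nhds s. \<gamma> r = to_torus (c r)"
    using assms(1) unfolding has_velocity_def by blast
  obtain c' where c': "(c' has_vector_derivative w') (at s)" "\<forall>\<^sub>F r in nhds s. \<gamma> r = to_torus (c' r)"
    using assms(2) unfolding has_velocity_def by blast
  define e where "e r = c r - c' r" for r
  have de: "(e has_vector_derivative w - w') (at s)"
    unfolding e_def by (intro has_vector_derivative_diff c c')
  have "isCont e s" using de by (rule has_vector_derivative_continuous)
  then have "\<forall>\<^sub>F r in at s. dist (e r) (e s) < 1" unfolding isCont_def by (rule tendstoD) simp
  then have near: "\<forall>\<^sub>F r in nhds s. dist (e r) (e s) < 1" by (simp add: eventually_nhds_conv_at)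
  have lat: "\<forall>\<^sub>F r in nhds s. e r \<in> int_lattice"
    using c(2) c'(2) by eventually_elim (metis e_def to_torus_eq_iff)
  then have "e s \<in> int_lattice" by (rule eventually_nhds_x_imp_x)
  have "\<forall>\<^sub>F r in nhds s. e r = e s"
    using near lat
  proof eventually_elim
    case (elim r)
    have "e r - e s \<in> int_lattice"
      using int_lattice_add[OF elim(2) int_lattice_uminus[OF \<open>e s \<in> int_lattice\<close>]] by simp
    then show ?case using norm_int_lattice_ge_1[of "e r - e s"] elim(1) by (force simp: dist_norm)
  qed
  then have "((\<lambda>_. e s) has_vector_derivative w - w') (at s)"
    using de has_derivative_transform_eventually[of e "\<lambda>h. h *\<^sub>R (w - w')" s UNIV "\<lambda>_. e s"]
    unfolding has_vector_derivative_def eventually_nhds_conv_at by auto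
  then show ?thesis
    using vector_derivative_unique_at[of "\<lambda>_. e s" "w - w'" s 0] by simp
qed

lemma velocity_eqI: "has_velocity \<gamma> w s \<Longrightarrow> velocity \<gamma> s = w"
  unfolding velocity_def using has_velocity_unique by blast

lemma velocity_traj:
  assumes g: "g absolutely_integrable_on {0..t}"
    and \<gamma>: "\<And>s. s \<in> {0..t} \<Longrightarrow> \<gamma> s = to_torus (traj X t g s)"
  shows "AE s in lebesgue. s \<in> {0..t} \<longrightarrow> velocity \<gamma> s = g s"
proof -
  have gi: "g integrable_on {0..t}" using g by (rule absolutely_integrable_imp_integrable)
  obtain N where N: "negligible N" "\<And>s. s \<in> {0<..<t} \<Longrightarrow> s \<notin> N \<Longrightarrow>
      ((\<lambda>r. integral {0..r} g) has_vector_derivative g s) (at s)"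
    using AE_has_vector_derivative_integral[OF gi] by blast
  have vel: "velocity \<gamma> s = g s" if s: "s \<in> {0<..<t}" "s \<notin> N" for s
  proof (rule velocity_eqI)
    have "((\<lambda>r. traj X t g 0 + integral {0..r} g) has_vector_derivative g s) (at s)"
      using has_vector_derivative_add[OF has_vector_derivative_const N(2)[OF s]] by simp
    moreover have "\<forall>\<^sub>F r in nhds s. r \<in> {0<..<t}"
      using s(1) by (intro eventually_nhds_in_open) auto
    then have "\<forall>\<^sub>F r in nhds s. \<gamma> r = to_torus (traj X t g 0 + integral {0..r} g)"
    proof eventually_elim
      case (elim r)
      then have "traj X t g r = traj X t g 0 + integral {0..r} g"
        using traj_diff[of 0 r t g X] gi by (simp add: algebra_simps)
      then show ?case using \<gamma>[of r] elim by simp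
    qed
    ultimately show "has_velocity \<gamma> (g s) s" unfolding has_velocity_def by blast
  qed
  \<comment> \<open>At an end point the velocity would depend on the curve outside [0, t]; the two
    end points join the null set.\<close>
  have "negligible (N \<union> {0, t})" using N(1) by (intro negligible_Un) auto
  then have "N \<union> {0, t} \<in> null_sets lebesgue" by (simp add: negligible_iff_null_sets)
  then show ?thesis by (rule AE_I') (use vel in force)
qed

text \<open>The lift is prolonged by one window of length \<open>d\<close>, using the
  representatives nearest to the lift at the left end of the window. The second invariant keeps
  values at nearby times within 1/2 of each other, where the projection is isometric; the bound 1/4
  leaves room for the triangle inequality through that left end.\<close>

lemma torus_curve_lift_step:
  assumes "0 < d" and small: "\<And>s r. s \<in> {0..t} \<Longrightarrow> r \<in> {0..t} \<Longrightarrow> \<bar>s - r\<bar> \<le> d \<Longrightarrow> dist (\<gamma> s) (\<gamma> r) < 1 / 4"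
  shows "\<exists>c. (\<forall>s. 0 \<le> s \<longrightarrow> s \<le> t \<longrightarrow> s \<le> real n * d \<longrightarrow> to_torus (c s) = \<gamma> s) \<and>
    (\<forall>s r. 0 \<le> s \<longrightarrow> s \<le> r \<longrightarrow> r \<le> t \<longrightarrow> r \<le> real n * d \<longrightarrow> r - s \<le> d \<longrightarrow> dist (c s) (c r) < 1 / 2)"
proof (induction n)
  case 0
  obtain X where "to_torus X = \<gamma> 0" using to_torus_surj by blast
  then show ?case by (intro exI[of _ "\<lambda>_. X"]) auto
next
  case (Suc n)
  then obtain c where c: "\<And>s. 0 \<le> s \<Longrightarrow> s \<le> t \<Longrightarrow> s \<le> real n * d \<Longrightarrow> to_torus (c s) = \<gamma> s"
    "\<And>s r. 0 \<le> s \<Longrightarrow> s \<le> r \<Longrightarrow> r \<le> t \<Longrightarrow> r \<le> real n * d \<Longrightarrow> r - s \<le> d \<Longrightarrow> dist (c s) (c r) < 1 / 2"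
    by blast
  define a where "a = real n * d"
  have a0: "0 \<le> a" using \<open>0 < d\<close> by (simp add: a_def)
  have Sa: "real (Suc n) * d = a + d" by (simp add: a_def algebra_simps)
  have "\<exists>Y. to_torus Y = \<gamma> s \<and> dist Y (c a) = dist (\<gamma> s) (to_torus (c a))" for s
    using to_torus_lift[of "\<gamma> s" "c a"] by blast
  then have "\<forall>s. \<exists>Y. to_torus Y = \<gamma> s \<and> dist Y (c a) = dist (\<gamma> s) (to_torus (c a))" by blast
  from choice[OF this] obtain b where b: "\<And>s. to_torus (b s) = \<gamma> s"
    "\<And>s. dist (b s) (c a) = dist (\<gamma> s) (to_torus (c a))" by blast
  define c' where "c' s = (if s \<le> a then c s else b s)" for s
  have near_right: "dist (b s) (c a) < 1 / 4" if "a \<le> s" "s \<le> t" "s \<le> a + d" for s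
    using b(2)[of s] c(1)[of a] small[of s a] that a0 by (simp add: a_def)
  have near_left: "dist (c s) (c a) < 1 / 4" if "0 \<le> s" "s \<le> a" "a \<le> t" "a - s \<le> d" for s
  proof -
    have "dist (c s) (c a) < 1 / 2" using c(2)[of s a] that by (simp add: a_def)
    from dist_to_torus_eq[OF this] show ?thesis
      using c(1)[of s] c(1)[of a] small[of s a] that a0 by (simp add: a_def)
  qed
  show ?case
  proof (intro exI[of _ c'] conjI allI impI)
    fix s assume "0 \<le> s" "s \<le> t" "s \<le> real (Suc n) * d"
    then show "to_torus (c' s) = \<gamma> s" using c(1)[of s] b(1) by (simp add: c'_def a_def)
  next
    fix s r assume sr: "0 \<le> s" "s \<le> r" "r \<le> t" "r \<le> real (Suc n) * d" "r - s \<le> d"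
    consider "r \<le> a" | "s \<le> a" "a < r" | "a < s" by linarith
    then show "dist (c' s) (c' r) < 1 / 2"
    proof cases
      case 1
      then show ?thesis using c(2)[of s r] sr by (simp add: c'_def a_def)
    next
      case 2
      then have "dist (c s) (c a) < 1 / 4" "dist (b r) (c a) < 1 / 4"
        using near_left[of s] near_right[of r] sr Sa by auto
      then show ?thesis using 2 dist_triangle2[of "c s" "b r" "c a"] by (simp add: c'_def)
    next
      case 3
      then have "dist (b s) (c a) < 1 / 4" "dist (b r) (c a) < 1 / 4"
        using near_right[of s] near_right[of r] sr Sa by auto
      then show ?thesis using 3 sr dist_triangle2[of "b s" "b r" "c a"] by (simp add: c'_def)
    qed
  qed
qed

lemma abs_continuous_lift:
  assumes ac: "abs_continuous_on 0 t \<gamma>" and "0 \<le> t"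
  obtains c where "\<And>s. s \<in> {0..t} \<Longrightarrow> to_torus (c s) = \<gamma> s" "abs_continuous_on 0 t c"
proof -
  obtain d where "d > 0" and d: "\<And>s r. s \<in> {0..t} \<Longrightarrow> r \<in> {0..t} \<Longrightarrow> \<bar>s - r\<bar> < d \<Longrightarrow> dist (\<gamma> s) (\<gamma> r) < 1 / 4"
    using abs_continuous_on_imp_uniform[OF ac, of "1 / 4"] by auto
  have "0 < d / 2" using \<open>d > 0\<close> by simp
  have small: "dist (\<gamma> s) (\<gamma> r) < 1 / 4" if "s \<in> {0..t}" "r \<in> {0..t}" "\<bar>s - r\<bar> \<le> d / 2" for s r
    using d[OF that(1,2)] that(3) \<open>d > 0\<close> by auto
  obtain n where n: "t / (d / 2) \<le> real n" using real_arch_simple by blast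
  then have nt: "t \<le> real n * (d / 2)" using \<open>d > 0\<close> by (simp add: field_simps)
  from torus_curve_lift_step[where \<gamma> = \<gamma> and t = t and d = "d / 2" and n = n, OF \<open>0 < d / 2\<close> small] obtain c where
    c: "\<And>s. 0 \<le> s \<Longrightarrow> s \<le> t \<Longrightarrow> s \<le> real n * (d / 2) \<Longrightarrow> to_torus (c s) = \<gamma> s"
    "\<And>s r. 0 \<le> s \<Longrightarrow> s \<le> r \<Longrightarrow> r \<le> t \<Longrightarrow> r \<le> real n * (d / 2) \<Longrightarrow> r - s \<le> d / 2 \<Longrightarrow> dist (c s) (c r) < 1 / 2"
    by blast
  have c1: "to_torus (c s) = \<gamma> s" if "s \<in> {0..t}" for s using c(1)[of s] that nt by auto
  have iso: "dist (c s) (c r) = dist (\<gamma> s) (\<gamma> r)" if "0 \<le> s" "s \<le> r" "r \<le> t" "r - s \<le> d / 2" for s r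
    using dist_to_torus_eq[OF c(2)[of s r]] c1[of s] c1[of r] that nt by auto
  have "abs_continuous_on 0 t c"
    unfolding abs_continuous_on_iff
  proof (intro allI impI)
    fix e :: real assume "e > 0"
    obtain \<delta> where "\<delta> > 0" and \<delta>: "\<And>D. interval_family 0 t D \<Longrightarrow>
        (\<Sum>(c, d)\<in>D. d - c) < \<delta> \<Longrightarrow> (\<Sum>(c, d)\<in>D. dist (\<gamma> c) (\<gamma> d)) < e"
      using ac \<open>e > 0\<close> unfolding abs_continuous_on_iff by meson
    show "\<exists>\<delta>>0. \<forall>D. interval_family 0 t D \<longrightarrow>
        (\<Sum>(c, d)\<in>D. d - c) < \<delta> \<longrightarrow>
        (\<Sum>(x, y)\<in>D. dist (c x) (c y)) < e"
    proof (intro exI conjI allI impI)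
      \<comment> \<open>A total length below \<open>d / 2\<close> makes every single interval short
        enough for the lift to preserve the distance of its end values.\<close>
      show "min \<delta> (d / 2) > 0" using \<open>\<delta> > 0\<close> \<open>d > 0\<close> by simp
      fix D
      assume fam: "interval_family 0 t D"
        and sum: "(\<Sum>(c, d)\<in>D. d - c) < min \<delta> (d / 2)"
      then have D: "finite D" "\<forall>(c, d)\<in>D. 0 \<le> c \<and> c \<le> d \<and> d \<le> t"
        by (auto simp: interval_family_def)
      have "(\<Sum>(x, y)\<in>D. dist (c x) (c y)) = (\<Sum>(x, y)\<in>D. dist (\<gamma> x) (\<gamma> y))"
        unfolding case_prod_beta'
      proof (rule sum.cong[OF refl])
        fix I assume "I \<in> D"
        then have I: "0 \<le> fst I" "fst I \<le> snd I" "snd I \<le> t" using D(2) by auto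
        have "snd I - fst I \<le> (\<Sum>I\<in>D. snd I - fst I)"
          using D by (intro member_le_sum \<open>I \<in> D\<close>) auto
        then have "snd I - fst I \<le> d / 2" using sum by (simp add: case_prod_beta')
        then show "dist (c (fst I)) (c (snd I)) = dist (\<gamma> (fst I)) (\<gamma> (snd I))" by (rule iso[OF I])
      qed
      also have "\<dots> < e" using \<delta>[OF fam] sum by simp
      finally show "(\<Sum>(x, y)\<in>D. dist (c x) (c y)) < e" .
    qed
  qed
  with c1 show ?thesis by (rule that)
qed

lemma abs_continuous_curve_control:
  assumes ac: "abs_continuous_on 0 t \<gamma>" and "0 \<le> t"
  obtains X g where "g absolutely_integrable_on {0..t}" "\<forall>s\<in>{0..t}. \<gamma> s = to_torus (traj X t g s)"
proof -
  obtain c where c: "\<And>s. s \<in> {0..t} \<Longrightarrow> to_torus (c s) = \<gamma> s" "abs_continuous_on 0 t c"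
    using abs_continuous_lift[OF assms] by blast
  obtain g where g: "g absolutely_integrable_on {0..t}" "\<And>x. x \<in> {0..t} \<Longrightarrow> c x = c 0 + integral {0..x} g"
    using abs_continuous_on_has_density[OF c(2) \<open>0 \<le> t\<close>] by blast
  have "traj (c t) t g s = c s" if s: "s \<in> {0..t}" for s
  proof -
    have "integral {0..s} g + integral {s..t} g = integral {0..t} g"
      using s absolutely_integrable_imp_integrable[OF g(1)]
      by (intro Henstock_Kurzweil_Integration.integral_combine) auto
    then show ?thesis using g(2)[OF s] g(2)[of t] s by (auto simp: traj_def algebra_simps)
  qed
  then have "\<forall>s\<in>{0..t}. \<gamma> s = to_torus (traj (c t) t g s)"
    using c(1) by simp
  with g(1) show ?thesis by (rule that)
qed

lemma abs_continuous_on_traj: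
  assumes g: "g absolutely_integrable_on {0..t}"
  shows "abs_continuous_on 0 t (\<lambda>s. to_torus (traj X t g s))"
proof (rule abs_continuous_onI_integral)
  show "(\<lambda>s. norm (g s)) integrable_on {0..t}" using g by (simp add: absolutely_integrable_on_def)
  fix s r :: real assume sr: "0 \<le> s" "s \<le> r" "r \<le> t"
  have "g absolutely_integrable_on {s..t}" using sr by (intro absolutely_integrable_on_subinterval[OF g]) auto
  from norm_traj_diff_le[OF this sr(2,3), of X] dist_to_torus_le[of "traj X t g s" "traj X t g r"]
  show "dist (to_torus (traj X t g s)) (to_torus (traj X t g r)) \<le> integral {s..r} (\<lambda>s. norm (g s))"
    by (simp add: dist_norm norm_minus_commute)
qed simp

section \<open>The action functional\<close>

lemma extended_integral_cong_AE:
  assumes "AE s in lebesgue. s \<in> S \<longrightarrow> f s = g s"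
  shows "extended_integral S f = extended_integral S g"
proof -
  have "(\<integral>\<^sup>+s\<in>S. ennreal (f s) \<partial>lebesgue) = (\<integral>\<^sup>+s\<in>S. ennreal (g s) \<partial>lebesgue)"
    "(\<integral>\<^sup>+s\<in>S. ennreal (- f s) \<partial>lebesgue) = (\<integral>\<^sup>+s\<in>S. ennreal (- g s) \<partial>lebesgue)"
    using assms by (auto intro!: nn_integral_cong_AE elim!: eventually_mono simp: indicator_def)
  then show ?thesis by (simp add: extended_integral_def)
qed

lemma nn_set_integral_eq_indicator_scaleR:
  "(\<integral>\<^sup>+s\<in>S. ennreal (f s) \<partial>M) = (\<integral>\<^sup>+s. ennreal (indicator S s *\<^sub>R f s) \<partial>M)"
  by (intro nn_integral_cong) (auto simp: indicator_def)

lemma extended_integral_eq_integral: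
  assumes "f absolutely_integrable_on S"
  shows "extended_integral S f = ereal (integral S f)"
proof -
  have int: "integrable lebesgue (\<lambda>s. indicator S s *\<^sub>R f s)" using assms by (simp add: set_integrable_def)
  obtain r q where rq: "0 \<le> r" "0 \<le> q"
    "(\<integral>\<^sup>+s. ennreal (indicator S s *\<^sub>R f s) \<partial>lebesgue) = ennreal r"
    "(\<integral>\<^sup>+s. ennreal (- (indicator S s *\<^sub>R f s)) \<partial>lebesgue) = ennreal q"
    "integral\<^sup>L lebesgue (\<lambda>s. indicator S s *\<^sub>R f s) = r - q"
    by (rule integrableE[OF int])
  have "integral S f = r - q"
    using set_lebesgue_integral_eq_integral(2)[OF assms] rq(5) by (simp add: set_lebesgue_integral_def)
  moreover have "(\<integral>\<^sup>+s\<in>S. ennreal (f s) \<partial>lebesgue) = ennreal r"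
    unfolding nn_set_integral_eq_indicator_scaleR by (rule rq)
  moreover have "(\<integral>\<^sup>+s\<in>S. ennreal (- f s) \<partial>lebesgue) = ennreal q"
    unfolding nn_set_integral_eq_indicator_scaleR using rq(4) by simp
  ultimately show ?thesis using rq(1,2) by (simp add: extended_integral_def)
qed

text \<open>The lower bound makes the negative part integrable over the bounded interval, so the
  failure of integrability lies in the positive part.\<close>

lemma extended_integral_eq_infinity:
  fixes f :: "real \<Rightarrow> real"
  assumes meas: "f \<in> borel_measurable (lebesgue_on {a..b})" and lower: "\<And>s. s \<in> {a..b} \<Longrightarrow> - C \<le> f s"
    and nint: "\<not> f absolutely_integrable_on {a..b}"
  shows "extended_integral {a..b} f = \<infinity>"
proof -
  have m: "(\<lambda>s. indicator {a..b} s *\<^sub>R f s) \<in> borel_measurable lebesgue"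
    using meas by (simp add: borel_measurable_restrict_space_iff mult.commute)
  have "(\<integral>\<^sup>+s\<in>{a..b}. ennreal (- f s) \<partial>lebesgue) \<le> (\<integral>\<^sup>+s\<in>{a..b}. ennreal C \<partial>lebesgue)"
    using lower by (intro nn_integral_mono) (auto simp: indicator_def intro!: ennreal_leI; smt (verit))
  also have "\<dots> = ennreal C * emeasure lebesgue {a..b}"
    by (rule nn_integral_cmult_indicator) simp
  also have "\<dots> < \<infinity>" by (simp add: ennreal_mult_less_top emeasure_lborel_Icc_eq)
  finally have neg: "(\<integral>\<^sup>+s\<in>{a..b}. ennreal (- f s) \<partial>lebesgue) \<noteq> \<infinity>" by simp
  have "(\<integral>\<^sup>+s\<in>{a..b}. ennreal (f s) \<partial>lebesgue) = \<infinity>"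
  proof (rule ccontr)
    assume "(\<integral>\<^sup>+s\<in>{a..b}. ennreal (f s) \<partial>lebesgue) \<noteq> \<infinity>"
    then have "integrable lebesgue (\<lambda>s. indicator {a..b} s *\<^sub>R f s)"
      using m neg nn_set_integral_eq_indicator_scaleR[where S = "{a..b}" and f = f and M = lebesgue]
        nn_set_integral_eq_indicator_scaleR[where S = "{a..b}" and f = "\<lambda>s. - f s" and M = lebesgue]
      by (simp add: real_integrable_def)
    then show False using nint by (simp add: set_integrable_def)
  qed
  then show ?thesis using neg by (cases "\<integral>\<^sup>+s\<in>{a..b}. ennreal (- f s) \<partial>lebesgue")
      (auto simp: extended_integral_def)
qed

context tonelli_value
begin

lemma action_traj:
  assumes g: "g absolutely_integrable_on {0..t}"
    and \<gamma>: "\<And>s. s \<in> {0..t} \<Longrightarrow> \<gamma> s = to_torus (traj X t g s)"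
  shows "action h v t \<gamma> = extended_integral {0..t} (running_cost v X t g)"
  unfolding action_def
proof (rule extended_integral_cong_AE)
  show "AE s in lebesgue. s \<in> {0..t} \<longrightarrow>
      lagrangian h (\<gamma> s) (velocity \<gamma> s) (v (\<gamma> s, s)) = running_cost v X t g s"
  proof -
    have "AE s in lebesgue. s \<in> {0..t} \<longrightarrow> velocity \<gamma> s = g s"
      by (rule velocity_traj[OF g]) (rule \<gamma>)
    then show ?thesis by eventually_elim (simp add: running_cost_def \<gamma>)
  qed
qed

text \<open>A curve with nonintegrable cost has infinite action and does not affect the infimum.
  Every other curve comes from an admissible control, whose end point may be another representative
  \<open>Y\<close> of the same torus point.\<close>

theorem value_fn_eq_INF:
  assumes "0 \<le> t"
  shows "ereal (value_fn v \<phi> X t) =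
    (INF \<gamma>\<in>{\<gamma>. abs_continuous_on 0 t \<gamma> \<and> \<gamma> t = to_torus X}. ereal (\<phi> (\<gamma> 0)) + action h v t \<gamma>)"
proof (rule antisym)
  show "ereal (value_fn v \<phi> X t) \<le>
    (INF \<gamma>\<in>{\<gamma>. abs_continuous_on 0 t \<gamma> \<and> \<gamma> t = to_torus X}. ereal (\<phi> (\<gamma> 0)) + action h v t \<gamma>)"
  proof (rule INF_greatest)
    fix \<gamma> assume "\<gamma> \<in> {\<gamma>. abs_continuous_on 0 t \<gamma> \<and> \<gamma> t = to_torus X}"
    then have ac: "abs_continuous_on 0 t \<gamma>" and endpt: "\<gamma> t = to_torus X" by auto
    obtain Y g where g: "g absolutely_integrable_on {0..t}"
      and "\<forall>s\<in>{0..t}. \<gamma> s = to_torus (traj Y t g s)"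
      using abs_continuous_curve_control[OF ac assms] .
    then have \<gamma>: "\<gamma> s = to_torus (traj Y t g s)" if "s \<in> {0..t}" for s
      using that by blast
    have YX: "value_fn v \<phi> X t = value_fn v \<phi> Y t"
      using \<gamma>[of t] endpt assms by (intro value_fn_cong) simp
    have act: "action h v t \<gamma> = extended_integral {0..t} (running_cost v Y t g)"
      by (rule action_traj[OF g]) (rule \<gamma>)
    show "ereal (value_fn v \<phi> X t) \<le> ereal (\<phi> (\<gamma> 0)) + action h v t \<gamma>"
    proof (cases "running_cost v Y t g absolutely_integrable_on {0..t}")
      case True
      then have "admissible v Y 0 t g" using g by (simp add: admissible_def)
      from value_fn_le[OF assms this] show ?thesis
        using \<gamma>[of 0] assms by (simp add: act extended_integral_eq_integral[OF True] YX total_cost_def cost_def)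
    next
      case False
      obtain C where C: "\<And>X r g s. 0 \<le> s \<Longrightarrow> s \<le> t \<Longrightarrow> 0 * norm (g s) - C \<le> running_cost v X r g s"
        using running_cost_lower[of 0 t, OF order_refl] by blast
      have "extended_integral {0..t} (running_cost v Y t g) = \<infinity>"
        by (rule extended_integral_eq_infinity[OF measurable_running_cost[OF g] _ False, of C])
          (use C[of _ g Y t] in simp)
      then show ?thesis by (simp add: act)
    qed
  qed
  show "(INF \<gamma>\<in>{\<gamma>. abs_continuous_on 0 t \<gamma> \<and> \<gamma> t = to_torus X}. ereal (\<phi> (\<gamma> 0)) + action h v t \<gamma>)
    \<le> ereal (value_fn v \<phi> X t)"
  proof (rule ereal_le_epsilon2)
    fix e :: real assume "0 < e"
    then obtain g where adm: "admissible v X 0 t g" and le: "total_cost v \<phi> X t g < value_fn v \<phi> X t + e"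
      using value_fn_near by blast
    define \<gamma> where "\<gamma> s = to_torus (traj X t g s)" for s
    have g: "g absolutely_integrable_on {0..t}" and rc: "running_cost v X t g absolutely_integrable_on {0..t}"
      using adm by (auto simp: admissible_def)
    have "\<gamma> \<in> {\<gamma>. abs_continuous_on 0 t \<gamma> \<and> \<gamma> t = to_torus X}"
      using abs_continuous_on_traj[OF g, of X] by (simp add: \<gamma>_def[abs_def])
    then have "(INF \<gamma>\<in>{\<gamma>. abs_continuous_on 0 t \<gamma> \<and> \<gamma> t = to_torus X}. ereal (\<phi> (\<gamma> 0)) + action h v t \<gamma>)
      \<le> ereal (\<phi> (\<gamma> 0)) + action h v t \<gamma>" by (rule INF_lower)
    also have "\<dots> = ereal (total_cost v \<phi> X t g)"
      using action_traj[where g = g and t = t and \<gamma> = \<gamma> and X = X, OF g] extended_integral_eq_integral[OF rc]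
      by (simp add: \<gamma>_def total_cost_def cost_def)
    also have "\<dots> \<le> ereal (value_fn v \<phi> X t) + ereal e" using le by simp
    finally show "(INF \<gamma>\<in>{\<gamma>. abs_continuous_on 0 t \<gamma> \<and> \<gamma> t = to_torus X}. ereal (\<phi> (\<gamma> 0)) + action h v t \<gamma>)
      \<le> ereal (value_fn v \<phi> X t) + ereal e" .
  qed
qed

end

section \<open>Uniqueness\<close>

text \<open>Unlike the squared distance, this penalization is smooth on the whole torus, and its
  gradients in the two variables are still opposite.\<close>

lift_definition torus_pen :: "'n::finite torus \<Rightarrow> 'n torus \<Rightarrow> real"
  is "\<lambda>X Y. \<Sum>i\<in>UNIV. 1 - cos (2 * pi * (X $ i - Y $ i))"
proof -
  fix X X' Y Y' :: "real ^ 'n"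
  assume *: "torus_rel X X'" "torus_rel Y Y'"
  have "cos (2 * pi * (X $ i - Y $ i)) = cos (2 * pi * (X' $ i - Y' $ i))" for i
  proof -
    have "(X - X') $ i \<in> \<int>" "(Y - Y') $ i \<in> \<int>"
      using * unfolding torus_rel_def int_lattice_def by blast+
    then have "(X - X') $ i - (Y - Y') $ i \<in> \<int>" by (rule Ints_diff)
    then obtain n where n: "(X - X') $ i - (Y - Y') $ i = of_int n" by (auto elim: Ints_cases)
    have "2 * pi * (X $ i - Y $ i) = 2 * pi * (X' $ i - Y' $ i) + 2 * pi * of_int n"
      unfolding n[symmetric] by (simp add: algebra_simps)
    then show ?thesis by (simp add: cos_add)
  qed
  then show "(\<Sum>i\<in>UNIV. 1 - cos (2 * pi * (X $ i - Y $ i))) = (\<Sum>i\<in>UNIV. 1 - cos (2 * pi * (X' $ i - Y' $ i)))"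
    by simp
qed

lemma torus_pen_nonneg: "0 \<le> torus_pen x y"
  by transfer (simp add: sum_nonneg)

lemma torus_pen_self [simp]: "torus_pen x x = 0"
  by transfer simp

lemma torus_pen_eq_0D: "torus_pen x y = 0 \<Longrightarrow> x = y"
proof transfer
  fix X Y :: "real ^ 'a"
  assume "(\<Sum>i\<in>UNIV. 1 - cos (2 * pi * (X $ i - Y $ i))) = 0"
  then have *: "cos (2 * pi * (X $ i - Y $ i)) = 1" for i
    by (subst (asm) sum_nonneg_eq_0_iff) auto
  have "(X - Y) $ i \<in> \<int>" for i
  proof -
    obtain n :: int where "2 * pi * (X $ i - Y $ i) = of_int n * 2 * pi"
      using *[of i] cos_one_2pi_int by blast
    then have "X $ i - Y $ i = of_int n" by simp
    then show ?thesis by simp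
  qed
  then show "torus_rel X Y" by (simp add: torus_rel_def int_lattice_def)
qed

lemma torus_pen_to_torus:
  "torus_pen (to_torus X) (to_torus Y) = (\<Sum>i\<in>UNIV. 1 - cos (2 * pi * (X $ i - Y $ i)))"
  by transfer simp

lemma continuous_on_torus_pen: "continuous_on UNIV (\<lambda>(x, y). torus_pen x y :: real)"
proof -
  have "continuous_on (UNIV \<times> UNIV) (\<lambda>(x :: 'a torus, Y). torus_pen x (to_torus Y))"
    by (rule continuous_on_torus_Times)
      (simp add: torus_pen_to_torus case_prod_beta' continuous_intros)
  from continuous_on_compose2[OF this, of UNIV "\<lambda>z. (snd z, fst z)"]
  have "continuous_on (UNIV \<times> UNIV) (\<lambda>(Y, x :: 'a torus). torus_pen x (to_torus Y))"
    by (simp add: case_prod_beta' continuous_on_Pair continuous_on_fst continuous_on_snd)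
  then have "continuous_on (UNIV \<times> UNIV) (\<lambda>(y :: 'a torus, x). torus_pen x y)"
    by (intro continuous_on_torus_Times) (simp add: case_prod_beta')
  from continuous_on_compose2[OF this, of UNIV "\<lambda>z. (snd z, fst z)"]
  show ?thesis
    by (simp add: case_prod_beta' continuous_on_Pair continuous_on_fst continuous_on_snd)
qed

lemma tendsto_torus_pen [tendsto_intros]:
  assumes "(f \<longlongrightarrow> x) F" "(g \<longlongrightarrow> y) F"
  shows "((\<lambda>s. torus_pen (f s) (g s)) \<longlongrightarrow> torus_pen x y) F"
  using continuous_on_tendsto_compose[OF continuous_on_torus_pen tendsto_Pair[OF assms]] by simp

lemma continuous_on_torus_pen' [continuous_intros]:
  assumes "continuous_on S f" "continuous_on S g"
  shows "continuous_on S (\<lambda>s. torus_pen (f s) (g s))"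
  using assms unfolding continuous_on_def by (auto intro: tendsto_torus_pen)

definition pen_grad :: "real ^ 'n \<Rightarrow> real ^ 'n::finite" where
  "pen_grad Z = (\<chi> i. 2 * pi * sin (2 * pi * Z $ i))"

lemma continuous_on_pen_grad [continuous_intros]:
  fixes f :: "'b::metric_space \<Rightarrow> real ^ 'n::finite"
  shows "continuous_on S f \<Longrightarrow> continuous_on S (\<lambda>x. pen_grad (f x))"
  unfolding pen_grad_def by (intro continuous_on_vec_lambda continuous_intros)

lemma gderiv_torus_pen_fst:
  "GDERIV (\<lambda>Z. torus_pen (to_torus Z) (to_torus Y)) X :> pen_grad (X - Y)"
  unfolding torus_pen_to_torus gderiv_def
  by (auto intro!: derivative_eq_intros bounded_linear.has_derivative[OF bounded_linear_vec_nth]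
      simp: inner_vec_def pen_grad_def sum_distrib_left fun_eq_iff mult_ac)

lemma gderiv_torus_pen_snd:
  "GDERIV (\<lambda>Z. torus_pen (to_torus X) (to_torus Z)) Y :> - pen_grad (X - Y)"
  unfolding torus_pen_to_torus gderiv_def
  by (auto intro!: derivative_eq_intros bounded_linear.has_derivative[OF bounded_linear_vec_nth]
      simp: inner_vec_def pen_grad_def sum_negf sum_distrib_left fun_eq_iff mult_ac)

section \<open>Test functions with separated variables\<close>

lemma C1_near_separated:
  fixes A :: "'n::finite torus \<Rightarrow> real"
  assumes A: "\<And>Y. GDERIV (\<lambda>Y. A (to_torus Y)) Y :> G Y" and G: "continuous_on UNIV G"
    and B: "\<And>r. (B has_real_derivative g r) (at r)" and g: "continuous_on UNIV g"
  shows "C1_near z (\<lambda>(x, r). A x + B r)"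
  unfolding C1_near_def
proof (intro exI conjI)
  show "C1_on {(Y, s). (to_torus Y, s) \<in> UNIV} (\<lambda>(Y, s). (\<lambda>(x, r). A x + B r) (to_torus Y, s))"
    unfolding C1_on_def
  proof (intro exI conjI ballI)
    let ?f' = "\<lambda>z. blinfun_inner_left (G (fst z), g (snd z)) :: ((real ^ 'n) \<times> real) \<Rightarrow>\<^sub>L real"
    show "continuous_on {(Y, s). (to_torus Y, s) \<in> UNIV} ?f'"
      by (intro bounded_linear.continuous_on[OF bounded_linear_blinfun_inner_left] continuous_on_Pair
          continuous_on_compose2[OF G] continuous_on_compose2[OF g] continuous_intros) auto
    fix z :: "(real ^ 'n) \<times> real"
    have 1: "((\<lambda>z. A (to_torus (fst z))) has_derivative (\<lambda>h. G (fst z) \<bullet> fst h)) (at z)"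
      using has_derivative_compose[OF has_derivative_fst[OF has_derivative_ident] A[of "fst z", unfolded gderiv_def]]
      by (simp add: inner_commute)
    have 2: "((\<lambda>z. B (snd z)) has_derivative (\<lambda>h. g (snd z) * snd h)) (at z)"
      using has_derivative_compose[OF has_derivative_snd[OF has_derivative_ident] B[of "snd z", unfolded has_field_derivative_def]]
      by simp
    show "((\<lambda>(Y, s). (\<lambda>(x, r). A x + B r) (to_torus Y, s)) has_derivative blinfun_apply (?f' z)) (at z)"
      using has_derivative_add[OF 1 2]
      by (simp add: case_prod_beta' blinfun_inner_left.rep_eq inner_prod_def inner_commute mult.commute)
  qed
qed auto

lemma viscosity_subsolutionD:
  assumes "viscosity_subsolution H \<phi> u" "0 < t" "C1_near (to_torus X, t) \<psi>"
    and "\<forall>\<^sub>F z in nhds (to_torus X, t). u z $ i - \<psi> z \<le> u (to_torus X, t) $ i - \<psi> (to_torus X, t)"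
    and "GDERIV (\<lambda>Y. \<psi> (to_torus Y, t)) X :> q"
    and "((\<lambda>s. \<psi> (to_torus X, s)) has_real_derivative \<tau>) (at t)"
  shows "\<tau> + H i (to_torus X) q (u (to_torus X, t)) \<le> 0"
  using assms unfolding viscosity_subsolution_def by blast

lemma viscosity_supersolutionD:
  assumes "viscosity_supersolution H \<phi> u" "0 < t" "C1_near (to_torus X, t) \<psi>"
    and "\<forall>\<^sub>F z in nhds (to_torus X, t). u z $ i - \<psi> z \<ge> u (to_torus X, t) $ i - \<psi> (to_torus X, t)"
    and "GDERIV (\<lambda>Y. \<psi> (to_torus Y, t)) X :> q"
    and "((\<lambda>s. \<psi> (to_torus X, s)) has_real_derivative \<tau>) (at t)"
  shows "\<tau> + H i (to_torus X) q (u (to_torus X, t)) \<ge> 0"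
  using assms unfolding viscosity_supersolution_def by blast

lemma viscosity_subsolution_separated:
  fixes A :: "'n::finite torus \<Rightarrow> real"
  assumes "viscosity_subsolution H \<phi> u" "0 < t"
    and A: "\<And>Y. GDERIV (\<lambda>Y. A (to_torus Y)) Y :> G Y" and G: "continuous_on UNIV G"
    and B: "\<And>r. (B has_real_derivative g r) (at r)" and g: "continuous_on UNIV g"
    and max: "\<forall>\<^sub>F z in nhds (to_torus X, t).
        u z $ i - (A (fst z) + B (snd z)) \<le> u (to_torus X, t) $ i - (A (to_torus X) + B t)"
  shows "g t + H i (to_torus X) (G X) (u (to_torus X, t)) \<le> 0"
proof -
  have 1: "GDERIV (\<lambda>Y. A (to_torus Y) + B t) X :> G X"
    using GDERIV_add[OF A[of X] GDERIV_const[of "B t" X]] by simp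
  have 2: "((\<lambda>s. A (to_torus X) + B s) has_real_derivative g t) (at t)"
    using DERIV_add[OF DERIV_const[of "A (to_torus X)"] B[of t]] by simp
  show ?thesis
    by (rule viscosity_subsolutionD[OF assms(1,2) C1_near_separated[OF A G B g]])
      (use max 1 2 in \<open>simp_all add: case_prod_beta'\<close>)
qed

lemma viscosity_supersolution_separated:
  fixes A :: "'n::finite torus \<Rightarrow> real"
  assumes "viscosity_supersolution H \<phi> u" "0 < t"
    and A: "\<And>Y. GDERIV (\<lambda>Y. A (to_torus Y)) Y :> G Y" and G: "continuous_on UNIV G"
    and B: "\<And>r. (B has_real_derivative g r) (at r)" and g: "continuous_on UNIV g"
    and min: "\<forall>\<^sub>F z in nhds (to_torus X, t).
        u z $ i - (A (fst z) + B (snd z)) \<ge> u (to_torus X, t) $ i - (A (to_torus X) + B t)"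
  shows "g t + H i (to_torus X) (G X) (u (to_torus X, t)) \<ge> 0"
proof -
  have 1: "GDERIV (\<lambda>Y. A (to_torus Y) + B t) X :> G X"
    using GDERIV_add[OF A[of X] GDERIV_const[of "B t" X]] by simp
  have 2: "((\<lambda>s. A (to_torus X) + B s) has_real_derivative g t) (at t)"
    using DERIV_add[OF DERIV_const[of "A (to_torus X)"] B[of t]] by simp
  show ?thesis
    by (rule viscosity_supersolutionD[OF assms(1,2) C1_near_separated[OF A G B g]])
      (use min 1 2 in \<open>simp_all add: case_prod_beta'\<close>)
qed

section \<open>Comparison for the system\<close>

locale tonelli_system =
  fixes H :: "'m::finite \<Rightarrow> ('n::finite, 'm) hamiltonian" and \<Theta> :: real
  assumes tonelli: "\<And>i. tonelli (H i) \<Theta>"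
begin

sublocale tonelli "H i" \<Theta> for i
  by (rule tonelli)

text \<open>Freezing one half of the variables turns the penalization into a test function for the
  other half. Its derivatives in the two halves are opposite, and the second half enters with the
  opposite sign, so both inequalities share the momentum \<open>c *\<^sub>R pen_grad (X - Y)\<close>
  and the time slope \<open>(t - s) / \<delta>\<close>.\<close>

lemma doubling_max_point:
  assumes u: "viscosity_subsolution H \<phi> u" and v: "viscosity_supersolution H \<psi> v"
    and "0 < \<delta>" and "0 < c"
    and b: "\<And>r. (b has_real_derivative b' r) (at r)" "continuous_on UNIV b'"
    and t: "0 < t" "t < T" and s: "0 < s" "s < T"
    and max: "\<And>x' t' y' s'. t' \<in> {0..T} \<Longrightarrow> s' \<in> {0..T} \<Longrightarrow>
        u (x', t') $ i - v (y', s') $ i - b t' - c * torus_pen x' y' - (t' - s')\<^sup>2 / (2 * \<delta>)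
        \<le> u (x, t) $ i - v (y, s) $ i - b t - c * torus_pen x y - (t - s)\<^sup>2 / (2 * \<delta>)"
  shows "\<exists>p. b' t + (t - s) / \<delta> + H i x p (u (x, t)) \<le> 0 \<and> (t - s) / \<delta> + H i y p (v (y, s)) \<ge> 0"
proof -
  obtain X where X: "to_torus X = x" using to_torus_surj by blast
  obtain Y where Y: "to_torus Y = y" using to_torus_surj by blast
  have near: "\<forall>\<^sub>F z in nhds (z0, r). snd z \<in> {0..T}" if "0 < r" "r < T" for z0 :: "'n torus" and r
  proof -
    have "open (snd -` {0<..<T} :: ('n torus \<times> real) set)" by (intro open_vimage_snd) simp
    then have "\<forall>\<^sub>F z in nhds (z0, r). z \<in> snd -` {0<..<T}"
      using that by (intro eventually_nhds_in_open) auto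
    then show ?thesis by eventually_elim auto
  qed
  have "(b' t + (t - s) / \<delta>) + H i (to_torus X) (c *\<^sub>R pen_grad (X - Y)) (u (to_torus X, t)) \<le> 0"
  proof (rule viscosity_subsolution_separated[OF u, where A = "\<lambda>z. c * torus_pen z y"
        and B = "\<lambda>r. b r + (r - s)\<^sup>2 / (2 * \<delta>)" and g = "\<lambda>r. b' r + (r - s) / \<delta>" and G = "\<lambda>X. c *\<^sub>R pen_grad (X - Y)"])
    show "GDERIV (\<lambda>Z. c * torus_pen (to_torus Z) y) Z :> c *\<^sub>R pen_grad (Z - Y)" for Z
      using GDERIV_mult[OF GDERIV_const[of c Z] gderiv_torus_pen_fst[of Y Z]] by (simp add: Y)
    show "((\<lambda>r. b r + (r - s)\<^sup>2 / (2 * \<delta>)) has_real_derivative b' r + (r - s) / \<delta>) (at r)" for r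
      using \<open>0 < \<delta>\<close> by (auto intro!: derivative_eq_intros b(1) simp: field_simps)
    show "\<forall>\<^sub>F z in nhds (to_torus X, t).
        u z $ i - (c * torus_pen (fst z) y + (b (snd z) + (snd z - s)\<^sup>2 / (2 * \<delta>)))
        \<le> u (to_torus X, t) $ i - (c * torus_pen (to_torus X) y + (b t + (t - s)\<^sup>2 / (2 * \<delta>)))"
      using near[OF t, of "to_torus X"]
    proof eventually_elim
      case (elim z)
      then show ?case using max[of "snd z" s "fst z" y] s by (simp add: X)
    qed
  qed (use t b(2) \<open>0 < \<delta>\<close> in \<open>auto intro!: continuous_intros\<close>)
  moreover have "(t - s) / \<delta> + H i (to_torus Y) (c *\<^sub>R pen_grad (X - Y)) (v (to_torus Y, s)) \<ge> 0"
  proof (rule viscosity_supersolution_separated[OF v, where A = "\<lambda>z. - c * torus_pen x z"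
        and B = "\<lambda>r. - (t - r)\<^sup>2 / (2 * \<delta>)" and g = "\<lambda>r. (t - r) / \<delta>" and G = "\<lambda>Y. c *\<^sub>R pen_grad (X - Y)"])
    show "GDERIV (\<lambda>Z. - c * torus_pen x (to_torus Z)) Z :> c *\<^sub>R pen_grad (X - Z)" for Z
      using GDERIV_mult[OF GDERIV_const[of "- c" Z] gderiv_torus_pen_snd[of X Z]] by (simp add: X)
    show "((\<lambda>r. - (t - r)\<^sup>2 / (2 * \<delta>)) has_real_derivative (t - r) / \<delta>) (at r)" for r
      using \<open>0 < \<delta>\<close> by (auto intro!: derivative_eq_intros simp: field_simps)
    show "\<forall>\<^sub>F z in nhds (to_torus Y, s).
        v z $ i - (- c * torus_pen x (fst z) + - (t - snd z)\<^sup>2 / (2 * \<delta>))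
        \<ge> v (to_torus Y, s) $ i - (- c * torus_pen x (to_torus Y) + - (t - s)\<^sup>2 / (2 * \<delta>))"
      using near[OF s, of "to_torus Y"]
    proof eventually_elim
      case (elim z)
      then show ?case using max[of t "snd z" x "fst z"] t by (simp add: Y)
    qed
  qed (use s \<open>0 < \<delta>\<close> in \<open>auto intro!: continuous_intros\<close>)
  ultimately show ?thesis by (auto simp: X Y)
qed

text \<open>The space penalization is removed first, with the time penalization \<open>\<delta>\<close> fixed: then the
  time slopes at the maximum points stay bounded, hence by coercivity so do the momenta, and no
  modulus of continuity of the Hamiltonian uniform in the momentum is needed.\<close>

lemma doubling_limit_point:
  assumes u: "viscosity_subsolution H \<phi> u" and v: "viscosity_supersolution H \<psi> v"
    and "0 < \<delta>" and "0 < T"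
    and b: "\<And>r. (b has_real_derivative b' r) (at r)" "continuous_on UNIV b'"
    and t0: "t0 \<in> {0..T}" "u (x0, t0) $ i - v (x0, t0) $ i - b t0 \<ge> 0"
  shows "\<exists>x t s. t \<in> {0..T} \<and> s \<in> {0..T} \<and>
      0 \<le> u (x, t) $ i - v (x, s) $ i - b t - (t - s)\<^sup>2 / (2 * \<delta>) \<and>
      (t \<in> {0<..<T} \<longrightarrow> s \<in> {0<..<T} \<longrightarrow> b' t \<le> \<Theta> * infnorm (u (x, t) - v (x, s)))"
proof -
  define K where "K = (UNIV :: 'n torus set) \<times> {0..T}"
  have compK: "compact K" unfolding K_def by (intro compact_Times compact_UNIV_torus) simp
  have contu: "continuous_on K u" and contv: "continuous_on K v"
    using u v unfolding viscosity_subsolution_def viscosity_supersolution_def K_def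
    by (auto intro: continuous_on_subset)
  have contb: "continuous_on UNIV b"
    using b(1) by (intro continuous_at_imp_continuous_on ballI DERIV_isCont) blast
  define F where "F z w = u z $ i - v w $ i - b (snd z) - (snd z - snd w)\<^sup>2 / (2 * \<delta>)" for z w
  define \<Psi> where "\<Psi> k zw = F (fst zw) (snd zw) - real (Suc k) * torus_pen (fst (fst zw)) (fst (snd zw))"
    for k zw
  have contF: "continuous_on (K \<times> K) (\<lambda>zw. F (fst zw) (snd zw))"
    unfolding F_def using \<open>0 < \<delta>\<close>
    by (intro continuous_intros continuous_on_compose2[OF contu] continuous_on_compose2[OF contv]
        continuous_on_compose2[OF contb]) auto
  have "\<exists>zw\<in>K \<times> K. \<forall>zw'\<in>K \<times> K. \<Psi> k zw' \<le> \<Psi> k zw" for k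
  proof (rule continuous_attains_sup)
    show "compact (K \<times> K)" by (intro compact_Times compK)
    show "K \<times> K \<noteq> {}" using \<open>0 < T\<close> by (auto simp: K_def)
    show "continuous_on (K \<times> K) (\<Psi> k)" unfolding \<Psi>_def by (intro continuous_intros contF)
  qed
  then have "\<forall>k. \<exists>zw. zw \<in> K \<times> K \<and> (\<forall>zw'\<in>K \<times> K. \<Psi> k zw' \<le> \<Psi> k zw)" by blast
  from choice[OF this] obtain zw where zw: "\<And>k. zw k \<in> K \<times> K"
    "\<And>k zw'. zw' \<in> K \<times> K \<Longrightarrow> \<Psi> k zw' \<le> \<Psi> k (zw k)" by blast
  obtain l r where l: "l \<in> K \<times> K" and r: "strict_mono r" "(zw \<circ> r) \<longlonglongrightarrow> l"
    using compact_Times[OF compK compK] zw(1) unfolding compact_def by blast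
  obtain x t y s where l_eq: "l = ((x, t), (y, s))" by (metis surj_pair)
  have ts: "t \<in> {0..T}" "s \<in> {0..T}" using l by (auto simp: l_eq K_def)
  define x' t' y' s' where "x' k = fst (fst (zw k))" and "t' k = snd (fst (zw k))"
    and "y' k = fst (snd (zw k))" and "s' k = snd (snd (zw k))" for k
  have zw_eq: "zw k = ((x' k, t' k), (y' k, s' k))" for k
    by (simp add: x'_def t'_def y'_def s'_def)
  have ts': "t' k \<in> {0..T}" "s' k \<in> {0..T}" for k
    using zw(1)[of k] by (auto simp: zw_eq K_def)
  have lim: "(\<lambda>k. x' (r k)) \<longlonglongrightarrow> x" "(\<lambda>k. t' (r k)) \<longlonglongrightarrow> t" "(\<lambda>k. y' (r k)) \<longlonglongrightarrow> y" "(\<lambda>k. s' (r k)) \<longlonglongrightarrow> s"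
    using tendsto_fst[OF tendsto_fst[OF r(2)]] tendsto_snd[OF tendsto_fst[OF r(2)]]
      tendsto_fst[OF tendsto_snd[OF r(2)]] tendsto_snd[OF tendsto_snd[OF r(2)]]
    by (simp_all add: zw_eq l_eq)
  \<comment> \<open>On the diagonal both penalties vanish, so the maximum dominates the value at
    \<open>(x0, t0)\<close>, which is nonnegative by assumption.\<close>
  have pos: "0 \<le> \<Psi> k (zw k)" for k
  proof -
    have "0 \<le> \<Psi> k ((x0, t0), (x0, t0))" using t0(2) by (simp add: \<Psi>_def F_def)
    also have "\<dots> \<le> \<Psi> k (zw k)" using t0(1) by (intro zw(2)) (simp add: K_def)
    finally show ?thesis .
  qed
  have F_pos: "real (Suc k) * torus_pen (x' k) (y' k) \<le> F (x' k, t' k) (y' k, s' k)" for k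
    using pos[of k] by (simp add: \<Psi>_def zw_eq)
  obtain C where C: "\<And>zw. zw \<in> K \<times> K \<Longrightarrow> F (fst zw) (snd zw) \<le> C"
    using continuous_attains_sup[OF compact_Times[OF compK compK] _ contF] l by blast
  have F_lim: "(\<lambda>k. F (x' (r k), t' (r k)) (y' (r k), s' (r k))) \<longlonglongrightarrow> F (x, t) (y, s)"
    using continuous_on_tendsto_compose[OF contF r(2) l] zw(1) by (simp add: zw_eq l_eq)
  have "torus_pen x y \<le> 0"
  proof (rule tendsto_le[OF sequentially_bot])
    show "(\<lambda>k. C * inverse (real (Suc k))) \<longlonglongrightarrow> 0"
      using tendsto_mult_left[OF LIMSEQ_inverse_real_of_nat, of C] by simp
    show "(\<lambda>k. torus_pen (x' (r k)) (y' (r k))) \<longlonglongrightarrow> torus_pen x y" by (intro tendsto_intros lim)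
    show "\<forall>\<^sub>F k in sequentially. torus_pen (x' (r k)) (y' (r k)) \<le> C * inverse (real (Suc k))"
    proof (rule always_eventually, rule allI)
      fix k
      have "real (Suc k) * torus_pen (x' (r k)) (y' (r k)) \<le> real (Suc (r k)) * torus_pen (x' (r k)) (y' (r k))"
        using seq_suble[OF r(1), of k] torus_pen_nonneg by (intro mult_right_mono) auto
      also have "\<dots> \<le> C" using F_pos[of "r k"] C[OF zw(1)[of "r k"]] by (simp add: zw_eq)
      finally show "torus_pen (x' (r k)) (y' (r k)) \<le> C * inverse (real (Suc k))"
        by (simp add: field_simps)
    qed
  qed
  then have yx: "y = x" using torus_pen_eq_0D torus_pen_nonneg[of x y] by fastforce
  have "0 \<le> F (x, t) (y, s)"
  proof (rule tendsto_lowerbound[OF F_lim])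
    show "\<forall>\<^sub>F k in sequentially. 0 \<le> F (x' (r k), t' (r k)) (y' (r k), s' (r k))"
      by (intro always_eventually allI order_trans[OF _ F_pos] mult_nonneg_nonneg torus_pen_nonneg) simp
  qed simp
  then have F0: "0 \<le> u (x, t) $ i - v (x, s) $ i - b t - (t - s)\<^sup>2 / (2 * \<delta>)"
    by (simp add: F_def yx)
  have "b' t \<le> \<Theta> * infnorm (u (x, t) - v (x, s))" if int: "t \<in> {0<..<T}" "s \<in> {0<..<T}"
  proof -
    have "\<forall>\<^sub>F k in sequentially. t' (r k) \<in> {0<..<T}" "\<forall>\<^sub>F k in sequentially. s' (r k) \<in> {0<..<T}"
      using topological_tendstoD[OF lim(2) open_greaterThanLessThan int(1)]
        topological_tendstoD[OF lim(4) open_greaterThanLessThan int(2)] by auto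
    then have "\<forall>\<^sub>F k in sequentially. t' (r k) \<in> {0<..<T} \<and> s' (r k) \<in> {0<..<T}"
      by (rule eventually_conj)
    then obtain N where N: "\<And>k. N \<le> k \<Longrightarrow> t' (r k) \<in> {0<..<T} \<and> s' (r k) \<in> {0<..<T}"
      unfolding eventually_sequentially by blast
    \<comment> \<open>A tail of the subsequence along which all times are interior, so that both
      viscosity inequalities hold.\<close>
    define q where "q k = r (k + N)" for k
    have limq: "(\<lambda>k. x' (q k)) \<longlonglongrightarrow> x" "(\<lambda>k. t' (q k)) \<longlonglongrightarrow> t" "(\<lambda>k. y' (q k)) \<longlonglongrightarrow> y" "(\<lambda>k. s' (q k)) \<longlonglongrightarrow> s"
      using lim[THEN LIMSEQ_ignore_initial_segment[where k = N]] by (simp_all add: q_def)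
    have "\<exists>p. b' (t' k) + (t' k - s' k) / \<delta> + H i (x' k) p (u (x' k, t' k)) \<le> 0 \<and>
        (t' k - s' k) / \<delta> + H i (y' k) p (v (y' k, s' k)) \<ge> 0" if "k \<in> range q" for k
    proof (rule doubling_max_point[OF u v \<open>0 < \<delta>\<close> _ b, where c = "real (Suc k)" and T = T])
      show "0 < t' k" "t' k < T" "0 < s' k" "s' k < T" using that N by (auto simp: q_def)
      fix z1 t1 z2 t2 assume "t1 \<in> {0..T}" "t2 \<in> {0..T}"
      then have "((z1, t1), (z2, t2)) \<in> K \<times> K" by (simp add: K_def)
      from zw(2)[OF this, of k]
      show "u (z1, t1) $ i - v (z2, t2) $ i - b t1 - real (Suc k) * torus_pen z1 z2 - (t1 - t2)\<^sup>2 / (2 * \<delta>)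
        \<le> u (x' k, t' k) $ i - v (y' k, s' k) $ i - b (t' k) - real (Suc k) * torus_pen (x' k) (y' k)
            - (t' k - s' k)\<^sup>2 / (2 * \<delta>)"
        by (simp add: \<Psi>_def F_def zw_eq)
    qed simp
    then have "\<forall>j. \<exists>p. b' (t' (q j)) + (t' (q j) - s' (q j)) / \<delta> + H i (x' (q j)) p (u (x' (q j), t' (q j))) \<le> 0 \<and>
        (t' (q j) - s' (q j)) / \<delta> + H i (y' (q j)) p (v (y' (q j), s' (q j))) \<ge> 0"
      by blast
    from choice[OF this] obtain p where
      p1: "\<And>j. b' (t' (q j)) + (t' (q j) - s' (q j)) / \<delta> + H i (x' (q j)) (p j) (u (x' (q j), t' (q j))) \<le> 0" and
      p2: "\<And>j. (t' (q j) - s' (q j)) / \<delta> + H i (y' (q j)) (p j) (v (y' (q j), s' (q j))) \<ge> 0"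
      by blast
    obtain C1 where C1: "\<And>x p u. 1 * norm p - C1 - \<Theta> * infnorm u \<le> H i x p u"
      using hamiltonian_superlinear[of 1 i] by auto
    have "bounded (u ` K)" by (intro compact_imp_bounded compact_continuous_image contu compK)
    then obtain Bu where Bu: "\<And>z. z \<in> K \<Longrightarrow> norm (u z) \<le> Bu" unfolding bounded_iff by blast
    have "bounded (b' ` {0..T})"
      by (intro compact_imp_bounded compact_continuous_image continuous_on_subset[OF b(2)]) auto
    then obtain Bb where Bb: "\<And>r. r \<in> {0..T} \<Longrightarrow> \<bar>b' r\<bar> \<le> Bb" unfolding bounded_iff by fastforce
    \<comment> \<open>The subsolution inequality bounds the Hamiltonian at \<open>p j\<close> from
      above, as the time slope is at least \<open>- (T / \<delta>)\<close>; coercivity with slope 1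
      turns this into a bound on \<open>p j\<close>.\<close>
    have "norm (p j) \<le> C1 + \<Theta> * Bu + Bb + T / \<delta>" for j
    proof -
      have "infnorm (u (x' (q j), t' (q j))) \<le> Bu"
        by (rule order_trans[OF infnorm_le_norm Bu]) (use ts'(1)[of "q j"] in \<open>simp add: K_def\<close>)
      then have "\<Theta> * infnorm (u (x' (q j), t' (q j))) \<le> \<Theta> * Bu"
        using \<Theta>_pos by (intro mult_left_mono) auto
      moreover have "- (T / \<delta>) \<le> (t' (q j) - s' (q j)) / \<delta>"
        using ts'[of "q j"] divide_right_mono[of "- T" "t' (q j) - s' (q j)" \<delta>] \<open>0 < \<delta>\<close> by simp
      ultimately show ?thesis
        using p1[of j] C1[of "p j" "u (x' (q j), t' (q j))" "x' (q j)"] Bb[OF ts'(1)[of "q j"]] by linarith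
    qed
    then have "p j \<in> cball 0 (C1 + \<Theta> * Bu + Bb + T / \<delta>)" for j by simp
    then obtain p0 w where w: "strict_mono w" "(p \<circ> w) \<longlonglongrightarrow> p0"
      using compact_cball[of 0 "C1 + \<Theta> * Bu + Bb + T / \<delta>"] unfolding compact_def by blast
    have limw: "(\<lambda>k. x' (q (w k))) \<longlonglongrightarrow> x" "(\<lambda>k. t' (q (w k))) \<longlonglongrightarrow> t"
        "(\<lambda>k. y' (q (w k))) \<longlonglongrightarrow> y" "(\<lambda>k. s' (q (w k))) \<longlonglongrightarrow> s" "(\<lambda>k. p (w k)) \<longlonglongrightarrow> p0"
      using limq[THEN LIMSEQ_subseq_LIMSEQ[OF _ w(1)]] w(2) by (simp_all add: o_def)
    have ulim: "(\<lambda>k. u (x' (q (w k)), t' (q (w k)))) \<longlonglongrightarrow> u (x, t)"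
      by (rule continuous_on_tendsto_compose[OF contu tendsto_Pair[OF limw(1,2)]])
        (use ts ts' in \<open>auto simp: K_def\<close>)
    have vlim: "(\<lambda>k. v (y' (q (w k)), s' (q (w k)))) \<longlonglongrightarrow> v (y, s)"
      by (rule continuous_on_tendsto_compose[OF contv tendsto_Pair[OF limw(3,4)]])
        (use ts ts' in \<open>auto simp: K_def\<close>)
    have blim: "(\<lambda>k. b' (t' (q (w k)))) \<longlonglongrightarrow> b' t"
      by (rule continuous_on_tendsto_compose[OF b(2) limw(2)]) auto
    \<comment> \<open>Subtracting the two inequalities cancels the common time slope. In the limit
      the base points agree as well as the momenta, which leaves a difference in the value argument
      only.\<close>
    have "b' t \<le> H i y p0 (v (y, s)) - H i x p0 (u (x, t))"
    proof (rule tendsto_le[OF sequentially_bot])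
      show "(\<lambda>k. H i (y' (q (w k))) (p (w k)) (v (y' (q (w k)), s' (q (w k))))
          - H i (x' (q (w k))) (p (w k)) (u (x' (q (w k)), t' (q (w k)))))
        \<longlonglongrightarrow> H i y p0 (v (y, s)) - H i x p0 (u (x, t))"
        by (intro tendsto_diff tendsto_hamiltonian limw ulim vlim)
      show "\<forall>\<^sub>F k in sequentially. b' (t' (q (w k))) \<le> H i (y' (q (w k))) (p (w k)) (v (y' (q (w k)), s' (q (w k))))
          - H i (x' (q (w k))) (p (w k)) (u (x' (q (w k)), t' (q (w k))))"
        using p1 p2 by (intro always_eventually allI) (smt (verit))
    qed (rule blim)
    also have "\<dots> \<le> \<Theta> * infnorm (v (x, s) - u (x, t))"
      using lip[of i x p0 "v (x, s)" "u (x, t)"] by (simp add: yx)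
    finally show ?thesis by (simp add: infnorm_sub)
  qed
  then show ?thesis using ts F0 by blast
qed

lemma infnorm_attained:
  fixes x :: "real ^ 'k"
  obtains i where "infnorm x = \<bar>x $ i\<bar>"
proof -
  have "infnorm x \<in> (\<lambda>i. \<bar>x \<bullet> i\<bar>) ` Basis"
    unfolding infnorm_Max by (intro Max_in) auto
  then show ?thesis using that by (auto simp: Basis_vec_def inner_axis)
qed

lemma component_le_infnorm: "\<bar>x $ i\<bar> \<le> infnorm (x :: real ^ 'k)"
  by (metis Basis_le_infnorm axis_in_Basis_iff cart_eq_inner_axis Basis_real_def insertI1)

text \<open>The time penalization is removed by letting \<delta> run through
  \<open>inverse (real (Suc k))\<close>. The limit is a single point where component
  \<open>i\<close> of the difference touches the barrier \<open>b\<close>. The initial data exclude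
  time 0 and \<open>lt\<close> excludes time \<open>T\<close>; in between, \<kappa> times the
  barrier is at most \<Theta> times the largest component, hence at most \<Theta> times the
  barrier.\<close>

lemma comparison_contact:
  assumes u: "viscosity_solution H \<phi> u" and v: "viscosity_solution H \<phi> v"
    and "0 < \<epsilon>" "\<Theta> < \<kappa>" "0 < T"
    and le: "\<And>x t. t \<in> {0..T} \<Longrightarrow> infnorm (u (x, t) - v (x, t)) \<le> \<epsilon> * exp (\<kappa> * t)"
    and lt: "\<And>x. infnorm (u (x, T) - v (x, T)) < \<epsilon> * exp (\<kappa> * T)"
    and t0: "t0 \<in> {0..T}" "\<epsilon> * exp (\<kappa> * t0) \<le> u (x0, t0) $ i - v (x0, t0) $ i"
  shows False
proof -
  define b where "b t = \<epsilon> * exp (\<kappa> * t)" for t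
  have b': "(b has_real_derivative \<kappa> * b r) (at r)" for r
    unfolding b_def by (auto intro!: derivative_eq_intros)
  have contb: "continuous_on S b" for S unfolding b_def by (intro continuous_intros)
  have bpos: "b t > 0" for t using \<open>0 < \<epsilon>\<close> by (simp add: b_def)
  have sub: "viscosity_subsolution H \<phi> u" and sup: "viscosity_supersolution H \<phi> v"
    using u v by (auto simp: viscosity_solution_def)
  define K where "K = (UNIV :: 'n torus set) \<times> {0..T}"
  have compK: "compact K" unfolding K_def by (intro compact_Times compact_UNIV_torus) simp
  have contu: "continuous_on K u" and contv: "continuous_on K v"
    using sub sup unfolding viscosity_subsolution_def viscosity_supersolution_def K_def
    by (auto intro: continuous_on_subset)
  have t0': "u (x0, t0) $ i - v (x0, t0) $ i - b t0 \<ge> 0" using t0(2) by (simp add: b_def)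
  define P where "P k x t s \<longleftrightarrow> t \<in> {0..T} \<and> s \<in> {0..T} \<and>
      0 \<le> u (x, t) $ i - v (x, s) $ i - b t - (t - s)\<^sup>2 / (2 * inverse (real (Suc k))) \<and>
      (t \<in> {0<..<T} \<longrightarrow> s \<in> {0<..<T} \<longrightarrow> \<kappa> * b t \<le> \<Theta> * infnorm (u (x, t) - v (x, s)))" for k x t s
  have "\<exists>z. P k (fst z) (fst (snd z)) (snd (snd z))" for k
  proof -
    have "inverse (real (Suc k)) > 0" by simp
    moreover have "continuous_on UNIV (\<lambda>r. \<kappa> * b r)" by (intro continuous_intros contb)
    ultimately obtain x t s where "P k x t s"
      using doubling_limit_point[OF sub sup _ \<open>0 < T\<close> b' _ t0(1) t0'] unfolding P_def by blast
    then show ?thesis by (intro exI[of _ "(x, t, s)"]) simp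
  qed
  then have "\<forall>k. \<exists>z. P k (fst z) (fst (snd z)) (snd (snd z))" ..
  from choice[OF this] obtain z where z: "\<And>k. P k (fst (z k)) (fst (snd (z k))) (snd (snd (z k)))" by blast
  define x' t' s' where "x' k = fst (z k)" and "t' k = fst (snd (z k))" and "s' k = snd (snd (z k))" for k
  have z': "t' k \<in> {0..T}" "s' k \<in> {0..T}"
    "0 \<le> u (x' k, t' k) $ i - v (x' k, s' k) $ i - b (t' k) - (t' k - s' k)\<^sup>2 / (2 * inverse (real (Suc k)))"
    "t' k \<in> {0<..<T} \<longrightarrow> s' k \<in> {0<..<T} \<longrightarrow> \<kappa> * b (t' k) \<le> \<Theta> * infnorm (u (x' k, t' k) - v (x' k, s' k))" for k
    using z[of k] unfolding P_def x'_def t'_def s'_def by blast+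
  have "z k \<in> UNIV \<times> ({0..T} \<times> {0..T})" for k using z'(1,2)[of k] by (auto simp: mem_Times_iff t'_def s'_def)
  moreover have "compact ((UNIV :: 'n torus set) \<times> ({0..T} \<times> {0..T}))"
    by (intro compact_Times compact_UNIV_torus) auto
  ultimately obtain l r where l: "l \<in> UNIV \<times> ({0..T} \<times> {0..T})" and r: "strict_mono r" "(z \<circ> r) \<longlonglongrightarrow> l"
    unfolding compact_def by blast
  obtain x t s where l_eq: "l = (x, t, s)" by (metis surj_pair)
  have ts: "t \<in> {0..T}" "s \<in> {0..T}" using l by (auto simp: l_eq)
  have lim: "(\<lambda>k. x' (r k)) \<longlonglongrightarrow> x" "(\<lambda>k. t' (r k)) \<longlonglongrightarrow> t" "(\<lambda>k. s' (r k)) \<longlonglongrightarrow> s"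
    using tendsto_fst[OF r(2)] tendsto_fst[OF tendsto_snd[OF r(2)]] tendsto_snd[OF tendsto_snd[OF r(2)]]
    by (simp_all add: l_eq x'_def t'_def s'_def)
  have ulim: "(\<lambda>k. u (x' (r k), t' (r k))) \<longlonglongrightarrow> u (x, t)"
    by (rule continuous_on_tendsto_compose[OF contu tendsto_Pair[OF lim(1,2)]])
      (use ts z' in \<open>auto simp: K_def\<close>)
  have vlim: "(\<lambda>k. v (x' (r k), s' (r k))) \<longlonglongrightarrow> v (x, s)"
    by (rule continuous_on_tendsto_compose[OF contv tendsto_Pair[OF lim(1,3)]])
      (use ts z' in \<open>auto simp: K_def\<close>)
  have blim: "(\<lambda>k. b (t' (r k))) \<longlonglongrightarrow> b t"
    by (rule continuous_on_tendsto_compose[OF contb[of UNIV] lim(2)]) auto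
  have Glim: "(\<lambda>k. u (x' (r k), t' (r k)) $ i - v (x' (r k), s' (r k)) $ i - b (t' (r k)))
      \<longlonglongrightarrow> u (x, t) $ i - v (x, s) $ i - b t"
    by (intro tendsto_diff tendsto_vec_nth ulim vlim blim)
  have G: "(t' k - s' k)\<^sup>2 * real (Suc k) \<le> 2 * (u (x' k, t' k) $ i - v (x' k, s' k) $ i - b (t' k))" for k
    using z'(3)[of k] by (simp add: field_simps)
  have "(t - s)\<^sup>2 \<le> 0"
  proof (rule tendsto_le[OF sequentially_bot])
    show "(\<lambda>k. 2 * (u (x' (r k), t' (r k)) $ i - v (x' (r k), s' (r k)) $ i - b (t' (r k))) * inverse (real (Suc k))) \<longlonglongrightarrow> 0"
      using tendsto_mult[OF tendsto_mult_left[OF Glim, of 2] LIMSEQ_inverse_real_of_nat] by simp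
    show "(\<lambda>k. (t' (r k) - s' (r k))\<^sup>2) \<longlonglongrightarrow> (t - s)\<^sup>2" by (intro tendsto_intros lim)
    show "\<forall>\<^sub>F k in sequentially. (t' (r k) - s' (r k))\<^sup>2
        \<le> 2 * (u (x' (r k), t' (r k)) $ i - v (x' (r k), s' (r k)) $ i - b (t' (r k))) * inverse (real (Suc k))"
    proof (rule always_eventually, rule allI)
      fix k
      have "(t' (r k) - s' (r k))\<^sup>2 * real (Suc k) \<le> (t' (r k) - s' (r k))\<^sup>2 * real (Suc (r k))"
        using seq_suble[OF r(1), of k] by (intro mult_left_mono) auto
      also have "\<dots> \<le> 2 * (u (x' (r k), t' (r k)) $ i - v (x' (r k), s' (r k)) $ i - b (t' (r k)))"
        by (rule G)
      finally show "(t' (r k) - s' (r k))\<^sup>2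
        \<le> 2 * (u (x' (r k), t' (r k)) $ i - v (x' (r k), s' (r k)) $ i - b (t' (r k))) * inverse (real (Suc k))"
        by (simp add: field_simps)
    qed
  qed
  then have st: "s = t" by simp
  have "0 \<le> u (x, t) $ i - v (x, s) $ i - b t"
  proof (rule tendsto_lowerbound[OF Glim])
    have "0 \<le> u (x' k, t' k) $ i - v (x' k, s' k) $ i - b (t' k)" for k
    proof -
      have "0 \<le> (t' k - s' k)\<^sup>2 * real (Suc k)" by simp
      from order_trans[OF this G[of k]] show ?thesis by simp
    qed
    then show "\<forall>\<^sub>F k in sequentially. 0 \<le> u (x' (r k), t' (r k)) $ i - v (x' (r k), s' (r k)) $ i - b (t' (r k))"
      by simp
  qed simp
  then have contact: "b t \<le> u (x, t) $ i - v (x, t) $ i" by (simp add: st)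
  have "t \<noteq> 0"
  proof
    assume "t = 0"
    have "u (x, 0) $ i \<le> \<phi> x $ i" "\<phi> x $ i \<le> v (x, 0) $ i"
      using sub sup unfolding viscosity_subsolution_def viscosity_supersolution_def by auto
    then show False using contact bpos[of 0] \<open>t = 0\<close> by simp
  qed
  moreover have "t \<noteq> T"
  proof
    assume "t = T"
    have "u (x, T) $ i - v (x, T) $ i \<le> infnorm (u (x, T) - v (x, T))"
      using component_le_infnorm[of "u (x, T) - v (x, T)" i] by simp
    also have "\<dots> < b T" using lt by (simp add: b_def)
    finally show False using contact \<open>t = T\<close> by simp
  qed
  ultimately have int: "t \<in> {0<..<T}" using ts by auto
  have "\<forall>\<^sub>F k in sequentially. t' (r k) \<in> {0<..<T}" "\<forall>\<^sub>F k in sequentially. s' (r k) \<in> {0<..<T}"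
    using topological_tendstoD[OF lim(2) open_greaterThanLessThan int]
      topological_tendstoD[OF lim(3) open_greaterThanLessThan, of 0 T] int by (auto simp: st)
  then have ev: "\<forall>\<^sub>F k in sequentially. \<kappa> * b (t' (r k)) \<le> \<Theta> * infnorm (u (x' (r k), t' (r k)) - v (x' (r k), s' (r k)))"
    by eventually_elim (use z'(4) in blast)
  have "\<kappa> * b t \<le> \<Theta> * infnorm (u (x, t) - v (x, s))"
    by (rule tendsto_le[OF sequentially_bot _ _ ev]) (intro tendsto_intros tendsto_infnorm blim ulim vlim)+
  also have "\<dots> \<le> \<Theta> * b t"
    using le[OF ts(1), of x] \<Theta>_pos by (intro mult_left_mono) (auto simp: b_def st)
  finally show False using \<open>\<Theta> < \<kappa>\<close> bpos[of t] by (simp add: mult_le_cancel_right)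
qed

theorem viscosity_solution_unique:
  assumes u: "viscosity_solution H \<phi> u" and v: "viscosity_solution H \<phi> v" and "0 \<le> t1"
  shows "u (x1, t1) = v (x1, t1)"
proof (rule ccontr)
  assume neq: "u (x1, t1) \<noteq> v (x1, t1)"
  define T where "T = t1 + 1"
  define K where "K = (UNIV :: 'n torus set) \<times> {0..T}"
  have "0 < T" using \<open>0 \<le> t1\<close> by (simp add: T_def)
  have compK: "compact K" unfolding K_def by (intro compact_Times compact_UNIV_torus) simp
  have contu: "continuous_on K u" and contv: "continuous_on K v"
    using u v unfolding viscosity_solution_def viscosity_subsolution_def viscosity_supersolution_def K_def
    by (auto intro: continuous_on_subset)
  define N where "N z = infnorm (u z - v z)" for z
  have contN: "continuous_on K N"
    using contu contv unfolding N_def continuous_on_def by (auto intro!: tendsto_infnorm tendsto_diff)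
  have inK: "(x1, t1) \<in> K" using \<open>0 \<le> t1\<close> by (simp add: K_def T_def)
  obtain m where m: "\<And>z. z \<in> K \<Longrightarrow> N z \<le> m"
    using continuous_attains_sup[OF compK _ contN] inK by blast
  define a where "a = N (x1, t1)"
  have "a > 0" using neq by (simp add: a_def N_def infnorm_pos_lt)
  \<comment> \<open>The entry \<open>m / a\<close> yields \<open>m < a * exp \<kappa>\<close>. As
    \<open>T = t1 + 1\<close>, the weighted difference at time \<open>T\<close> is then smaller than
    at \<open>(x1, t1)\<close>, and the maximum is not attained at the final time.\<close>
  define \<kappa> where "\<kappa> = max (\<Theta> + 1) (m / a)"
  have "\<Theta> < \<kappa>" by (simp add: \<kappa>_def)
  have "m < a * exp \<kappa>"
  proof -
    have "m / a \<le> \<kappa>" by (simp add: \<kappa>_def)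
    also have "\<kappa> < exp \<kappa>" using exp_ge_add_one_self[of \<kappa>] by linarith
    finally show ?thesis using \<open>a > 0\<close> by (simp add: pos_divide_less_eq mult.commute)
  qed
  have "continuous_on K (\<lambda>z. exp (- \<kappa> * snd z) * N z)" by (intro continuous_intros contN)
  moreover have "K \<noteq> {}" using inK by blast
  ultimately obtain z0 where z0: "z0 \<in> K" and
    z0_max: "\<And>z. z \<in> K \<Longrightarrow> exp (- \<kappa> * snd z) * N z \<le> exp (- \<kappa> * snd z0) * N z0"
    using continuous_attains_sup[OF compK] by blast
  \<comment> \<open>\<epsilon> is the maximum of the weighted difference, so the barrier
    \<open>\<epsilon> * exp (\<kappa> * t)\<close> lies above the difference and touches it at
    \<open>z0\<close>.\<close>
  define \<epsilon> where "\<epsilon> = exp (- \<kappa> * snd z0) * N z0"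
  have a_le: "exp (- \<kappa> * t1) * a \<le> \<epsilon>" using z0_max[OF inK] by (simp add: a_def \<epsilon>_def)
  moreover have "0 < exp (- \<kappa> * t1) * a" using \<open>a > 0\<close> by simp
  ultimately have "\<epsilon> > 0" by linarith
  have le: "infnorm (u (x, t) - v (x, t)) \<le> \<epsilon> * exp (\<kappa> * t)" if "t \<in> {0..T}" for x t
  proof -
    have "exp (- \<kappa> * t) * N (x, t) * exp (\<kappa> * t) \<le> \<epsilon> * exp (\<kappa> * t)"
      using z0_max[of "(x, t)"] that by (intro mult_right_mono) (auto simp: K_def \<epsilon>_def)
    moreover have "exp (- \<kappa> * t) * N (x, t) * exp (\<kappa> * t) = N (x, t)"
      by (simp add: exp_minus)
    ultimately show ?thesis by (simp only: N_def)
  qed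
  have lt: "infnorm (u (x, T) - v (x, T)) < \<epsilon> * exp (\<kappa> * T)" for x
  proof -
    have "infnorm (u (x, T) - v (x, T)) \<le> m"
      using m[of "(x, T)"] \<open>0 < T\<close> by (simp add: K_def N_def)
    also have "m < a * exp \<kappa>" by fact
    also have "a * exp \<kappa> = exp (- \<kappa> * t1) * a * exp (\<kappa> * T)"
      by (simp add: T_def distrib_left exp_add exp_minus)
    also have "\<dots> \<le> \<epsilon> * exp (\<kappa> * T)" using a_le by (intro mult_right_mono) auto
    finally show ?thesis .
  qed
  obtain x0 t0 where z0_eq: "z0 = (x0, t0)" by (cases z0)
  have t0: "t0 \<in> {0..T}" using z0 by (simp add: z0_eq K_def)
  have eq: "infnorm (u (x0, t0) - v (x0, t0)) = \<epsilon> * exp (\<kappa> * t0)"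
    by (simp add: \<epsilon>_def z0_eq N_def exp_minus)
  obtain i where "infnorm (u (x0, t0) - v (x0, t0)) = \<bar>(u (x0, t0) - v (x0, t0)) $ i\<bar>"
    using infnorm_attained .
  \<comment> \<open>The sign of the extremal component decides which of the two solutions acts as
    the subsolution.\<close>
  then consider "\<epsilon> * exp (\<kappa> * t0) \<le> u (x0, t0) $ i - v (x0, t0) $ i" |
      "\<epsilon> * exp (\<kappa> * t0) \<le> v (x0, t0) $ i - u (x0, t0) $ i"
    using eq by (auto simp: abs_if split: if_splits)
  then show False
  proof cases
    case 1
    then show ?thesis
      using comparison_contact[OF u v \<open>\<epsilon> > 0\<close> \<open>\<Theta> < \<kappa>\<close> \<open>0 < T\<close> le lt t0] by blast
  next
    case 2
    then show ?thesis
      using comparison_contact[OF v u \<open>\<epsilon> > 0\<close> \<open>\<Theta> < \<kappa>\<close> \<open>0 < T\<close> _ _ t0] le lt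
      by (simp add: infnorm_sub)
  qed
qed

end

section \<open>Existence\<close>

text \<open>A joint derivative exists because \<psi> is continuously differentiable near the point;
  being linear, it is determined by the partial derivatives \<open>q\<close> and \<tau>.\<close>

lemma C1_near_has_derivative:
  assumes "C1_near (to_torus X, t) \<psi>" and q: "GDERIV (\<lambda>Y. \<psi> (to_torus Y, t)) X :> q"
    and \<tau>: "((\<lambda>s. \<psi> (to_torus X, s)) has_real_derivative \<tau>) (at t)"
  shows "((\<lambda>(Y, s). \<psi> (to_torus Y, s)) has_derivative (\<lambda>(W, r). q \<bullet> W + \<tau> * r)) (at (X, t))"
proof -
  define F where "F = (\<lambda>(Y, s). \<psi> (to_torus Y, s))"
  obtain D where D: "(F has_derivative D) (at (X, t))"
    using assms(1) unfolding C1_near_def C1_on_def F_def by fastforce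
  have "((\<lambda>Y. (Y, t)) has_derivative (\<lambda>W. (W, 0))) (at X)" by (auto intro!: derivative_eq_intros)
  from has_derivative_compose[OF this D]
  have "((\<lambda>Y. F (Y, t)) has_derivative (\<lambda>W. D (W, 0))) (at X)" .
  then have 1: "(\<lambda>W. D (W, 0)) = (\<lambda>W. W \<bullet> q)"
    using q unfolding gderiv_def F_def by (auto intro: has_derivative_unique)
  have "((\<lambda>s. (X, s)) has_derivative (\<lambda>r. (0, r))) (at t)" by (auto intro!: derivative_eq_intros)
  from has_derivative_compose[OF this D]
  have "((\<lambda>s. F (X, s)) has_derivative (\<lambda>r. D (0, r))) (at t)" .
  then have 2: "(\<lambda>r. D (0, r)) = (*) \<tau>"
    using \<tau> unfolding has_field_derivative_def F_def by (auto intro: has_derivative_unique)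
  have "D (W, r) = q \<bullet> W + \<tau> * r" for W r
  proof -
    have "D (W, r) = D ((W, 0) + (0, r))" by simp
    also have "\<dots> = D (W, 0) + D (0, r)" by (rule linear_add[OF has_derivative_linear[OF D]])
    finally show ?thesis using fun_cong[OF 1, of W] fun_cong[OF 2, of r] by (simp add: inner_commute)
  qed
  then have "D = (\<lambda>(W, r). q \<bullet> W + \<tau> * r)" by auto
  with D show ?thesis by (simp add: F_def)
qed

definition torus_rep :: "'n::finite torus \<Rightarrow> real ^ 'n" where
  "torus_rep x = (SOME X. to_torus X = x)"

lemma to_torus_rep [simp]: "to_torus (torus_rep x) = x"
  unfolding torus_rep_def by (rule someI_ex[OF to_torus_surj])

context tonelli_value
begin

text \<open>Negative times are sent to 0, so that the function is continuous on the whole type, the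
  domain of a bounded continuous function.\<close>

lemma continuous_on_value_fn:
  "continuous_on UNIV (\<lambda>z. value_fn v \<phi> (torus_rep (fst z)) (max 0 (snd z)))"
  unfolding continuous_on_iff
proof (intro ballI allI impI)
  fix z :: "'n torus \<times> real" and e :: real assume "0 < e"
  obtain x t where z: "z = (x, t)" by (cases z)
  define T where "T = max 0 t + 1"
  have "0 \<le> T" by (simp add: T_def)
  obtain d where "d > 0" and d: "\<And>X Y t s. 0 \<le> t \<Longrightarrow> t \<le> T \<Longrightarrow> 0 \<le> s \<Longrightarrow> s \<le> T \<Longrightarrow> norm (X - Y) < d \<Longrightarrow> \<bar>t - s\<bar> < d \<Longrightarrow>
      \<bar>value_fn v \<phi> X t - value_fn v \<phi> Y s\<bar> < e"
    using value_fn_uniformly_continuous[OF \<open>0 < e\<close> \<open>0 \<le> T\<close>] by blast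
  show "\<exists>d>0. \<forall>z'\<in>UNIV. dist z' z < d \<longrightarrow>
      dist (value_fn v \<phi> (torus_rep (fst z')) (max 0 (snd z'))) (value_fn v \<phi> (torus_rep (fst z)) (max 0 (snd z))) < e"
  proof (intro exI conjI ballI impI)
    show "0 < min d 1" using \<open>d > 0\<close> by simp
    fix z' :: "'n torus \<times> real" assume near: "dist z' z < min d 1"
    obtain y s where z': "z' = (y, s)" by (cases z')
    have yx: "dist y x < min d 1" and st: "dist s t < min d 1"
      using near dist_fst_le[of z' z] dist_snd_le[of z' z] by (auto simp: z z')
    \<comment> \<open>\<open>torus_rep\<close> need not be continuous, but the value depends on the
      torus point alone, so a representative close to \<open>torus_rep x\<close> may replace
      \<open>torus_rep y\<close>.\<close>
    obtain Y where Y: "to_torus Y = y" "dist Y (torus_rep x) = dist y x"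
      using to_torus_lift[of y "torus_rep x"] by auto
    have "value_fn v \<phi> (torus_rep y) (max 0 s) = value_fn v \<phi> Y (max 0 s)"
      by (rule value_fn_cong) (simp add: Y)
    moreover have "\<bar>value_fn v \<phi> Y (max 0 s) - value_fn v \<phi> (torus_rep x) (max 0 t)\<bar> < e"
    proof (rule d)
      show "norm (Y - torus_rep x) < d" using Y(2) yx by (simp add: dist_norm)
      show "\<bar>max 0 s - max 0 t\<bar> < d" "max 0 s \<le> T" using st by (auto simp: dist_real_def T_def)
    qed (auto simp: T_def)
    ultimately show "dist (value_fn v \<phi> (torus_rep (fst z')) (max 0 (snd z')))
        (value_fn v \<phi> (torus_rep (fst z)) (max 0 (snd z))) < e"
      by (simp add: z z' dist_real_def)
  qed
qed

end

section \<open>The fixed point of the value operator\<close>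

locale tonelli_cauchy = tonelli_system H \<Theta>
  for H :: "'m::finite \<Rightarrow> ('n::finite, 'm) hamiltonian" and \<Theta> +
  fixes \<phi> :: "'n torus \<Rightarrow> real ^ 'm"
  assumes cont_\<phi>: "continuous_on UNIV \<phi>"
begin

lemma tonelli_valueI: "continuous_on UNIV v \<Longrightarrow> tonelli_value (H i) \<Theta> v (\<lambda>x. \<phi> x $ i)"
  using tonelli cont_\<phi> by (intro tonelli_value.intro tonelli_value_axioms.intro continuous_on_component) auto

abbreviation component_value :: "'m \<Rightarrow> ('n torus \<times> real \<Rightarrow> real ^ 'm) \<Rightarrow> real ^ 'n \<Rightarrow> real \<Rightarrow> real" where
  "component_value i v \<equiv> tonelli.value_fn (H i) v (\<lambda>x. \<phi> x $ i)"

text \<open>Distances of bounded continuous functions are suprema of Euclidean distances, estimated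
  here by sums over components. One component contributes the factor \<Theta> / \<open>rate\<close>,
  so all \<open>CARD('m)\<close> of them together contract by 1/2.\<close>

definition rate :: real where
  "rate = 2 * real CARD('m) * \<Theta>"

text \<open>Functions of growth at most \<open>exp (rate * t)\<close> are represented by bounded continuous ones.\<close>

definition unweight :: "(('n torus \<times> real) \<Rightarrow>\<^sub>C (real ^ 'm)) \<Rightarrow> 'n torus \<times> real \<Rightarrow> real ^ 'm" where
  "unweight w z = exp (rate * max 0 (snd z)) *\<^sub>R apply_bcontfun w z"

definition weighted_value :: "(('n torus \<times> real) \<Rightarrow>\<^sub>C (real ^ 'm)) \<Rightarrow> 'n torus \<times> real \<Rightarrow> real ^ 'm" where
  "weighted_value w z =
    (\<chi> i. exp (- rate * max 0 (snd z)) * component_value i (unweight w) (torus_rep (fst z)) (max 0 (snd z)))"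

lemma rate_pos: "0 < rate"
  using \<Theta>_pos by (simp add: rate_def)

lemma continuous_unweight: "continuous_on UNIV (unweight w)"
  unfolding unweight_def by (intro continuous_intros continuous_on_apply_bcontfun)

lemma weighted_value_bcontfun: "weighted_value w \<in> bcontfun"
proof -
  note tv = tonelli_valueI[OF continuous_unweight[of w]]
  have "\<exists>D. \<forall>X t. 0 \<le> t \<longrightarrow> \<bar>component_value i (unweight w) X t\<bar> \<le> D * exp (rate * t)" for i
  proof (rule tonelli_value.value_fn_exp_bounded[OF tv rate_pos])
    show "0 \<le> \<Theta> * norm w" using \<Theta>_pos by simp
    fix x and s :: real assume "0 \<le> s"
    have "infnorm (unweight w (x, s)) \<le> norm (unweight w (x, s))" by (rule infnorm_le_norm)
    also have "\<dots> \<le> norm w * exp (rate * s)"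
      using \<open>0 \<le> s\<close> norm_bounded[of w "(x, s)"] by (simp add: unweight_def mult.commute)
    finally show "\<Theta> * infnorm (unweight w (x, s)) \<le> \<Theta> * norm w * exp (rate * s)"
      using \<Theta>_pos by simp
  qed
  then have "\<forall>i. \<exists>D. \<forall>X t. 0 \<le> t \<longrightarrow> \<bar>component_value i (unweight w) X t\<bar> \<le> D * exp (rate * t)" ..
  from choice[OF this] obtain D where
    D: "\<And>i X t. 0 \<le> t \<Longrightarrow> \<bar>component_value i (unweight w) X t\<bar> \<le> D i * exp (rate * t)" by blast
  show ?thesis
  proof (rule bcontfun_normI)
    show "continuous_on UNIV (weighted_value w)"
      unfolding weighted_value_def
      by (intro continuous_on_vec_lambda continuous_intros tonelli_value.continuous_on_value_fn[OF tv])
    fix z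
    have "norm (weighted_value w z) \<le> (\<Sum>i\<in>UNIV. \<bar>weighted_value w z $ i\<bar>)" by (rule norm_le_l1_cart)
    also have "\<dots> \<le> (\<Sum>i\<in>UNIV. D i)"
    proof (rule sum_mono)
      fix i
      have "\<bar>weighted_value w z $ i\<bar>
          = exp (- rate * max 0 (snd z)) * \<bar>component_value i (unweight w) (torus_rep (fst z)) (max 0 (snd z))\<bar>"
        by (simp add: weighted_value_def abs_mult)
      also have "\<dots> \<le> exp (- rate * max 0 (snd z)) * (D i * exp (rate * max 0 (snd z)))"
        by (intro mult_left_mono D) auto
      also have "\<dots> = D i" by (simp add: exp_minus)
      finally show "\<bar>weighted_value w z $ i\<bar> \<le> D i" .
    qed
    finally show "norm (weighted_value w z) \<le> (\<Sum>i\<in>UNIV. D i)" .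
  qed
qed

lemma component_value_contraction:
  assumes "0 \<le> t"
  shows "component_value i (unweight w) X t \<le> component_value i (unweight w') X t + \<Theta> * dist w w' / rate * exp (rate * t)"
proof (rule tonelli_value.value_fn_diff_le[OF tonelli_valueI[OF continuous_unweight]
      tonelli_valueI[OF continuous_unweight] rate_pos _ assms])
  show "0 \<le> \<Theta> * dist w w'" using \<Theta>_pos by simp
  fix x and s :: real assume "0 \<le> s"
  have "infnorm (unweight w (x, s) - unweight w' (x, s)) \<le> norm (unweight w (x, s) - unweight w' (x, s))"
    by (rule infnorm_le_norm)
  also have "\<dots> = exp (rate * s) * dist (apply_bcontfun w (x, s)) (apply_bcontfun w' (x, s))"
    using \<open>0 \<le> s\<close> by (simp add: unweight_def dist_norm flip: scaleR_diff_right)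
  also have "\<dots> \<le> exp (rate * s) * dist w w'"
    by (intro mult_left_mono dist_bounded) simp
  finally show "\<Theta> * infnorm (unweight w (x, s) - unweight w' (x, s)) \<le> \<Theta> * dist w w' * exp (rate * s)"
    using \<Theta>_pos by (simp add: mult.commute)
qed

lemma fixed_point_exists: "\<exists>w. apply_bcontfun w = weighted_value w"
proof -
  define F where "F w = Bcontfun (weighted_value w)" for w
  have F: "apply_bcontfun (F w) = weighted_value w" for w
    unfolding F_def by (rule Bcontfun_inverse[OF weighted_value_bcontfun])
  have "dist (F w) (F w') \<le> 1 / 2 * dist w w'" for w w'
  proof (rule dist_bound)
    fix z :: "'n torus \<times> real"
    define t where "t = max 0 (snd z)"
    have "dist (weighted_value w z) (weighted_value w' z)
        \<le> (\<Sum>i\<in>UNIV. \<bar>(weighted_value w z - weighted_value w' z) $ i\<bar>)"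
      unfolding dist_norm by (rule norm_le_l1_cart)
    also have "\<dots> \<le> (\<Sum>i\<in>(UNIV :: 'm set). \<Theta> * dist w w' / rate)"
    proof (rule sum_mono)
      fix i
      have "\<bar>component_value i (unweight w) (torus_rep (fst z)) t - component_value i (unweight w') (torus_rep (fst z)) t\<bar>
          \<le> \<Theta> * dist w w' / rate * exp (rate * t)"
        using component_value_contraction[of t i w "torus_rep (fst z)" w']
          component_value_contraction[of t i w' "torus_rep (fst z)" w]
        by (simp add: t_def abs_le_iff dist_commute)
      then have "exp (- rate * t) * \<bar>component_value i (unweight w) (torus_rep (fst z)) t - component_value i (unweight w') (torus_rep (fst z)) t\<bar>
          \<le> exp (- rate * t) * (\<Theta> * dist w w' / rate * exp (rate * t))"
        by (rule mult_left_mono) simp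
      also have "\<dots> = \<Theta> * dist w w' / rate" by (simp add: exp_minus)
      also have "exp (- rate * t) * \<bar>component_value i (unweight w) (torus_rep (fst z)) t - component_value i (unweight w') (torus_rep (fst z)) t\<bar>
          = \<bar>(weighted_value w z - weighted_value w' z) $ i\<bar>"
        by (simp add: weighted_value_def t_def abs_mult flip: right_diff_distrib)
      finally show "\<bar>(weighted_value w z - weighted_value w' z) $ i\<bar> \<le> \<Theta> * dist w w' / rate" .
    qed
    also have "\<dots> = 1 / 2 * dist w w'"
      using \<Theta>_pos by (simp add: rate_def)
    finally show "dist (apply_bcontfun (F w) z) (apply_bcontfun (F w') z) \<le> 1 / 2 * dist w w'"
      by (simp add: F)
  qed
  then have "\<exists>!w. F w = w" by (intro banach_fix_type[of "1 / 2"]) auto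
  then show ?thesis using F by metis
qed

lemma value_fixed_point:
  "\<exists>u. continuous_on UNIV u \<and> (\<forall>i X t. 0 \<le> t \<longrightarrow> u (to_torus X, t) $ i = component_value i u X t)"
proof -
  obtain w where w: "apply_bcontfun w = weighted_value w" using fixed_point_exists by blast
  define u where "u = unweight w"
  have cu: "continuous_on UNIV u" unfolding u_def by (rule continuous_unweight)
  have "u (to_torus X, t) $ i = component_value i u X t" if "0 \<le> t" for i X t
  proof -
    have "u (to_torus X, t) = exp (rate * t) *\<^sub>R weighted_value w (to_torus X, t)"
      using that by (simp add: u_def unweight_def w)
    then have "u (to_torus X, t) $ i
        = exp (rate * t) * (exp (- rate * t) * component_value i u (torus_rep (to_torus X)) t)"
      using that by (simp add: weighted_value_def flip: u_def)
    also have "\<dots> = component_value i u (torus_rep (to_torus X)) t" by (simp add: exp_minus)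
    also have "\<dots> = component_value i u X t"
      by (rule tonelli_value.value_fn_cong[OF tonelli_valueI[OF cu]]) simp
    finally show ?thesis .
  qed
  then show ?thesis using cu by blast
qed

text \<open>Test functions are lifted to Euclidean space, where the tests of the value function
  apply. By the fixed point property, the function inserted into the Hamiltonian is the solution
  itself.\<close>

lemma value_fixed_point_viscosity:
  assumes cu: "continuous_on UNIV u"
    and u: "\<And>i X t. 0 \<le> t \<Longrightarrow> u (to_torus X, t) $ i = component_value i u X t"
  shows "viscosity_solution H \<phi> u"
proof -
  note tv = tonelli_valueI[OF cu]
  have cont: "continuous_on (UNIV \<times> {0..}) u" using cu by (rule continuous_on_subset) simp
  have init: "u (x, 0) $ i = \<phi> x $ i" for x i
    using u[of 0 "torus_rep x" i] tonelli_value.value_fn_0[OF tv] by simp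
  have sub: "\<tau> + H i (to_torus X) q (u (to_torus X, t)) \<le> 0"
    if hyps: "0 < t" "C1_near (to_torus X, t) \<psi>"
      "\<forall>\<^sub>F z in nhds (to_torus X, t). u z $ i - \<psi> z \<le> u (to_torus X, t) $ i - \<psi> (to_torus X, t)"
      "GDERIV (\<lambda>Y. \<psi> (to_torus Y, t)) X :> q"
      "((\<lambda>s. \<psi> (to_torus X, s)) has_real_derivative \<tau>) (at t)" for i X t \<psi> q \<tau>
  proof -
    obtain d where "d > 0" and d: "\<And>Y s. dist Y X < d \<Longrightarrow> dist s t < d \<Longrightarrow>
        u (to_torus Y, s) $ i - \<psi> (to_torus Y, s) \<le> u (to_torus X, t) $ i - \<psi> (to_torus X, t)"
      using eventually_nhds_torus_lift[OF hyps(3)] by blast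
    show ?thesis
    proof (rule tonelli_value.value_fn_subsolution_test[OF tv hyps(1) C1_near_has_derivative[OF hyps(2,4,5)] \<open>d > 0\<close>])
      fix Y and s :: real assume "0 \<le> s" "dist Y X < d" "dist s t < d"
      then show "component_value i u Y s - (\<lambda>(Y, s). \<psi> (to_torus Y, s)) (Y, s)
          \<le> component_value i u X t - (\<lambda>(Y, s). \<psi> (to_torus Y, s)) (X, t)"
        using d[of Y s] u[of s Y i] u[of t X i] \<open>0 < t\<close> by simp
    qed
  qed
  have sup: "\<tau> + H i (to_torus X) q (u (to_torus X, t)) \<ge> 0"
    if hyps: "0 < t" "C1_near (to_torus X, t) \<psi>"
      "\<forall>\<^sub>F z in nhds (to_torus X, t). u z $ i - \<psi> z \<ge> u (to_torus X, t) $ i - \<psi> (to_torus X, t)"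
      "GDERIV (\<lambda>Y. \<psi> (to_torus Y, t)) X :> q"
      "((\<lambda>s. \<psi> (to_torus X, s)) has_real_derivative \<tau>) (at t)" for i X t \<psi> q \<tau>
  proof -
    obtain d where "d > 0" and d: "\<And>Y s. dist Y X < d \<Longrightarrow> dist s t < d \<Longrightarrow>
        u (to_torus Y, s) $ i - \<psi> (to_torus Y, s) \<ge> u (to_torus X, t) $ i - \<psi> (to_torus X, t)"
      using eventually_nhds_torus_lift[OF hyps(3)] by blast
    obtain B where B: "\<And>Y s. 0 \<le> s \<Longrightarrow> s \<le> t \<Longrightarrow> \<bar>component_value i u Y s\<bar> \<le> B"
      using tonelli_value.value_fn_bounded[OF tv, of t] by blast
    show ?thesis
    proof (rule tonelli_value.value_fn_supersolution_test[OF tv hyps(1) C1_near_has_derivative[OF hyps(2,4,5)] \<open>d > 0\<close> _ B])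
      fix Y and s :: real assume "0 \<le> s" "dist Y X < d" "dist s t < d"
      then show "component_value i u Y s - (\<lambda>(Y, s). \<psi> (to_torus Y, s)) (Y, s)
          \<ge> component_value i u X t - (\<lambda>(Y, s). \<psi> (to_torus Y, s)) (X, t)"
        using d[of Y s] u[of s Y i] u[of t X i] \<open>0 < t\<close> by simp
    qed
  qed
  show ?thesis
    unfolding viscosity_solution_def viscosity_subsolution_def viscosity_supersolution_def
    using cont init sub sup by (intro conjI allI impI) auto
qed

end

theorem theorem1p1:
  fixes H :: "'m::finite \<Rightarrow> ('n::finite, 'm) hamiltonian"
    and \<phi> :: "'n torus \<Rightarrow> real ^ 'm"
  assumes "CARD('n) > 1" and "CARD('m) > 1"
    and "\<And>i. C2_hamiltonian (H i)"
    and H1: "\<And>i x u. strictly_convex (\<lambda>p. H i x p u)"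
    and H2: "\<And>i x u. superlinear (\<lambda>p. H i x p u)"
    and H3: "\<And>i. Lipschitz_in_value (H i)"
    and "continuous_on UNIV \<phi>"
  shows "\<exists>u :: 'n torus \<times> real \<Rightarrow> real ^ 'm.
           viscosity_solution H \<phi> u \<and>
           (\<forall>v. viscosity_solution H \<phi> v \<longrightarrow> (\<forall>x. \<forall>t\<ge>0. v (x, t) = u (x, t))) \<and>
           (\<forall>i x t. 0 \<le> t \<longrightarrow>
              ereal (u (x, t) $ i) =
                (INF \<gamma>\<in>{\<gamma>. abs_continuous_on 0 t \<gamma> \<and> \<gamma> t = x}.
                   ereal (\<phi> (\<gamma> 0) $ i) + action (H i) u t \<gamma>))"
proof -
  have "\<forall>i. \<exists>\<Theta>>0. \<forall>x p u v. \<bar>H i x p u - H i x p v\<bar> \<le> \<Theta> * infnorm (u - v)"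
    using H3 unfolding Lipschitz_in_value_def by blast
  from choice[OF this] obtain \<theta> where \<theta>: "\<And>i. 0 < \<theta> i"
    "\<And>i x p u v. \<bar>H i x p u - H i x p v\<bar> \<le> \<theta> i * infnorm (u - v)" by blast
  \<comment> \<open>Each component comes with its own Lipschitz constant; the sum of these positive
    numbers dominates them all.\<close>
  define \<Theta> where "\<Theta> = (\<Sum>i\<in>UNIV. \<theta> i)"
  have \<theta>_le: "\<theta> i \<le> \<Theta>" for i
    unfolding \<Theta>_def using \<theta>(1) by (intro member_le_sum) (auto intro: less_imp_le)
  have "tonelli (H i) \<Theta>" for i
  proof
    show "0 < \<Theta>" using \<theta>(1)[of i] \<theta>_le[of i] by linarith
    show "\<bar>H i x p u - H i x p v\<bar> \<le> \<Theta> * infnorm (u - v)" for x p u v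
      using \<theta>(2) mult_right_mono[OF \<theta>_le infnorm_pos_le] by (rule order_trans)
  qed (fact assms)+
  then interpret tonelli_cauchy H \<Theta> \<phi>
    using assms(7) by (intro tonelli_cauchy.intro tonelli_system.intro tonelli_cauchy_axioms.intro)
  obtain u where cu: "continuous_on UNIV u"
    and u: "\<And>i X t. 0 \<le> t \<Longrightarrow> u (to_torus X, t) $ i = component_value i u X t"
    using value_fixed_point by blast
  have sol: "viscosity_solution H \<phi> u" by (rule value_fixed_point_viscosity[OF cu u])
  show ?thesis
  proof (intro exI[of _ u] conjI allI impI)
    show "viscosity_solution H \<phi> u" by (rule sol)
    show "v (x, t) = u (x, t)" if "viscosity_solution H \<phi> v" "0 \<le> t" for v x t
      by (rule viscosity_solution_unique[OF that(1) sol that(2)])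
    fix i x and t :: real assume "0 \<le> t"
    show "ereal (u (x, t) $ i) = (INF \<gamma>\<in>{\<gamma>. abs_continuous_on 0 t \<gamma> \<and> \<gamma> t = x}.
        ereal (\<phi> (\<gamma> 0) $ i) + action (H i) u t \<gamma>)"
      using tonelli_value.value_fn_eq_INF[OF tonelli_valueI[OF cu] \<open>0 \<le> t\<close>, of i "torus_rep x"]
        u[OF \<open>0 \<le> t\<close>, of "torus_rep x" i] by simp
  qed
qed

end
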